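(* Assume that $u\in\dot B^{s}_{r,\infty,\infty}(\mathbb{R}^n)\cap\dot B^{0}_{q,\infty,\infty}(\mathbb{R}^n)$ with $1<q,r\le\infty$ and $0\le\sigma<s<\infty$. Then there exists a positive constant $C=C(n,q,p,r,s,\sigma)$ such that $$\|u\|_{\dot B^{\sigma}_{p,1,1}}\le C\,\|u\|_{\dot B^{0}_{q,\infty,\infty}}^{\theta}\,\|u\|_{\dot B^{s}_{r,\infty,\infty}}^{1-\theta},$$ with $$\frac{n}{p}-\sigma=\theta\,\frac{n}{q}+(1-\theta)\left(\frac{n}{r}-s\right),\qquad 0<\theta<1-\frac{\sigma}{s},\qquad s-\frac{n}{r}\neq\sigma-\frac{n}{p}.$$
   Context: Lorentz spaces: for measurable $f$ on $\mathbb{R}^n$, let $f_*(\alpha)=|\{x:|f(x)|>\alpha\}|$ and $f^*(t)=\inf\{\alpha>0: f_*(\alpha)\le t\}$. For $p,q\in(0,\infty]$ put $\|f\|_{L^{p,q}(\mathbb{R}^n)}=\left(\int_0^\infty (t^{1/p}f^*(t))^q\,\frac{dt}{t}\right)^{1/q}$ if $q<\infty$ and $\|f\|_{L^{p,\infty}(\mathbb{R}^n)}=\sup_{t>0}t^{1/p}f^*(t)$. In particular $L^{\infty,\infty}=L^\infty$ and $L^{\infty,q}=\{0\}$ for $0<q<\infty$. Littlewood–Paley decomposition: fix a nonnegative radial function $\varphi\in C^\infty(\mathbb{R}^n)$ supported in $\{\frac34\le|\xi|\le\frac83\}$ with $\sum_{j\in\mathbb{Z}}\varphi(2^{-j}\xi)=1$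 for all $\xi\ne0$, and set $\dot\Delta_j f=\varphi(2^{-j}D)f$, i.e. $\widehat{\dot\Delta_j f}(\xi)=\varphi(2^{-j}\xi)\widehat f(\xi)$, $j\in\mathbb{Z}$. Besov–Lorentz spaces: $\dot B^{s}_{p,q,r}(\mathbb{R}^n)$ is the set of $f\in\mathcal{S}'(\mathbb{R}^n)/\mathcal{P}(\mathbb{R}^n)$ (tempered distributions modulo polynomials) such that $\|f\|_{\dot B^s_{p,q,r}}:=\left\|\{2^{js}\|\dot\Delta_j f\|_{L^{p,q}(\mathbb{R}^n)}\}_{j\in\mathbb{Z}}\right\|_{\ell^r(\mathbb{Z})}<\infty$.
   Formalization: The formal theorem assumes 0<p<∞; p=∞ is excluded because L^{∞,1}={0} makes the left-hand norm infinite for every nonzero u, so the inequality fails there (e.g. n=1, q=r=2, σ=0, s=1, θ=1/2). *)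

theory Defs
  imports "HOL-Analysis.Analysis"
begin

section \<open>Lorentz quasi-norms\<close>

text \<open>
  Exponents live in \<^typ>\<open>ennreal\<close>; \<open>recip p\<close> is the real number \<open>1/p\<close>, with \<open>1/\<infinity> = 0\<close>.
  It is only used for \<open>p > 0\<close>.
\<close>

definition recip :: "ennreal \<Rightarrow> real"
  where "recip p = enn2real (1 / p)"

text \<open>Real powers of extended nonnegative reals; only used for exponents \<open>a > 0\<close>.\<close>

definition ennpowr :: "ennreal \<Rightarrow> real \<Rightarrow> ennreal"
  where "ennpowr x a = (if x = \<infinity> then \<infinity> else ennreal (enn2real x powr a))"

definition distribution_function :: "('a::euclidean_space \<Rightarrow> complex) \<Rightarrow> real \<Rightarrow> ennreal"
  where "distribution_function f \<alpha> = emeasure lebesgue {x. cmod (f x) > \<alpha>}"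

definition decreasing_rearrangement :: "('a::euclidean_space \<Rightarrow> complex) \<Rightarrow> real \<Rightarrow> ennreal"
  where "decreasing_rearrangement f t =
    Inf {ennreal \<alpha> | \<alpha>. \<alpha> > 0 \<and> distribution_function f \<alpha> \<le> ennreal t}"

definition lorentz_norm :: "ennreal \<Rightarrow> ennreal \<Rightarrow> ('a::euclidean_space \<Rightarrow> complex) \<Rightarrow> ennreal"
  where "lorentz_norm p q f =
    (if q = \<infinity> then SUP t\<in>{0<..}. ennreal (t powr recip p) * decreasing_rearrangement f t
     else ennpowr
       (\<integral>\<^sup>+t\<in>{0<..}. ennpowr (ennreal (t powr recip p) * decreasing_rearrangement f t) (enn2real q)
          / ennreal t \<partial>lborel)
       (recip q))"

definition lr_norm :: "ennreal \<Rightarrow> (int \<Rightarrow> ennreal) \<Rightarrow> ennreal"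
  where "lr_norm r a =
    (if r = \<infinity> then SUP j. a j else ennpowr (\<Sum>\<^sub>\<infinity>j. ennpowr (a j) (enn2real r)) (recip r))"


section \<open>Schwartz functions and tempered distributions\<close>

definition partial_deriv ::
    "'n::finite \<Rightarrow> (real^'n \<Rightarrow> 'b::real_normed_vector) \<Rightarrow> real^'n \<Rightarrow> 'b"
  where "partial_deriv i f x = frechet_derivative f (at x) (axis i 1)"

definition partial_derivs ::
    "'n::finite list \<Rightarrow> (real^'n \<Rightarrow> 'b::real_normed_vector) \<Rightarrow> real^'n \<Rightarrow> 'b"
  where "partial_derivs is f = foldr partial_deriv is f"

text \<open>
  \<open>C\<^sup>\<infinity>\<close>: every iterated partial derivative exists and is differentiable
  (hence continuous) everywhere.
\<close>

definition smooth :: "(real^'n::finite \<Rightarrow> 'b::real_normed_vector) \<Rightarrow> bool"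
  where "smooth f \<longleftrightarrow> (\<forall>is. partial_derivs is f differentiable_on UNIV)"

definition schwartz :: "(real^'n::finite \<Rightarrow> complex) set"
  where "schwartz = {\<psi>. smooth \<psi> \<and>
    (\<forall>k is. bdd_above (range (\<lambda>x. (1 + norm x) ^ k * cmod (partial_derivs is \<psi> x))))}"

definition schwartz_seminorm :: "nat \<Rightarrow> 'n::finite list \<Rightarrow> (real^'n \<Rightarrow> complex) \<Rightarrow> real"
  where "schwartz_seminorm k is \<psi> = (SUP x. (1 + norm x) ^ k * cmod (partial_derivs is \<psi> x))"

text \<open>
  A distribution is a functional on functions of which only the values on \<^term>\<open>schwartz\<close> matter;
  functionals that agree there are identified by \<open>mod_poly\<close> below.
\<close>

type_synonym 'n dist = "(real^'n \<Rightarrow> complex) \<Rightarrow> complex"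

definition tempered :: "'n::finite dist set"
  where "tempered = {u.
    (\<forall>\<psi>\<in>schwartz. \<forall>\<eta>\<in>schwartz. \<forall>a b. u (\<lambda>x. a * \<psi> x + b * \<eta> x) = a * u \<psi> + b * u \<eta>) \<and>
    (\<exists>C N. \<forall>\<psi>\<in>schwartz.
       cmod (u \<psi>) \<le> C * (\<Sum>is\<in>{is. length is \<le> N}. schwartz_seminorm N is \<psi>))}"

definition mod_poly :: "('n::finite dist \<times> 'n dist) set"
  where "mod_poly = {(u, v). u \<in> tempered \<and> v \<in> tempered \<and>
    (\<exists>P. polynomial_function P \<and>
       (\<forall>\<psi>\<in>schwartz. u \<psi> - v \<psi> = (LINT x|lborel. P x * \<psi> x)))}"

definition tempered_mod_poly :: "'n::finite dist set set"
  where "tempered_mod_poly = tempered // mod_poly"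

definition represents :: "(real^'n::finite \<Rightarrow> complex) \<Rightarrow> 'n dist \<Rightarrow> bool"
  where "represents g u \<longleftrightarrow> g \<in> borel_measurable lebesgue \<and>
    (\<forall>\<psi>\<in>schwartz. integrable lebesgue (\<lambda>x. g x * \<psi> x) \<and> u \<psi> = (LINT x|lebesgue. g x * \<psi> x))"

text \<open>
  Any two functions representing \<open>u\<close> agree almost everywhere, so the infimum is over at most one
  value; it is \<open>\<infinity>\<close> if \<open>u\<close> is not given by a function.
\<close>

definition lorentz_norm_dist :: "ennreal \<Rightarrow> ennreal \<Rightarrow> 'n::finite dist \<Rightarrow> ennreal"
  where "lorentz_norm_dist p q u = Inf {lorentz_norm p q g | g. represents g u}"


section \<open>Fourier multipliers and Littlewood--Paley blocks\<close>

definition fourier :: "(real^'n::finite \<Rightarrow> complex) \<Rightarrow> real^'n \<Rightarrow> complex"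
  where "fourier f \<xi> = (LINT x|lborel. cis (- (x \<bullet> \<xi>)) * f x)"

definition inv_fourier :: "(real^'n::finite \<Rightarrow> complex) \<Rightarrow> real^'n \<Rightarrow> complex"
  where "inv_fourier f x =
    (LINT \<xi>|lborel. cis (x \<bullet> \<xi>) * f \<xi>) / complex_of_real ((2 * pi) ^ CARD('n))"

definition fourier_dist :: "'n::finite dist \<Rightarrow> 'n dist"
  where "fourier_dist u = (\<lambda>\<psi>. u (fourier \<psi>))"

definition inv_fourier_dist :: "'n::finite dist \<Rightarrow> 'n dist"
  where "inv_fourier_dist u = (\<lambda>\<psi>. u (inv_fourier \<psi>))"

definition mult_dist :: "(real^'n::finite \<Rightarrow> real) \<Rightarrow> 'n dist \<Rightarrow> 'n dist"
  where "mult_dist m u = (\<lambda>\<psi>. u (\<lambda>\<xi>. complex_of_real (m \<xi>) * \<psi> \<xi>))"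

definition littlewood_paley :: "(real^'n::finite \<Rightarrow> real) \<Rightarrow> bool"
  where "littlewood_paley \<phi> \<longleftrightarrow>
    smooth \<phi> \<and> (\<forall>\<xi>. 0 \<le> \<phi> \<xi>) \<and>
    (\<forall>\<xi> \<eta>. norm \<xi> = norm \<eta> \<longrightarrow> \<phi> \<xi> = \<phi> \<eta>) \<and>
    closure {\<xi>. \<phi> \<xi> \<noteq> 0} \<subseteq> {\<xi>. 3/4 \<le> norm \<xi> \<and> norm \<xi> \<le> 8/3} \<and>
    (\<forall>\<xi>. \<xi> \<noteq> 0 \<longrightarrow> ((\<lambda>j::int. \<phi> (2 powi (-j) *\<^sub>R \<xi>)) has_sum 1) UNIV)"

definition lp_block :: "(real^'n::finite \<Rightarrow> real) \<Rightarrow> int \<Rightarrow> 'n dist \<Rightarrow> 'n dist"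
  where "lp_block \<phi> j u =
    inv_fourier_dist (mult_dist (\<lambda>\<xi>. \<phi> (2 powi (-j) *\<^sub>R \<xi>)) (fourier_dist u))"


section \<open>Homogeneous Besov--Lorentz spaces\<close>

definition besov_lorentz_norm_dist ::
    "(real^'n::finite \<Rightarrow> real) \<Rightarrow> real \<Rightarrow> ennreal \<Rightarrow> ennreal \<Rightarrow> ennreal \<Rightarrow> 'n dist \<Rightarrow> ennreal"
  where "besov_lorentz_norm_dist \<phi> s p q r u =
    lr_norm r (\<lambda>j. ennreal (2 powr (real_of_int j * s)) * lorentz_norm_dist p q (lp_block \<phi> j u))"

text \<open>
  The blocks annihilate polynomials, because \<open>\<phi>\<close> vanishes near the origin.
  Hence all representatives of a class have the same norm, and any one of them may be used.
\<close>

definition besov_lorentz_norm ::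
    "(real^'n::finite \<Rightarrow> real) \<Rightarrow> real \<Rightarrow> ennreal \<Rightarrow> ennreal \<Rightarrow> ennreal \<Rightarrow> 'n dist set \<Rightarrow> ennreal"
  where "besov_lorentz_norm \<phi> s p q r U = besov_lorentz_norm_dist \<phi> s p q r (SOME u. u \<in> U)"

definition besov_lorentz ::
    "(real^'n::finite \<Rightarrow> real) \<Rightarrow> real \<Rightarrow> ennreal \<Rightarrow> ennreal \<Rightarrow> ennreal \<Rightarrow> 'n dist set set"
  where "besov_lorentz \<phi> s p q r =
    {U \<in> tempered_mod_poly. besov_lorentz_norm \<phi> s p q r U < \<infinity>}"

end

(*
  A function g representing the block Delta_j u satisfies g = K_j * g for a kernel K_j (x) =
  2^(jn) K (2^j x) with K in L^1 and L^infinity.  Splitting g at the height a = N 2^(jnb), a weak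
  bound g^* (t) <= N t^(-b) with 0 < b < 1 gives |g| <= C a almost everywhere, and integrating
  min (C a) (N t^(-b)) yields the Bernstein inequality
  |g|_{p,1} <= C 2^(jn(b - 1/p)) N for 1/p < b.

  The weak bounds of exponents q and r interpolate pointwise in t, with N = A^eta B_j^(1 - eta) and
  b = eta/q + (1 - eta)/r.  Taking eta = theta + eps and eta = theta - eps bounds the j-th term of
  the Besov norm by the smaller of two geometric sequences in j with ratios 2^(eps kappa) and
  2^(-eps kappa), where kappa = n/q - n/r + s is nonzero because s - n/r and sigma - n/p differ.
  Their minimum sums to a multiple of A^theta B^(1 - theta).

  Fourier inversion is needed only up to a nonzero constant factor; this avoids Gaussians.  The
  approximate identities come from translates and dilates of phi itself.
*)

theory Submission
  imports Defs
begin

text \<open>A distribution here is only a functional on Schwartz functions, and a function in weak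
  L^q need not be integrable, so the identity g = K_j * g cannot be read off from g directly. It is
  proved by duality: a block takes the same value at a test function psi and at the smoothed
  function K_j * psi, and the kernel is then moved onto g by Fubini. The multiplier behind K is a
  multiple of the sum of three neighbouring dilates of phi, which is constant on the support of phi.
  Since it has compact support, only Fourier transforms of compactly supported smooth functions ever
  have to be Schwartz.

  There is room for eps because theta < 1 - sigma/s is the strict inequality 1/p < b at eta = theta:
  the scaling relation gives n (b - 1/p) = s (1 - theta) - sigma there. The same relation makes all
  powers of 2^j cancel at theta, so the bound at theta alone would be constant in j and not
  summable. This forces the use of exponents on both sides of theta.\<close>

section \<open>Smooth functions\<close>

lemma partial_deriv_eq:
  "(f has_derivative D) (at x) \<Longrightarrow> partial_deriv i f x = D (axis i 1)"
  unfolding partial_deriv_def using frechet_derivative_at by metis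

lemma partial_derivs_Nil [simp]: "partial_derivs [] f = f"
  by (simp add: partial_derivs_def)

lemma partial_derivs_snoc: "partial_derivs (is @ [i]) f = partial_derivs is (partial_deriv i f)"
  by (simp add: partial_derivs_def)

text \<open>The iterated derivatives of f never leave S. Closure of smoothness under an operation
  thus reduces to guessing a class that is stable under a single derivative, in place of a formula
  for iterated ones.\<close>

lemma smooth_coinduct:
  assumes "f \<in> S"
    and diff: "\<And>g. g \<in> S \<Longrightarrow> g differentiable_on UNIV"
    and closed: "\<And>g i. g \<in> S \<Longrightarrow> partial_deriv i g \<in> S"
  shows "smooth f"
proof -
  have "partial_derivs is f \<in> S" for "is"
    by (induction "is") (simp_all add: partial_derivs_def \<open>f \<in> S\<close> closed)
  then show ?thesis
    by (simp add: smooth_def diff)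
qed

lemma smooth_has_derivative:
  "smooth f \<Longrightarrow> (f has_derivative frechet_derivative f (at x)) (at x)"
  using frechet_derivative_works by (metis UNIV_I differentiable_on_def partial_derivs_Nil smooth_def)

lemma smooth_differentiable_on: "smooth f \<Longrightarrow> f differentiable_on UNIV"
  by (metis partial_derivs_Nil smooth_def)

lemma smooth_partial_deriv: "smooth f \<Longrightarrow> smooth (partial_deriv i f)"
  by (metis partial_derivs_snoc smooth_def)

lemma smooth_continuous_on: "smooth f \<Longrightarrow> continuous_on A f"
  using smooth_differentiable_on differentiable_imp_continuous_on continuous_on_subset by blast

lemma differentiable_on_UNIV_I:
  "(\<And>x. (f has_derivative D x) (at x)) \<Longrightarrow> f differentiable_on UNIV"
  by (auto simp: differentiable_on_def differentiable_def)

lemma smooth_const: "smooth (\<lambda>x. c)"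
proof (rule smooth_coinduct[where S = "range (\<lambda>c x. c)"])
  fix g :: "real^'n \<Rightarrow> 'b" and i assume "g \<in> range (\<lambda>c x. c)"
  then obtain c where g: "g = (\<lambda>x. c)" by blast
  show "g differentiable_on UNIV" by (simp add: g)
  have "partial_deriv i g = (\<lambda>x. 0)"
    by (rule ext) (simp add: g partial_deriv_def)
  then show "partial_deriv i g \<in> range (\<lambda>c x. c)" by auto
qed auto

lemma smooth_bounded_linear_compose:
  fixes f :: "real^'n::finite \<Rightarrow> 'b::real_normed_vector" and L :: "'b \<Rightarrow> 'c::real_normed_vector"
  assumes L: "bounded_linear L" and f: "smooth f"
  shows "smooth (\<lambda>x. L (f x))"
proof (rule smooth_coinduct[where S = "{\<lambda>x. L (f x) |f. smooth f}"])
  fix g :: "real^'n \<Rightarrow> 'c" and i assume "g \<in> {\<lambda>x. L (f x) |f. smooth f}"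
  then obtain f where f: "smooth f" and g: "g = (\<lambda>x. L (f x))" by blast
  have D: "(g has_derivative (\<lambda>h. L (frechet_derivative f (at x) h))) (at x)" for x
    unfolding g using bounded_linear.has_derivative[OF L smooth_has_derivative[OF f]] .
  then show "g differentiable_on UNIV" by (rule differentiable_on_UNIV_I)
  have "partial_deriv i g = (\<lambda>x. L (partial_deriv i f x))"
    by (rule ext) (unfold partial_deriv_eq[OF D], simp add: partial_deriv_def)
  then show "partial_deriv i g \<in> {\<lambda>x. L (f x) |f. smooth f}"
    using smooth_partial_deriv[OF f] by blast
qed (use f in blast)

lemma smooth_affine_compose:
  fixes f :: "real^'n::finite \<Rightarrow> 'b::real_normed_vector"
  assumes f: "smooth f"
  shows "smooth (\<lambda>x. f (a *\<^sub>R x + b))"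
\<comment> \<open>The factor c absorbs the power of a that each application of the chain rule
  produces.\<close>
proof (rule smooth_coinduct[where S = "{\<lambda>x. c *\<^sub>R f (a *\<^sub>R x + b) |c f. smooth f}"])
  fix g :: "real^'n \<Rightarrow> 'b" and i assume "g \<in> {\<lambda>x. c *\<^sub>R f (a *\<^sub>R x + b) |c f. smooth f}"
  then obtain c f where f: "smooth f" and g: "g = (\<lambda>x. c *\<^sub>R f (a *\<^sub>R x + b))" by blast
  have D: "(g has_derivative (\<lambda>h. c *\<^sub>R frechet_derivative f (at (a *\<^sub>R x + b)) (a *\<^sub>R h))) (at x)" for x
    unfolding g
    by (rule has_derivative_scaleR_right,
        rule has_derivative_compose[where f = "\<lambda>x. a *\<^sub>R x + b", OF _ smooth_has_derivative[OF f]])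
       (auto intro!: derivative_eq_intros)
  then show "g differentiable_on UNIV" by (rule differentiable_on_UNIV_I)
  have lin: "linear (frechet_derivative f (at y))" for y
    using has_derivative_bounded_linear[OF smooth_has_derivative[OF f]] bounded_linear.linear by blast
  have "partial_deriv i g = (\<lambda>x. (c * a) *\<^sub>R partial_deriv i f (a *\<^sub>R x + b))"
    by (rule ext) (unfold partial_deriv_eq[OF D], simp add: partial_deriv_def linear_scale[OF lin])
  then show "partial_deriv i g \<in> {\<lambda>x. c *\<^sub>R f (a *\<^sub>R x + b) |c f. smooth f}"
    using smooth_partial_deriv[OF f] by blast
next
  have "(\<lambda>x. f (a *\<^sub>R x + b)) = (\<lambda>x. 1 *\<^sub>R f (a *\<^sub>R x + b))" by simp
  then show "(\<lambda>x. f (a *\<^sub>R x + b)) \<in> {\<lambda>x. c *\<^sub>R f (a *\<^sub>R x + b) |c f. smooth f}"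
    using f by blast
qed

lemma smooth_scaleR_compose:
  fixes f :: "real^'n::finite \<Rightarrow> 'b::real_normed_vector"
  assumes f: "smooth f"
  shows "smooth (\<lambda>x. f (a *\<^sub>R x))"
  using smooth_affine_compose[OF f, of a 0] by simp

lemma smooth_add:
  fixes f g :: "real^'n::finite \<Rightarrow> 'b::real_normed_vector"
  assumes "smooth f" "smooth g"
  shows "smooth (\<lambda>x. f x + g x)"
proof (rule smooth_coinduct[where S = "{\<lambda>x. f x + g x |f g. smooth f \<and> smooth g}"])
  fix h :: "real^'n \<Rightarrow> 'b" and i assume "h \<in> {\<lambda>x. f x + g x |f g. smooth f \<and> smooth g}"
  then obtain f g where f: "smooth f" and g: "smooth g" and h: "h = (\<lambda>x. f x + g x)" by blast
  have D: "(h has_derivative (\<lambda>v. frechet_derivative f (at x) v + frechet_derivative g (at x) v)) (at x)" for x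
    unfolding h by (intro has_derivative_add smooth_has_derivative f g)
  then show "h differentiable_on UNIV" by (rule differentiable_on_UNIV_I)
  have "partial_deriv i h = (\<lambda>x. partial_deriv i f x + partial_deriv i g x)"
    by (rule ext) (unfold partial_deriv_eq[OF D], simp add: partial_deriv_def)
  then show "partial_deriv i h \<in> {\<lambda>x. f x + g x |f g. smooth f \<and> smooth g}"
    using smooth_partial_deriv[OF f] smooth_partial_deriv[OF g] by blast
qed (use assms in blast)

text \<open>The product rule leads from products to sums of products, so the invariant class behind
  \<open>smooth_mult\<close> has to be closed under sums as well.\<close>

inductive_set smooth_products :: "(real^'n::finite \<Rightarrow> 'b::real_normed_algebra) set" where
  prod: "smooth f \<Longrightarrow> smooth g \<Longrightarrow> (\<lambda>x. f x * g x) \<in> smooth_products"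
| add: "f \<in> smooth_products \<Longrightarrow> g \<in> smooth_products \<Longrightarrow> (\<lambda>x. f x + g x) \<in> smooth_products"

lemma smooth_products_closed:
  "h \<in> smooth_products \<Longrightarrow> h differentiable_on UNIV \<and> (\<forall>i. partial_deriv i h \<in> smooth_products)"
proof (induction rule: smooth_products.induct)
  case (prod f g)
  have D: "((\<lambda>x. f x * g x) has_derivative
      (\<lambda>v. f x * frechet_derivative g (at x) v + frechet_derivative f (at x) v * g x)) (at x)" for x
    by (intro has_derivative_mult smooth_has_derivative prod)
  have "partial_deriv i (\<lambda>x. f x * g x) = (\<lambda>x. f x * partial_deriv i g x + partial_deriv i f x * g x)" for i
    by (rule ext) (unfold partial_deriv_eq[OF D], simp add: partial_deriv_def)
  moreover have "(\<lambda>x. f x * partial_deriv i g x + partial_deriv i f x * g x) \<in> smooth_products" for i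
    by (intro smooth_products.intros prod smooth_partial_deriv)
  ultimately show ?case
    using differentiable_on_UNIV_I[OF D] by simp
next
  case (add f g)
  have f: "(f has_derivative frechet_derivative f (at x)) (at x)"
    and g: "(g has_derivative frechet_derivative g (at x)) (at x)" for x
    using add.IH by (auto simp: differentiable_on_def intro!: frechet_derivative_works[THEN iffD1])
  have D: "((\<lambda>x. f x + g x) has_derivative
      (\<lambda>v. frechet_derivative f (at x) v + frechet_derivative g (at x) v)) (at x)" for x
    by (intro has_derivative_add f g)
  have "partial_deriv i (\<lambda>x. f x + g x) = (\<lambda>x. partial_deriv i f x + partial_deriv i g x)" for i
    by (rule ext) (unfold partial_deriv_eq[OF D], simp add: partial_deriv_def)
  then show ?case
    using differentiable_on_UNIV_I[OF D] add.IH smooth_products.add by metis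
qed

lemma smooth_mult:
  fixes f g :: "real^'n::finite \<Rightarrow> 'b::real_normed_algebra"
  assumes "smooth f" "smooth g"
  shows "smooth (\<lambda>x. f x * g x)"
  by (rule smooth_coinduct[where S = smooth_products])
     (use assms smooth_products_closed smooth_products.prod in blast)+

lemma smooth_nth: "smooth (\<lambda>x::real^'n::finite. x $ i)"
proof (rule smooth_coinduct[where S = "insert (\<lambda>x. x $ i) (range (\<lambda>c x. c))"])
  fix g :: "real^'n \<Rightarrow> real" and k assume "g \<in> insert (\<lambda>x. x $ i) (range (\<lambda>c x. c))"
  then consider "g = (\<lambda>x. x $ i)" | c where "g = (\<lambda>x. c)" by blast
  then have "g differentiable_on UNIV \<and> partial_deriv k g \<in> range (\<lambda>c x. c)"
  proof cases
    case 1
    have D: "(g has_derivative (\<lambda>v. v $ i)) (at x)" for x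
      unfolding 1 by (rule bounded_linear_imp_has_derivative, rule bounded_linear_vec_nth)
    have "partial_deriv k g = (\<lambda>x. axis k 1 $ i)"
      by (rule ext) (simp add: partial_deriv_eq[OF D])
    then show ?thesis using differentiable_on_UNIV_I[OF D] by auto
  next
    case 2
    have "partial_deriv k g = (\<lambda>x. 0)"
      by (rule ext) (simp add: 2 partial_deriv_def)
    then show ?thesis using 2 by auto
  qed
  then show "g differentiable_on UNIV" "partial_deriv k g \<in> insert (\<lambda>x. x $ i) (range (\<lambda>c x. c))"
    by auto
qed auto

section \<open>Test functions\<close>

text \<open>The space of compactly supported smooth functions, with the support controlled by a
  radius. Integrals against continuous weights converge here; \<open>fourier\<close> leads from this
  space into \<open>schwartz\<close>.\<close>

definition testfun :: "(real^'n::finite \<Rightarrow> complex) set"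
  where "testfun = {f. smooth f \<and> (\<exists>R. \<forall>x. R < norm x \<longrightarrow> f x = 0)}"

lemma testfun_smooth: "f \<in> testfun \<Longrightarrow> smooth f"
  by (simp add: testfun_def)

lemma testfunE:
  assumes "f \<in> testfun"
  obtains R where "R > 0" "\<And>x. R < norm x \<Longrightarrow> f x = 0"
proof -
  obtain R where R: "\<forall>x. R < norm x \<longrightarrow> f x = 0" using assms by (auto simp: testfun_def)
  show ?thesis by (rule that[of "max R 1"]) (use R in auto)
qed

lemma testfun_mult_left: "smooth f \<Longrightarrow> g \<in> testfun \<Longrightarrow> (\<lambda>x. f x * g x) \<in> testfun"
  unfolding testfun_def using smooth_mult[of f g] by fastforce

lemma testfun_mult_right: "f \<in> testfun \<Longrightarrow> smooth g \<Longrightarrow> (\<lambda>x. f x * g x) \<in> testfun"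
  unfolding testfun_def using smooth_mult[of f g] by fastforce

lemma testfun_cmult: "g \<in> testfun \<Longrightarrow> (\<lambda>x. c * g x) \<in> testfun"
  by (rule testfun_mult_left[OF smooth_const])

lemma testfun_affine_compose:
  assumes f: "f \<in> testfun" and a: "a \<noteq> 0"
  shows "(\<lambda>x. f (a *\<^sub>R x + b)) \<in> testfun"
proof -
  obtain R where R: "\<And>x. R < norm x \<Longrightarrow> f x = 0" using testfunE[OF f] by blast
  have "f (a *\<^sub>R x + b) = 0" if "(R + norm b) / \<bar>a\<bar> < norm x" for x
  proof (rule R)
    have "R + norm b < norm (a *\<^sub>R x)" using that a by (simp add: field_simps)
    also have "\<dots> \<le> norm (a *\<^sub>R x + b) + norm b" using norm_triangle_ineq4[of "a *\<^sub>R x + b" b] by simp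
    finally show "R < norm (a *\<^sub>R x + b)" by simp
  qed
  then show ?thesis
    unfolding testfun_def using smooth_affine_compose[OF testfun_smooth[OF f]] by blast
qed

lemma testfun_partial_deriv:
  assumes f: "f \<in> testfun"
  shows "partial_deriv i f \<in> testfun"
proof -
  obtain R where R: "\<And>x. R < norm x \<Longrightarrow> f x = 0" using testfunE[OF f] by blast
  have "partial_deriv i f x = 0" if "R < norm x" for x
  proof -
    \<comment> \<open>Beyond radius R the function is locally zero, so its derivative at x is that
      of the zero function.\<close>
    have "frechet_derivative f (at x) = frechet_derivative (\<lambda>x. 0) (at x)"
      by (rule frechet_derivative_transform_within_open[of _ _ "{x. R < norm x}"])
         (use R that smooth_differentiable_on[OF testfun_smooth[OF f]] in
          \<open>auto simp: differentiable_on_def open_Collect_less continuous_intros\<close>)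
    then show ?thesis by (simp add: partial_deriv_def)
  qed
  then show ?thesis
    unfolding testfun_def using smooth_partial_deriv[OF testfun_smooth[OF f]] by blast
qed

lemma testfun_partial_derivs: "f \<in> testfun \<Longrightarrow> partial_derivs is f \<in> testfun"
  by (induction "is") (auto simp: partial_derivs_def intro: testfun_partial_deriv)

lemma testfun_continuous: "f \<in> testfun \<Longrightarrow> continuous_on A f"
  by (simp add: testfun_smooth smooth_continuous_on)

lemma testfun_measurable [measurable]: "f \<in> testfun \<Longrightarrow> f \<in> borel_measurable borel"
  by (simp add: testfun_continuous borel_measurable_continuous_onI)

lemma bounded_if_support_bounded:
  fixes f :: "'a::euclidean_space \<Rightarrow> 'b::real_normed_vector"
  assumes "continuous_on UNIV f" and R: "\<And>x. R < norm x \<Longrightarrow> f x = 0"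
  shows "\<exists>B>0. \<forall>x. norm (f x) \<le> B"
proof -
  have "compact (f ` cball 0 R)"
    by (intro compact_continuous_image continuous_on_subset[OF assms(1)]) auto
  then obtain B where B: "B > 0" "\<And>y. y \<in> f ` cball 0 R \<Longrightarrow> norm y \<le> B"
    using compact_imp_bounded bounded_pos by metis
  have "norm (f x) \<le> B" for x
    using B R[of x] by (cases "R < norm x") auto
  with B(1) show ?thesis by blast
qed

lemma integrable_if_support_bounded:
  fixes f :: "'a::euclidean_space \<Rightarrow> 'b::{banach, second_countable_topology}"
  assumes f: "continuous_on UNIV f" and R: "\<And>x. R < norm x \<Longrightarrow> f x = 0"
  shows "integrable lborel f"
proof -
  have "set_integrable lborel (cball 0 R) f"
    unfolding set_integrable_def
    by (rule borel_integrable_compact) (auto intro: continuous_on_subset[OF f])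
  moreover have "(\<lambda>x. indicator (cball 0 R) x *\<^sub>R f x) = f"
    by (rule ext) (use R in \<open>auto simp: indicator_def\<close>)
  ultimately show ?thesis by (simp add: set_integrable_def)
qed

lemma testfun_bounded: "f \<in> testfun \<Longrightarrow> \<exists>B>0. \<forall>x. norm (f x) \<le> B"
  by (metis testfunE bounded_if_support_bounded testfun_continuous)

lemma testfun_integrable: "f \<in> testfun \<Longrightarrow> integrable lborel f"
  by (metis testfunE integrable_if_support_bounded testfun_continuous)

lemma testfun_schwartz:
  assumes f: "f \<in> testfun"
  shows "f \<in> schwartz"
proof -
  have "bdd_above (range (\<lambda>x. (1 + norm x) ^ k * cmod (partial_derivs is f x)))" for k "is"
  proof -
    have g: "partial_derivs is f \<in> testfun" by (rule testfun_partial_derivs[OF f])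
    obtain R where R: "R > 0" "\<And>x. R < norm x \<Longrightarrow> partial_derivs is f x = 0" using testfunE[OF g] by blast
    obtain B where B: "B > 0" "\<And>x. cmod (partial_derivs is f x) \<le> B" using testfun_bounded[OF g] by blast
    have "(1 + norm x) ^ k * cmod (partial_derivs is f x) \<le> (1 + R) ^ k * B" for x
    proof (cases "R < norm x")
      case False
      then show ?thesis by (intro mult_mono power_mono B) (use R in auto)
    qed (use R B in auto)
    then show ?thesis by (intro bdd_aboveI[of _ "(1 + R) ^ k * B"]) blast
  qed
  then show ?thesis using testfun_smooth[OF f] by (simp add: schwartz_def)
qed

section \<open>Fourier transforms of test functions\<close>

lemma ennreal_le_suminf: "f k \<le> (\<Sum>k. f k)" for f :: "nat \<Rightarrow> ennreal"
  using sum_le_suminf[of f "{k}"] by simp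

text \<open>The function is dominated by a series of indicators of balls of radius k + 1 with
  weights (k + 1)^-(n + 2). Ball volumes grow like (k + 1)^n, so the exponent n + 2 leaves the
  convergent series of (k + 1)^-2.\<close>

lemma integrable_inverse_power_norm:
  "integrable lborel (\<lambda>x::'a::euclidean_space. inverse ((1 + norm x) ^ (DIM('a) + 2)))"
proof -
  let ?n = "DIM('a)"
  let ?f = "\<lambda>x::'a. inverse ((1 + norm x) ^ (?n + 2))"
  let ?t = "\<lambda>k::nat. \<lambda>x::'a. ennreal (inverse (real (Suc k) ^ (?n + 2))) * indicator (cball 0 (real (Suc k))) x"
  have meas: "?t k \<in> borel_measurable lborel" for k
    by (intro borel_measurable_times_ennreal borel_measurable_indicator) auto
  have le: "ennreal (?f x) \<le> (\<Sum>k. ?t k x)" for x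
  proof -
    define k where "k = nat \<lfloor>norm x\<rfloor>"
    have k: "real k \<le> norm x" "norm x < real (Suc k)"
      unfolding k_def using of_nat_floor[of "norm x"] by (auto, linarith)
    have "?f x \<le> inverse (real (Suc k) ^ (?n + 2))"
      by (intro le_imp_inverse_le power_mono) (use k in auto)
    then have "ennreal (?f x) \<le> ?t k x"
      using k by (auto simp: indicator_def intro!: ennreal_leI)
    also have "\<dots> \<le> (\<Sum>k. ?t k x)"
      by (rule ennreal_le_suminf)
    finally show ?thesis .
  qed
  have eq: "(\<integral>\<^sup>+x. ?t k x \<partial>lborel) = ennreal (unit_ball_vol (real ?n) * inverse (real (Suc k) ^ 2))" for k
  proof -
    have "(\<integral>\<^sup>+x. ?t k x \<partial>lborel) = ennreal (inverse (real (Suc k) ^ (?n + 2))) * ennreal (unit_ball_vol (real ?n) * real (Suc k) ^ ?n)"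
      by (subst nn_integral_cmult_indicator) (auto simp: emeasure_cball simp del: of_nat_Suc)
    also have "\<dots> = ennreal (unit_ball_vol (real ?n) * inverse (real (Suc k) ^ 2))"
      by (subst ennreal_mult[symmetric])
         (auto simp: power_add power2_eq_square field_simps simp del: of_nat_Suc intro!: arg_cong[where f = ennreal])
    finally show ?thesis .
  qed
  have "(\<integral>\<^sup>+x. ennreal (?f x) \<partial>lborel) \<le> (\<integral>\<^sup>+x. (\<Sum>k. ?t k x) \<partial>lborel)"
    by (intro nn_integral_mono le)
  also have "\<dots> = (\<Sum>k. ennreal (unit_ball_vol (real ?n) * inverse (real (Suc k) ^ 2)))"
    by (subst nn_integral_suminf) (simp_all only: eq meas)
  also have "\<dots> < \<infinity>"
  proof -
    have "summable (\<lambda>k. unit_ball_vol (real ?n) * inverse (real (Suc k) ^ 2))"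
      by (intro summable_mult) (subst summable_Suc_iff, rule inverse_power_summable, simp)
    then show ?thesis
      by (subst suminf_ennreal2) (auto simp del: of_nat_Suc)
  qed
  finally have fin: "(\<integral>\<^sup>+x. ennreal (?f x) \<partial>lborel) < \<infinity>" .
  show ?thesis
    by (rule integrableI_bounded) (use fin in \<open>auto simp: abs_of_nonneg\<close>)
qed

lemma integrable_if_rapidly_decreasing:
  fixes f :: "real^'n::finite \<Rightarrow> complex"
  assumes [measurable]: "f \<in> borel_measurable borel"
    and le: "\<And>x. (1 + norm x) ^ (CARD('n) + 2) * cmod (f x) \<le> B"
  shows "integrable lborel f"
proof (rule Bochner_Integration.integrable_bound)
  show "integrable lborel (\<lambda>x::real^'n. B * inverse ((1 + norm x) ^ (CARD('n) + 2)))"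
    using integrable_inverse_power_norm[where 'a = "real^'n"] by (intro integrable_mult_right) simp
  show "AE x in lborel. cmod (f x) \<le> norm (B * inverse ((1 + norm x) ^ (CARD('n) + 2)))"
  proof (rule AE_I2)
    fix x :: "real^'n"
    have pos: "(1 + norm x) ^ (CARD('n) + 2) > 0" by (intro zero_less_power) (simp add: add_pos_nonneg)
    have "cmod (f x) \<le> B * inverse ((1 + norm x) ^ (CARD('n) + 2))"
      using le[of x] pos by (simp add: divide_simps mult.commute del: power_add)
    then show "cmod (f x) \<le> norm (B * inverse ((1 + norm x) ^ (CARD('n) + 2)))"
      by (smt (verit) real_norm_def)
  qed
qed simp

lemma cis_measurable [measurable]: "cis \<in> borel_measurable borel"
  by (intro borel_measurable_continuous_onI continuous_intros)

lemma integrable_cis_mult: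
  fixes f :: "'a::euclidean_space \<Rightarrow> complex"
  assumes f: "integrable lborel f" and [measurable]: "g \<in> borel_measurable borel"
  shows "integrable lborel (\<lambda>x. cis (g x) * f x)"
  using f by (rule Bochner_Integration.integrable_bound)
    (use borel_measurable_integrable[OF f] in \<open>auto simp: norm_mult\<close>)

lemma cmod_fourier_le: "cmod (fourier f \<xi>) \<le> (LINT x|lborel. cmod (f x))"
proof (cases "integrable lborel (\<lambda>x. cis (- (x \<bullet> \<xi>)) * f x)")
  case True
  have "cmod (fourier f \<xi>) \<le> (LINT x|lborel. cmod (cis (- (x \<bullet> \<xi>)) * f x))"
    unfolding fourier_def by (rule integral_norm_bound)
  then show ?thesis by (simp add: norm_mult)
qed (simp add: fourier_def not_integrable_integral_eq)

lemma inv_fourier_eq_fourier: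
  "inv_fourier f x = fourier f (- x) / complex_of_real ((2 * pi) ^ CARD('n))"
  for f :: "real^'n::finite \<Rightarrow> complex"
  by (simp add: inv_fourier_def fourier_def inner_commute)

lemma cmod_cis_minus_linear_le: "cmod (cis t - 1 - \<i> * of_real t) \<le> t\<^sup>2"
proof -
  have "cmod (exp (\<i> * of_real t) - (\<Sum>k\<le>1. (\<i> * of_real t) ^ k / fact k)) \<le> t\<^sup>2"
    using Taylor_exp[of "\<i> * of_real t" 1] by (simp add: norm_mult power2_eq_square)
  then show ?thesis by (simp add: cis_conv_exp diff_diff_eq)
qed

text \<open>Differentiation under the integral sign: the first-order Taylor error of the character
  is at most the square of x . h, so the remainder is bounded by |h|^2 times the second absolute
  moment M of f.\<close>

lemma fourier_has_derivative:
  fixes f :: "real^'n::finite \<Rightarrow> complex"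
  assumes f: "f \<in> testfun"
  shows "(fourier f has_derivative
    (\<lambda>h. LINT x|lborel. - \<i> * of_real (x \<bullet> h) * cis (- (x \<bullet> \<xi>)) * f x)) (at \<xi>)"
proof -
  obtain R where R: "R > 0" "\<And>x. R < norm x \<Longrightarrow> f x = 0" using testfunE[OF f] by blast
  have cont: "continuous_on UNIV f" by (rule testfun_continuous[OF f])
  have int: "integrable lborel (\<lambda>x. g x * f x)" if "continuous_on UNIV g" for g :: "real^'n \<Rightarrow> complex"
    by (rule integrable_if_support_bounded[of _ R]) (use R cont that in \<open>auto intro!: continuous_intros\<close>)
  define M where "M = (LINT x|lborel. cmod (of_real ((norm x)\<^sup>2) * f x))"
  have M: "M \<ge> 0" unfolding M_def by simp
  define D where "D = (\<lambda>h. LINT x|lborel. - \<i> * of_real (x \<bullet> h) * cis (- (x \<bullet> \<xi>)) * f x)"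
  have intD: "integrable lborel (\<lambda>x. - \<i> * of_real (x \<bullet> h) * cis (- (x \<bullet> \<xi>)) * f x)" for h
    by (rule int) (intro continuous_intros)
  have lin: "bounded_linear D"
  proof (rule linear_conv_bounded_linear[THEN iffD1], rule linearI)
    fix h k :: "real^'n" and c :: real
    show "D (h + k) = D h + D k"
      unfolding D_def by (subst Bochner_Integration.integral_add[OF intD intD, symmetric])
        (simp add: inner_add_right algebra_simps)
    show "D (c *\<^sub>R h) = c *\<^sub>R D h"
      unfolding D_def integral_scaleR_right[symmetric]
      by (intro Bochner_Integration.integral_cong refl) (simp add: scaleR_conv_of_real[where 'a = complex])
  qed
  have err: "cmod (fourier f (\<xi> + h) - fourier f \<xi> - D h) \<le> (norm h)\<^sup>2 * M" for h
  proof -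
    have i1: "integrable lborel (\<lambda>x. cis (- (x \<bullet> \<eta>)) * f x)" for \<eta>
      by (rule int) (intro continuous_intros)
    have "fourier f (\<xi> + h) - fourier f \<xi> - D h =
        (LINT x|lborel. (cis (- (x \<bullet> (\<xi> + h))) * f x - cis (- (x \<bullet> \<xi>)) * f x
          - (- \<i> * of_real (x \<bullet> h) * cis (- (x \<bullet> \<xi>)) * f x)))"
      unfolding fourier_def D_def
      by (subst Bochner_Integration.integral_diff, (intro Bochner_Integration.integrable_diff i1 intD)+,
          subst Bochner_Integration.integral_diff, (intro i1)+, simp)
    also have "\<dots> = (LINT x|lborel. cis (- (x \<bullet> \<xi>)) * (cis (- (x \<bullet> h)) - 1 - \<i> * of_real (- (x \<bullet> h))) * f x)"
    proof (intro Bochner_Integration.integral_cong refl)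
      fix x
      have "cis (- (x \<bullet> (\<xi> + h))) = cis (- (x \<bullet> \<xi>)) * cis (- (x \<bullet> h))"
        by (simp add: cis_mult inner_add_right)
      then show "cis (- (x \<bullet> (\<xi> + h))) * f x - cis (- (x \<bullet> \<xi>)) * f x
          - (- \<i> * of_real (x \<bullet> h) * cis (- (x \<bullet> \<xi>)) * f x) =
          cis (- (x \<bullet> \<xi>)) * (cis (- (x \<bullet> h)) - 1 - \<i> * of_real (- (x \<bullet> h))) * f x"
        by (simp add: algebra_simps)
    qed
    finally have eq: "fourier f (\<xi> + h) - fourier f \<xi> - D h = \<dots>" .
    have "cmod (fourier f (\<xi> + h) - fourier f \<xi> - D h) \<le>
        (LINT x|lborel. cmod (cis (- (x \<bullet> \<xi>)) * (cis (- (x \<bullet> h)) - 1 - \<i> * of_real (- (x \<bullet> h))) * f x))"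
      unfolding eq by (rule integral_norm_bound)
    also have "\<dots> \<le> (LINT x|lborel. (norm h)\<^sup>2 * cmod (of_real ((norm x)\<^sup>2) * f x))"
    proof (rule integral_mono)
      show "integrable lborel (\<lambda>x. cmod (cis (- (x \<bullet> \<xi>)) * (cis (- (x \<bullet> h)) - 1 - \<i> * of_real (- (x \<bullet> h))) * f x))"
        by (intro integrable_norm int continuous_intros)
      show "integrable lborel (\<lambda>x. (norm h)\<^sup>2 * cmod (of_real ((norm x)\<^sup>2) * f x))"
        by (intro integrable_mult_right integrable_norm int continuous_intros)
      fix x :: "real^'n"
      have "cmod (cis (- (x \<bullet> h)) - 1 - \<i> * of_real (- (x \<bullet> h))) \<le> (x \<bullet> h)\<^sup>2"
        using cmod_cis_minus_linear_le[of "- (x \<bullet> h)"] by simp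
      also have "\<dots> \<le> (norm h)\<^sup>2 * (norm x)\<^sup>2"
        by (metis Cauchy_Schwarz_ineq2 mult.commute power2_abs power_mono power_mult_distrib abs_ge_zero)
      finally show "cmod (cis (- (x \<bullet> \<xi>)) * (cis (- (x \<bullet> h)) - 1 - \<i> * of_real (- (x \<bullet> h))) * f x)
          \<le> (norm h)\<^sup>2 * cmod (of_real ((norm x)\<^sup>2) * f x)"
        unfolding norm_mult by (simp add: mult_right_mono mult.assoc[symmetric] norm_power)
    qed
    finally show ?thesis by (simp add: M_def)
  qed
  have "(fourier f has_derivative D) (at \<xi>)"
    unfolding has_derivative_at
  proof (intro conjI lin)
    show "(\<lambda>h. norm (fourier f (\<xi> + h) - fourier f \<xi> - D h) / norm h) \<midarrow>0\<rightarrow> 0"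
    proof (rule tendsto_sandwich[where f = "\<lambda>_. 0" and h = "\<lambda>h. norm h * M"])
      show "\<forall>\<^sub>F h in at 0. norm (fourier f (\<xi> + h) - fourier f \<xi> - D h) / norm h \<le> norm h * M"
        using err by (intro eventually_at_filter[THEN iffD2] always_eventually)
          (auto simp: field_simps power2_eq_square)
      show "(\<lambda>h::real^'n. norm h * M) \<midarrow>0\<rightarrow> 0"
        by (auto intro!: tendsto_eq_intros)
    qed auto
  qed
  then show ?thesis unfolding D_def .
qed

lemma partial_deriv_fourier:
  assumes f: "f \<in> testfun"
  shows "partial_deriv i (fourier f) = fourier (\<lambda>x. - \<i> * of_real (x $ i) * f x)"
  unfolding fourier_def[of "\<lambda>x. - \<i> * of_real (x $ i) * f x"]
  by (rule ext, subst partial_deriv_eq[OF fourier_has_derivative[OF f]])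
     (auto simp: inner_axis ac_simps intro!: Bochner_Integration.integral_cong)

lemma smooth_of_real: "smooth f \<Longrightarrow> smooth (\<lambda>x. complex_of_real (f x))"
  by (rule smooth_bounded_linear_compose[OF bounded_linear_of_real])

lemma testfun_nth_mult: "f \<in> testfun \<Longrightarrow> (\<lambda>x. c * of_real (x $ i) * f x) \<in> testfun"
  by (intro testfun_mult_left smooth_mult smooth_const smooth_of_real smooth_nth)

text \<open>Differentiating a transform multiplies the test function by -i x_i, so the transforms of
  test functions form a class stable under derivatives.\<close>

lemma smooth_fourier:
  assumes f: "f \<in> testfun"
  shows "smooth (fourier f)"
proof (rule smooth_coinduct[where S = "fourier ` testfun"])
  fix g :: "real^'a \<Rightarrow> complex" and i assume "g \<in> fourier ` testfun"
  then obtain f where f: "f \<in> testfun" and g: "g = fourier f" by blast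
  show "g differentiable_on UNIV"
    unfolding g by (rule differentiable_on_UNIV_I[OF fourier_has_derivative[OF f]])
  show "partial_deriv i g \<in> fourier ` testfun"
    unfolding g partial_deriv_fourier[OF f] by (intro imageI testfun_nth_mult f)
qed (use f in blast)


section \<open>Substitution, transforms of derivatives, and rapid decay\<close>

lemma lborel_integral_affine:
  fixes f :: "'a::euclidean_space \<Rightarrow> 'b::{banach, second_countable_topology}"
  assumes c: "c \<noteq> 0" and [measurable]: "f \<in> borel_measurable borel"
  shows "integral\<^sup>L lborel f = \<bar>c\<bar> ^ DIM('a) *\<^sub>R (LINT x|lborel. f (t + c *\<^sub>R x))"
  by (subst lborel_affine[OF c, of t])
     (simp add: integral_density integral_distr del: scaleR_left_distrib)

lemma lborel_integral_translate:
  fixes f :: "'a::euclidean_space \<Rightarrow> 'b::{banach, second_countable_topology}"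
  assumes [measurable]: "f \<in> borel_measurable borel"
  shows "(LINT x|lborel. f (t + x)) = integral\<^sup>L lborel f"
  using lborel_integral_affine[of 1 f t] by simp

text \<open>Integration by parts as a limit of difference quotients: translation invariance turns
  the transform of a quotient with step h into \<open>fourier f\<close> times (cis (h xi_i) - 1) /
  h, and this factor tends to i xi_i.\<close>

lemma fourier_partial_deriv:
  fixes f :: "real^'n::finite \<Rightarrow> complex"
  assumes f: "f \<in> testfun"
  shows "fourier (partial_deriv i f) \<xi> = \<i> * of_real (\<xi> $ i) * fourier f \<xi>"
proof -
  let ?e = "axis i 1 :: real^'n"
  let ?h = "\<lambda>k. inverse (real (Suc k))"
  obtain R where R: "R > 0" "\<And>x. R < norm x \<Longrightarrow> f x = 0" using testfunE[OF f] by blast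
  have g: "partial_deriv i f \<in> testfun" by (rule testfun_partial_deriv[OF f])
  obtain B where B: "B > 0" "\<And>x. cmod (partial_deriv i f x) \<le> B" using testfun_bounded[OF g] by blast
  have [measurable]: "f \<in> borel_measurable borel" "partial_deriv i f \<in> borel_measurable borel"
    using f g by (auto intro: testfun_measurable)
  define s where "s = (\<lambda>k x. cis (- (x \<bullet> \<xi>)) * ((f (?h k *\<^sub>R ?e + x) - f x) / of_real (?h k)))"
  have line: "((\<lambda>t. f (t *\<^sub>R ?e + x)) has_derivative (\<lambda>v. v *\<^sub>R partial_deriv i f (t *\<^sub>R ?e + x))) (at t)" for t x
  proof -
    have "((\<lambda>t. f (t *\<^sub>R ?e + x)) has_derivative (\<lambda>v. frechet_derivative f (at (t *\<^sub>R ?e + x)) (v *\<^sub>R ?e))) (at t)"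
      by (rule has_derivative_compose[where f = "\<lambda>t. t *\<^sub>R ?e + x", OF _ smooth_has_derivative[OF testfun_smooth[OF f]]])
         (auto intro!: derivative_eq_intros)
    moreover have "linear (frechet_derivative f (at y))" for y
      using has_derivative_bounded_linear[OF smooth_has_derivative[OF testfun_smooth[OF f]]] bounded_linear.linear by blast
    ultimately show ?thesis by (simp add: partial_deriv_def linear_scale)
  qed
  \<comment> \<open>The quotients are therefore bounded by B uniformly in the step. As the steps are
    at most 1, the quotients also vanish outside radius R + 1, which gives the integrable majorant
    below.\<close>
  have mvt: "cmod (f (t *\<^sub>R ?e + x) - f x) \<le> B * t" if "t \<ge> 0" for t x
  proof -
    have "norm (f (t *\<^sub>R ?e + x) - f (0 *\<^sub>R ?e + x)) \<le> B * norm (t - 0)"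
    proof (rule differentiable_bound[where S = UNIV and f' = "\<lambda>t v. v *\<^sub>R partial_deriv i f (t *\<^sub>R ?e + x)"])
      show "onorm (\<lambda>v. v *\<^sub>R partial_deriv i f (y *\<^sub>R ?e + x)) \<le> B" for y :: real
        by (rule onorm_bound) (use B in \<open>simp_all add: less_imp_le mult.commute[of B] mult_left_mono\<close>)
    qed (use line in auto)
    then show ?thesis using that by simp
  qed
  have "(\<lambda>k. LINT x|lborel. s k x) \<longlonglongrightarrow> (LINT x|lborel. cis (- (x \<bullet> \<xi>)) * partial_deriv i f x)"
  proof (rule integral_dominated_convergence[where w = "\<lambda>x. B * indicator (cball 0 (R + 1)) x"])
    show "integrable lborel (\<lambda>x::real^'n. B * indicator (cball 0 (R + 1)) x)"
      by (intro integrable_mult_right integrable_real_indicator) (auto simp: emeasure_cball R(1) less_imp_le)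
    show "s k \<in> borel_measurable lborel" for k
      unfolding s_def by measurable
    show "AE x in lborel. (\<lambda>k. s k x) \<longlonglongrightarrow> cis (- (x \<bullet> \<xi>)) * partial_deriv i f x"
    proof (rule AE_I2)
      fix x :: "real^'n"
      have "(\<lambda>h. norm (f (h *\<^sub>R ?e + x) - f x - h *\<^sub>R partial_deriv i f x) / norm h) \<midarrow>0\<rightarrow> 0"
        using line[of x 0] unfolding has_derivative_at by simp
      moreover have "filterlim ?h (at 0) sequentially"
        using LIMSEQ_inverse_real_of_nat by (auto simp: filterlim_at)
      ultimately have "(\<lambda>k. norm (f (?h k *\<^sub>R ?e + x) - f x - ?h k *\<^sub>R partial_deriv i f x) / norm (?h k)) \<longlonglongrightarrow> 0"
        by (rule filterlim_compose)
      moreover have "norm (f (?h k *\<^sub>R ?e + x) - f x - ?h k *\<^sub>R partial_deriv i f x) / norm (?h k) =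
          norm ((f (?h k *\<^sub>R ?e + x) - f x) / of_real (?h k) - partial_deriv i f x)" for k
      proof -
        have "(f (?h k *\<^sub>R ?e + x) - f x) / of_real (?h k) - partial_deriv i f x =
            (f (?h k *\<^sub>R ?e + x) - f x - ?h k *\<^sub>R partial_deriv i f x) / of_real (?h k)"
          by (simp add: diff_divide_distrib scaleR_conv_of_real del: of_nat_Suc of_real_inverse)
        then show ?thesis by (simp only: norm_divide norm_of_real real_norm_def)
      qed
      ultimately have "(\<lambda>k. (f (?h k *\<^sub>R ?e + x) - f x) / of_real (?h k) - partial_deriv i f x) \<longlonglongrightarrow> 0"
        by (simp only: tendsto_norm_zero_iff)
      then have "(\<lambda>k. (f (?h k *\<^sub>R ?e + x) - f x) / of_real (?h k)) \<longlonglongrightarrow> partial_deriv i f x"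
        by (rule Lim_null[THEN iffD2])
      then show "(\<lambda>k. s k x) \<longlonglongrightarrow> cis (- (x \<bullet> \<xi>)) * partial_deriv i f x"
        unfolding s_def by (rule tendsto_mult_left)
    qed
    show "AE x in lborel. cmod (s k x) \<le> B * indicator (cball 0 (R + 1)) x" for k
    proof (rule AE_I2)
      fix x :: "real^'n"
      have h: "0 < ?h k" "?h k \<le> 1" by (auto simp: field_simps)
      show "cmod (s k x) \<le> B * indicator (cball 0 (R + 1)) x"
      proof (cases "norm x \<le> R + 1")
        case True
        have "cmod (s k x) = cmod (f (?h k *\<^sub>R ?e + x) - f x) / ?h k"
          using h by (simp add: s_def norm_mult norm_divide del: of_real_inverse of_nat_Suc)
        also have "\<dots> \<le> B" using mvt[of "?h k" x] h by (simp add: pos_divide_le_eq)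
        finally show ?thesis using True by simp
      next
        case False
        have "norm x \<le> norm (?h k *\<^sub>R ?e + x) + norm (?h k *\<^sub>R ?e)"
          using norm_triangle_ineq4[of "?h k *\<^sub>R ?e + x" "?h k *\<^sub>R ?e"] by simp
        also have "norm (?h k *\<^sub>R ?e) \<le> 1" using h by (simp add: norm_axis_1)
        finally have "R < norm (?h k *\<^sub>R ?e + x)" using False by simp
        then have "f (?h k *\<^sub>R ?e + x) = 0" "f x = 0" using R False by auto
        then show ?thesis using False by (simp add: s_def)
      qed
    qed
  qed simp
  moreover have "(LINT x|lborel. s k x) = (cis (?h k * \<xi> $ i) - 1) / of_real (?h k) * fourier f \<xi>" for k
  proof -
    have int1: "integrable lborel (\<lambda>x. cis (- (x \<bullet> \<xi>)) * f (?h k *\<^sub>R ?e + x))"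
      using testfun_affine_compose[OF f, of 1 "?h k *\<^sub>R ?e"]
      by (intro integrable_cis_mult testfun_integrable) (auto simp: add.commute)
    have int2: "integrable lborel (\<lambda>x. cis (- (x \<bullet> \<xi>)) * f x)"
      by (intro integrable_cis_mult testfun_integrable f) auto
    have "(LINT x|lborel. cis (- (x \<bullet> \<xi>)) * f (?h k *\<^sub>R ?e + x)) =
        (LINT x|lborel. cis (?h k * \<xi> $ i) * (cis (- ((?h k *\<^sub>R ?e + x) \<bullet> \<xi>)) * f (?h k *\<^sub>R ?e + x)))"
      by (intro Bochner_Integration.integral_cong refl)
         (simp add: inner_add_left inner_axis' cis_mult mult.assoc[symmetric])
    also have "\<dots> = (LINT x|lborel. cis (?h k * \<xi> $ i) * (cis (- (x \<bullet> \<xi>)) * f x))"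
      by (rule lborel_integral_translate) measurable
    finally have tr: "(LINT x|lborel. cis (- (x \<bullet> \<xi>)) * f (?h k *\<^sub>R ?e + x)) = cis (?h k * \<xi> $ i) * fourier f \<xi>"
      by (simp add: fourier_def)
    have "(LINT x|lborel. s k x) =
        (LINT x|lborel. (cis (- (x \<bullet> \<xi>)) * f (?h k *\<^sub>R ?e + x) - cis (- (x \<bullet> \<xi>)) * f x) / of_real (?h k))"
      unfolding s_def by (intro Bochner_Integration.integral_cong refl) (simp add: right_diff_distrib)
    also have "\<dots> = (cis (?h k * \<xi> $ i) * fourier f \<xi> - fourier f \<xi>) / of_real (?h k)"
      by (subst integral_divide_zero, subst Bochner_Integration.integral_diff[OF int1 int2], subst tr)
         (simp add: fourier_def)
    finally show ?thesis by (simp add: left_diff_distrib diff_divide_distrib)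
  qed
  moreover have "(\<lambda>k. (cis (?h k * \<xi> $ i) - 1) / of_real (?h k) * fourier f \<xi>) \<longlonglongrightarrow> \<i> * of_real (\<xi> $ i) * fourier f \<xi>"
  proof (rule tendsto_mult_right)
    have "(\<lambda>k. (cis (?h k * \<xi> $ i) - 1) / of_real (?h k) - \<i> * of_real (\<xi> $ i)) \<longlonglongrightarrow> 0"
    proof (rule Lim_null_comparison)
      show "\<forall>\<^sub>F k in sequentially. cmod ((cis (?h k * \<xi> $ i) - 1) / of_real (?h k) - \<i> * of_real (\<xi> $ i)) \<le> ?h k * (\<xi> $ i)\<^sup>2"
      proof (intro always_eventually allI)
        fix k
        have h: "?h k > 0" by simp
        have "(cis (?h k * \<xi> $ i) - 1) / of_real (?h k) - \<i> * of_real (\<xi> $ i) =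
            (cis (?h k * \<xi> $ i) - 1 - \<i> * of_real (?h k * \<xi> $ i)) / of_real (?h k)"
          using h by (simp add: diff_divide_distrib del: of_nat_Suc of_real_inverse)
        then have "cmod ((cis (?h k * \<xi> $ i) - 1) / of_real (?h k) - \<i> * of_real (\<xi> $ i)) \<le> (?h k * \<xi> $ i)\<^sup>2 / ?h k"
          using cmod_cis_minus_linear_le[of "?h k * \<xi> $ i"] h
          by (simp only: norm_divide norm_of_real abs_of_pos) (intro divide_right_mono, auto)
        also have "\<dots> = ?h k * (\<xi> $ i)\<^sup>2"
          using h by (simp add: power2_eq_square)
        finally show "cmod ((cis (?h k * \<xi> $ i) - 1) / of_real (?h k) - \<i> * of_real (\<xi> $ i)) \<le> ?h k * (\<xi> $ i)\<^sup>2" .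
      qed
      show "(\<lambda>k. ?h k * (\<xi> $ i)\<^sup>2) \<longlonglongrightarrow> 0"
        using tendsto_mult_left_zero[OF LIMSEQ_inverse_real_of_nat] .
    qed
    then show "(\<lambda>k. (cis (?h k * \<xi> $ i) - 1) / of_real (?h k)) \<longlonglongrightarrow> \<i> * of_real (\<xi> $ i)"
      by (rule Lim_null[THEN iffD2])
  qed
  ultimately show ?thesis
    unfolding fourier_def[of "partial_deriv i f"] using LIMSEQ_unique by simp
qed

text \<open>Each further power of 1 + |xi| costs one derivative of f: the factor is at most 1 plus
  the sum of the |xi_i|, and xi_i times \<open>fourier f\<close> is, up to a factor of modulus 1,
  the transform of a partial derivative, to which the induction hypothesis applies.\<close>

lemma fourier_rapidly_decreasing:
  fixes f :: "real^'n::finite \<Rightarrow> complex"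
  shows "f \<in> testfun \<Longrightarrow> \<exists>B. \<forall>\<xi>. (1 + norm \<xi>) ^ k * cmod (fourier f \<xi>) \<le> B"
proof (induction k arbitrary: f)
  case 0
  show ?case using cmod_fourier_le[of f] by auto
next
  case (Suc k)
  obtain B where B: "\<And>\<xi>. (1 + norm \<xi>) ^ k * cmod (fourier f \<xi>) \<le> B"
    using Suc by blast
  have "\<exists>B. \<forall>\<xi>. (1 + norm \<xi>) ^ k * cmod (fourier (partial_deriv i f) \<xi>) \<le> B" for i
    using Suc.IH Suc.prems testfun_partial_deriv by blast
  then obtain B' where B': "\<And>i \<xi>. (1 + norm \<xi>) ^ k * cmod (fourier (partial_deriv i f) \<xi>) \<le> B' i"
    by metis
  have "(1 + norm \<xi>) ^ Suc k * cmod (fourier f \<xi>) \<le> B + (\<Sum>i\<in>UNIV. B' i)" for \<xi>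
  proof -
    have "(1 + norm \<xi>) ^ Suc k * cmod (fourier f \<xi>) \<le>
        (1 + norm \<xi>) ^ k * cmod (fourier f \<xi>) * (1 + (\<Sum>i\<in>UNIV. \<bar>\<xi> $ i\<bar>))"
    proof -
      have "(1 + norm \<xi>) ^ Suc k * cmod (fourier f \<xi>) = (1 + norm \<xi>) ^ k * cmod (fourier f \<xi>) * (1 + norm \<xi>)"
        by simp
      then show ?thesis
        using norm_le_l1_cart[of \<xi>] by (simp only:) (intro mult_left_mono, auto)
    qed
    also have "\<dots> = (1 + norm \<xi>) ^ k * cmod (fourier f \<xi>) +
        (\<Sum>i\<in>UNIV. (1 + norm \<xi>) ^ k * cmod (fourier (partial_deriv i f) \<xi>))"
      using Suc.prems
      by (simp add: fourier_partial_deriv norm_mult distrib_left sum_distrib_left mult_ac)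
    also have "\<dots> \<le> B + (\<Sum>i\<in>UNIV. B' i)"
      by (intro add_mono sum_mono B B')
    finally show ?thesis .
  qed
  then show ?case by blast
qed

lemma partial_derivs_fourier:
  assumes "f \<in> testfun"
  shows "\<exists>g\<in>testfun. partial_derivs is (fourier f) = fourier g"
proof (induction "is")
  case (Cons i "is")
  then obtain g where g: "g \<in> testfun" "partial_derivs is (fourier f) = fourier g" by blast
  then have "partial_derivs (i # is) (fourier f) = fourier (\<lambda>x. - \<i> * of_real (x $ i) * g x)"
    by (simp add: partial_derivs_def partial_deriv_fourier)
  then show ?case using testfun_nth_mult[OF g(1)] by blast
qed (use assms in auto)

lemma fourier_schwartz:
  fixes f :: "real^'n::finite \<Rightarrow> complex"
  assumes f: "f \<in> testfun"
  shows "fourier f \<in> schwartz"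
proof -
  have "bdd_above (range (\<lambda>x. (1 + norm x) ^ k * cmod (partial_derivs is (fourier f) x)))" for k "is"
  proof -
    obtain g where g: "g \<in> testfun" "partial_derivs is (fourier f) = fourier g"
      using partial_derivs_fourier[OF f] by blast
    obtain B where "\<And>x. (1 + norm x) ^ k * cmod (fourier g x) \<le> B"
      using fourier_rapidly_decreasing[OF g(1)] by blast
    then show ?thesis unfolding g(2) by (intro bdd_aboveI[of _ B]) blast
  qed
  then show ?thesis using smooth_fourier[OF f] by (simp add: schwartz_def)
qed

lemma fourier_continuous: "f \<in> testfun \<Longrightarrow> continuous_on A (fourier f)"
  by (intro smooth_continuous_on smooth_fourier)

lemma fourier_measurable: "f \<in> testfun \<Longrightarrow> fourier f \<in> borel_measurable borel"
  by (simp add: fourier_continuous borel_measurable_continuous_onI)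

lemma fourier_integrable: "f \<in> testfun \<Longrightarrow> integrable lborel (fourier f)"
  using fourier_rapidly_decreasing integrable_if_rapidly_decreasing fourier_measurable by metis

lemma smooth_inv_fourier:
  fixes f :: "real^'n::finite \<Rightarrow> complex"
  assumes f: "f \<in> testfun"
  shows "smooth (inv_fourier f)"
proof -
  have eq: "inv_fourier f = (\<lambda>x. inverse (complex_of_real ((2 * pi) ^ CARD('n))) * fourier f ((-1) *\<^sub>R x))"
    by (rule ext) (simp add: inv_fourier_eq_fourier divide_inverse mult.commute)
  show ?thesis
    unfolding eq by (intro smooth_mult smooth_const smooth_scaleR_compose smooth_fourier f)
qed

section \<open>Fourier inversion up to a constant factor\<close>

lemma integrable_pair_mult_bounded:
  fixes f g :: "'a::euclidean_space \<Rightarrow> complex"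
  assumes f: "integrable lborel f" and g: "integrable lborel g"
    and [measurable]: "k \<in> borel_measurable (borel \<Otimes>\<^sub>M borel)"
    and k: "\<And>x y. cmod (k (x, y)) \<le> B"
  shows "integrable (lborel \<Otimes>\<^sub>M lborel) (\<lambda>(x, y). k (x, y) * f x * g y)"
proof -
  have [measurable]: "f \<in> borel_measurable borel" "g \<in> borel_measurable borel"
    using f g borel_measurable_integrable by fastforce+
  have prod: "integrable (lborel \<Otimes>\<^sub>M lborel) (\<lambda>(x, y). f x * g y)"
  proof (rule lborel_pair.Fubini_integrable)
    show "integrable lborel (\<lambda>x. LINT y|lborel. norm (case (x, y) of (x, y) \<Rightarrow> f x * g y))"
      using f by (simp add: norm_mult)
    show "AE x in lborel. integrable lborel (\<lambda>y. case (x, y) of (x, y) \<Rightarrow> f x * g y)"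
      using g by simp
  qed measurable
  show ?thesis
  proof (rule Bochner_Integration.integrable_bound)
    show "integrable (lborel \<Otimes>\<^sub>M lborel) (\<lambda>z. complex_of_real B * (case z of (x, y) \<Rightarrow> f x * g y))"
      using prod by (rule integrable_mult_right)
    have "cmod (k (x, y) * f x * g y) \<le> cmod (complex_of_real B * (f x * g y))" for x y
    proof -
      have "cmod (k (x, y)) \<le> \<bar>B\<bar>" using k[of x y] by linarith
      then show ?thesis by (simp add: norm_mult mult_right_mono mult.assoc)
    qed
    then show "AE z in lborel \<Otimes>\<^sub>M lborel. cmod (case z of (x, y) \<Rightarrow> k (x, y) * f x * g y)
        \<le> cmod (complex_of_real B * (case z of (x, y) \<Rightarrow> f x * g y))"
      by (intro AE_I2) (auto split: prod.split)
  qed measurable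
qed

text \<open>Fubini for a bounded kernel. The kernel is a character in the Fourier arguments and a
  rescaled bump in the mollification argument.\<close>

lemma integral_kernel_swap:
  fixes f g :: "'a::euclidean_space \<Rightarrow> complex"
  assumes f: "integrable lborel f" and g: "integrable lborel g"
    and k: "k \<in> borel_measurable (borel \<Otimes>\<^sub>M borel)" "\<And>x y. cmod (k (x, y)) \<le> B"
  shows "(LINT x|lborel. f x * (LINT y|lborel. k (x, y) * g y)) =
    (LINT y|lborel. g y * (LINT x|lborel. k (x, y) * f x))"
proof -
  have "(LINT x|lborel. f x * (LINT y|lborel. k (x, y) * g y)) =
      (LINT x|lborel. LINT y|lborel. k (x, y) * f x * g y)"
    by (simp add: mult_ac flip: integral_mult_right_zero)
  also have "\<dots> = (LINT y|lborel. LINT x|lborel. k (x, y) * f x * g y)"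
    using lborel_pair.Fubini_integral[OF integrable_pair_mult_bounded[OF f g k]] by simp
  also have "\<dots> = (LINT y|lborel. g y * (LINT x|lborel. k (x, y) * f x))"
    by (simp add: mult_ac flip: integral_mult_right_zero)
  finally show ?thesis .
qed

lemma fourier_scaleR:
  fixes f :: "real^'n::finite \<Rightarrow> complex"
  assumes a: "a \<noteq> 0" and [measurable]: "f \<in> borel_measurable borel"
  shows "fourier f (x /\<^sub>R a) = \<bar>a\<bar> ^ CARD('n) *\<^sub>R fourier (\<lambda>\<xi>. f (a *\<^sub>R \<xi>)) x"
proof -
  have "fourier f (x /\<^sub>R a) = \<bar>a\<bar> ^ DIM(real^'n) *\<^sub>R
      (LINT \<xi>|lborel. cis (- ((0 + a *\<^sub>R \<xi>) \<bullet> (x /\<^sub>R a))) * f (0 + a *\<^sub>R \<xi>))"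
    unfolding fourier_def by (rule lborel_integral_affine[OF a]) measurable
  moreover have "inverse a * (a * t) = t" for t using a by simp
  ultimately show ?thesis by (simp add: fourier_def)
qed

lemma continuous_AE_zero:
  fixes f :: "'a::euclidean_space \<Rightarrow> 'b::real_normed_vector"
  assumes f: "continuous_on UNIV f" and ae: "AE x in lborel. f x = 0"
  shows "f x = 0"
proof (rule ccontr)
  assume "f x \<noteq> 0"
  have "open {x. f x \<noteq> 0}" using f by (rule open_Collect_neq) auto
  moreover have "negligible {x. f x \<noteq> 0}"
    using ae \<open>open _\<close> by (subst negligible_iff_null_sets, intro null_sets_completionI) (simp add: AE_iff_null)
  ultimately show False using open_not_negligible \<open>f x \<noteq> 0\<close> by blast
qed

text \<open>Damping the inversion integral by m (h xi) and applying Fubini turns it into the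
  integral of f (x + h z) against \<open>fourier m z\<close>. As h tends to 0, the damping
  disappears because m 0 = 1, and the other side tends to f x times c0, the integral of
  \<open>fourier m\<close>.\<close>

lemma fourier_inversion_up_to_factor:
  fixes m :: "real^'n::finite \<Rightarrow> complex"
  assumes m: "m \<in> testfun" "m 0 = 1"
  shows "\<exists>c. c \<noteq> 0 \<and> (\<forall>f\<in>testfun. \<forall>x::real^'n. inv_fourier (fourier f) x = c * f x)"
proof -
  define c0 where "c0 = (LINT z|lborel. fourier m z)"
  let ?h = "\<lambda>k. inverse (real (Suc k))"
  have h_lim: "?h \<longlonglongrightarrow> 0" by (rule LIMSEQ_inverse_real_of_nat)
  have m_meas [measurable]: "m \<in> borel_measurable borel" by (rule testfun_measurable[OF m(1)])
  have Fm_meas [measurable]: "fourier m \<in> borel_measurable borel" by (rule fourier_measurable[OF m(1)])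
  obtain Bm where Bm: "\<And>x. cmod (m x) \<le> Bm" using testfun_bounded[OF m(1)] by blast
  have inv: "(LINT \<xi>|lborel. cis (x \<bullet> \<xi>) * fourier f \<xi>) = c0 * f x" if f: "f \<in> testfun" for f :: "real^'n \<Rightarrow> complex" and x
  proof -
    have [measurable]: "f \<in> borel_measurable borel" "fourier f \<in> borel_measurable borel"
      using testfun_measurable[OF f] fourier_measurable[OF f] .
    obtain Bf where Bf: "\<And>x. cmod (f x) \<le> Bf" using testfun_bounded[OF f] by blast
    have eq: "(LINT \<xi>|lborel. cis (x \<bullet> \<xi>) * m (?h k *\<^sub>R \<xi>) * fourier f \<xi>) =
        (LINT z|lborel. f (x + ?h k *\<^sub>R z) * fourier m z)" for k
    proof -
      define e where "e = ?h k"
      have e: "e > 0" by (simp add: e_def)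
      have i: "integrable lborel (\<lambda>\<xi>. cis (x \<bullet> \<xi>) * m (e *\<^sub>R \<xi>))"
        using testfun_affine_compose[OF m(1), of e 0] e
        by (intro integrable_cis_mult testfun_integrable) auto
      have "(LINT \<xi>|lborel. cis (x \<bullet> \<xi>) * m (e *\<^sub>R \<xi>) * fourier f \<xi>) =
          (LINT \<xi>|lborel. cis (x \<bullet> \<xi>) * m (e *\<^sub>R \<xi>) * (LINT y|lborel. cis (- (snd (\<xi>, y) \<bullet> fst (\<xi>, y))) * f y))"
        by (simp add: fourier_def)
      also have "\<dots> = (LINT y|lborel. f y * (LINT \<xi>|lborel. cis (- (snd (\<xi>, y) \<bullet> fst (\<xi>, y))) * (cis (x \<bullet> \<xi>) * m (e *\<^sub>R \<xi>))))"
        by (rule integral_kernel_swap[OF i testfun_integrable[OF f], of "\<lambda>p. cis (- (snd p \<bullet> fst p))" 1]) auto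
      also have "\<dots> = (LINT y|lborel. f y * fourier (\<lambda>\<xi>. m (e *\<^sub>R \<xi>)) (y - x))"
        unfolding fourier_def
        by (simp add: mult.assoc[symmetric] cis_mult inner_diff_left inner_diff_right inner_commute algebra_simps)
      \<comment> \<open>Substitution y = x + e z. Its Jacobian is the power of e by which the
        transform of the dilate of m differs from a dilate of \<open>fourier m\<close>.\<close>
      also have "\<dots> = \<bar>e\<bar> ^ DIM(real^'n) *\<^sub>R (LINT z|lborel. f (x + e *\<^sub>R z) * fourier (\<lambda>\<xi>. m (e *\<^sub>R \<xi>)) (x + e *\<^sub>R z - x))"
      proof (rule lborel_integral_affine)
        have "fourier (\<lambda>\<xi>. m (e *\<^sub>R \<xi>)) \<in> borel_measurable borel"
          using testfun_affine_compose[OF m(1), of e 0] e by (intro fourier_measurable) auto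
        then show "(\<lambda>y. f y * fourier (\<lambda>\<xi>. m (e *\<^sub>R \<xi>)) (y - x)) \<in> borel_measurable borel"
          by measurable
      qed (use e in auto)
      also have "\<dots> = (LINT z|lborel. f (x + e *\<^sub>R z) * (\<bar>e\<bar> ^ CARD('n) *\<^sub>R fourier (\<lambda>\<xi>. m (e *\<^sub>R \<xi>)) (e *\<^sub>R z)))"
        by (simp flip: integral_scaleR_right)
      also have "\<dots> = (LINT z|lborel. f (x + e *\<^sub>R z) * fourier m z)"
        using e by (subst fourier_scaleR[symmetric]) auto
      finally show ?thesis by (simp add: e_def)
    qed
    have "(\<lambda>k. LINT \<xi>|lborel. cis (x \<bullet> \<xi>) * m (?h k *\<^sub>R \<xi>) * fourier f \<xi>) \<longlonglongrightarrow>
        (LINT \<xi>|lborel. cis (x \<bullet> \<xi>) * fourier f \<xi>)"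
    proof (rule integral_dominated_convergence[where w = "\<lambda>\<xi>. Bm * cmod (fourier f \<xi>)"])
      show "integrable lborel (\<lambda>\<xi>. Bm * cmod (fourier f \<xi>))"
        by (intro integrable_mult_right integrable_norm fourier_integrable f)
      show "AE \<xi> in lborel. (\<lambda>k. cis (x \<bullet> \<xi>) * m (?h k *\<^sub>R \<xi>) * fourier f \<xi>) \<longlonglongrightarrow> cis (x \<bullet> \<xi>) * fourier f \<xi>"
      proof (rule AE_I2)
        fix \<xi> :: "real^'n"
        have "(\<lambda>k. m (?h k *\<^sub>R \<xi>)) \<longlonglongrightarrow> m (0 *\<^sub>R \<xi>)"
          by (rule continuous_on_tendsto_compose[OF testfun_continuous[OF m(1), of UNIV]
                tendsto_scaleR[OF h_lim tendsto_const]]) auto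
        then have "(\<lambda>k. cis (x \<bullet> \<xi>) * m (?h k *\<^sub>R \<xi>) * fourier f \<xi>) \<longlonglongrightarrow> cis (x \<bullet> \<xi>) * 1 * fourier f \<xi>"
          using m(2) by (intro tendsto_mult tendsto_const) simp
        then show "(\<lambda>k. cis (x \<bullet> \<xi>) * m (?h k *\<^sub>R \<xi>) * fourier f \<xi>) \<longlonglongrightarrow> cis (x \<bullet> \<xi>) * fourier f \<xi>"
          by simp
      qed
      show "AE \<xi> in lborel. cmod (cis (x \<bullet> \<xi>) * m (?h k *\<^sub>R \<xi>) * fourier f \<xi>) \<le> Bm * cmod (fourier f \<xi>)" for k
        by (intro AE_I2) (auto simp: norm_mult intro!: mult_right_mono Bm)
    qed measurable
    moreover have "(\<lambda>k. LINT z|lborel. f (x + ?h k *\<^sub>R z) * fourier m z) \<longlonglongrightarrow>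
        (LINT z|lborel. f x * fourier m z)"
    proof (rule integral_dominated_convergence[where w = "\<lambda>\<xi>. Bf * cmod (fourier m \<xi>)"])
      show "integrable lborel (\<lambda>\<xi>. Bf * cmod (fourier m \<xi>))"
        by (intro integrable_mult_right integrable_norm fourier_integrable m)
      show "AE z in lborel. (\<lambda>k. f (x + ?h k *\<^sub>R z) * fourier m z) \<longlonglongrightarrow> f x * fourier m z"
      proof (rule AE_I2)
        fix z :: "real^'n"
        have "(\<lambda>k. f (x + ?h k *\<^sub>R z)) \<longlonglongrightarrow> f (x + 0 *\<^sub>R z)"
          by (rule continuous_on_tendsto_compose[OF testfun_continuous[OF f, of UNIV]
                tendsto_add[OF tendsto_const tendsto_scaleR[OF h_lim tendsto_const]]]) auto
        then show "(\<lambda>k. f (x + ?h k *\<^sub>R z) * fourier m z) \<longlonglongrightarrow> f x * fourier m z"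
          by (intro tendsto_mult tendsto_const) simp
      qed
      show "AE z in lborel. cmod (f (x + ?h k *\<^sub>R z) * fourier m z) \<le> Bf * cmod (fourier m z)" for k
        by (intro AE_I2) (auto simp: norm_mult intro!: mult_right_mono Bf)
    qed measurable
    ultimately have "(LINT \<xi>|lborel. cis (x \<bullet> \<xi>) * fourier f \<xi>) = (LINT z|lborel. f x * fourier m z)"
      unfolding eq by (rule LIMSEQ_unique)
    then show ?thesis by (simp add: c0_def)
  qed
  have "c0 \<noteq> 0"
  proof
    assume c0: "c0 = 0"
    \<comment> \<open>Plancherel: \<open>\<integral>|F f|\<^sup>2 = c\<^sub>0 \<integral>|f|\<^sup>2\<close>, so every \<open>F f\<close> would vanish.\<close>
    have F0: "fourier f \<xi> = 0" if f: "f \<in> testfun" for f :: "real^'n \<Rightarrow> complex" and \<xi>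
    proof -
      have [measurable]: "f \<in> borel_measurable borel" "fourier f \<in> borel_measurable borel"
        using testfun_measurable[OF f] fourier_measurable[OF f] .
      have "(LINT \<xi>|lborel. fourier f \<xi> * (LINT y|lborel. cis (snd (\<xi>, y) \<bullet> fst (\<xi>, y)) * cnj (f y))) =
          (LINT y|lborel. cnj (f y) * (LINT \<xi>|lborel. cis (snd (\<xi>, y) \<bullet> fst (\<xi>, y)) * fourier f \<xi>))"
        by (rule integral_kernel_swap[OF fourier_integrable[OF f] _, of "\<lambda>y. cnj (f y)" "\<lambda>p. cis (snd p \<bullet> fst p)" 1])
           (auto intro: testfun_integrable[OF f])
      also have "\<dots> = 0" using inv[OF f] c0 by simp
      finally have "(LINT \<xi>|lborel. fourier f \<xi> * (LINT y|lborel. cis (snd (\<xi>, y) \<bullet> fst (\<xi>, y)) * cnj (f y))) = 0" .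
      moreover have "(LINT y|lborel. cis (snd (\<xi>, y) \<bullet> fst (\<xi>, y)) * cnj (f y)) = cnj (fourier f \<xi>)" for \<xi>
        unfolding fourier_def by (simp add: cis_cnj flip: Bochner_Integration.integral_cnj)
      ultimately have "(LINT \<xi>|lborel. complex_of_real ((cmod (fourier f \<xi>))\<^sup>2)) = 0"
        by (simp only: complex_norm_square)
      then have zero: "(LINT \<xi>|lborel. (cmod (fourier f \<xi>))\<^sup>2) = 0"
        by (simp only: integral_complex_of_real of_real_eq_0_iff)
      obtain B where B: "\<And>\<xi>. cmod (fourier f \<xi>) \<le> B" using cmod_fourier_le by blast
      have "integrable lborel (\<lambda>\<xi>. (cmod (fourier f \<xi>))\<^sup>2)"
      proof (rule Bochner_Integration.integrable_bound)
        show "integrable lborel (\<lambda>\<xi>. B * cmod (fourier f \<xi>))"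
          by (intro integrable_mult_right integrable_norm fourier_integrable f)
        show "AE \<xi> in lborel. norm ((cmod (fourier f \<xi>))\<^sup>2) \<le> norm (B * cmod (fourier f \<xi>))"
        proof (rule AE_I2)
          fix \<xi>
          have "(cmod (fourier f \<xi>))\<^sup>2 \<le> B * cmod (fourier f \<xi>)"
            using B[of \<xi>] by (simp add: power2_eq_square mult_right_mono)
          then show "norm ((cmod (fourier f \<xi>))\<^sup>2) \<le> norm (B * cmod (fourier f \<xi>))" by simp
        qed
      qed measurable
      then have "AE \<xi> in lborel. (cmod (fourier f \<xi>))\<^sup>2 = 0"
        using integral_nonneg_eq_0_iff_AE[of lborel "\<lambda>\<xi>. (cmod (fourier f \<xi>))\<^sup>2"] zero by simp
      then have "AE \<xi> in lborel. fourier f \<xi> = 0" by simp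
      then show ?thesis using continuous_AE_zero fourier_continuous[OF f] by blast
    qed
    \<comment> \<open>The transform of |m|^2 at the origin is the integral of |m|^2. If it vanishes,
      then so does m almost everywhere, and by continuity at 0, where its value is 1.\<close>
    have mm: "(\<lambda>x. m x * cnj (m x)) \<in> testfun"
      by (rule testfun_mult_right[OF m(1) smooth_bounded_linear_compose[OF bounded_linear_cnj testfun_smooth[OF m(1)]]])
    have "(LINT x|lborel. complex_of_real ((cmod (m x))\<^sup>2)) = 0"
      using F0[OF mm, of 0] by (simp only: fourier_def complex_norm_square inner_zero_right minus_zero cis_zero mult_1)
    then have zero: "(LINT x|lborel. (cmod (m x))\<^sup>2) = 0"
      by (simp only: integral_complex_of_real of_real_eq_0_iff)
    have int: "integrable lborel (\<lambda>x. (cmod (m x))\<^sup>2)"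
      using testfun_integrable[OF mm] by (simp only: complex_norm_square[symmetric] complex_of_real_integrable_eq)
    have "AE x in lborel. (cmod (m x))\<^sup>2 = 0"
      using integral_nonneg_eq_0_iff_AE[OF int] zero by simp
    then have "AE x in lborel. m x = 0" by simp
    then have "m 0 = 0" using continuous_AE_zero testfun_continuous[OF m(1)] by blast
    then show False using m(2) by simp
  qed
  then have "c0 / complex_of_real ((2 * pi) ^ CARD('n)) \<noteq> 0" by simp
  moreover have "inv_fourier (fourier f) x = c0 / complex_of_real ((2 * pi) ^ CARD('n)) * f x" if "f \<in> testfun" for f :: "real^'n \<Rightarrow> complex" and x
    using inv[OF that] by (simp add: inv_fourier_def)
  ultimately show ?thesis by blast
qed

text \<open>The convolution theorem in the order that blocks require: by duality a block evaluates u
  at \<open>fourier\<close> of a multiplier times \<open>inv_fourier \<psi>\<close>.\<close>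

lemma fourier_mult_inv_fourier:
  fixes m f :: "real^'n::finite \<Rightarrow> complex"
  assumes m: "m \<in> testfun" and f: "f \<in> testfun"
  shows "fourier (\<lambda>\<xi>. m \<xi> * inv_fourier f \<xi>) x =
    (LINT y|lborel. fourier m (x - y) * f y) / complex_of_real ((2 * pi) ^ CARD('n))"
proof -
  let ?c = "complex_of_real ((2 * pi) ^ CARD('n))"
  have [measurable]: "m \<in> borel_measurable borel" "f \<in> borel_measurable borel"
    using testfun_measurable[OF m] testfun_measurable[OF f] .
  have i: "integrable lborel (\<lambda>\<xi>. cis (- (\<xi> \<bullet> x)) * m \<xi>)"
    by (intro integrable_cis_mult testfun_integrable m) auto
  have "fourier (\<lambda>\<xi>. m \<xi> * inv_fourier f \<xi>) x =
      (LINT \<xi>|lborel. cis (- (\<xi> \<bullet> x)) * m \<xi> * (LINT y|lborel. cis (fst (\<xi>, y) \<bullet> snd (\<xi>, y)) * f y)) / ?c"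
    unfolding fourier_def inv_fourier_def integral_divide_zero[symmetric] by (simp add: mult.assoc)
  also have "(LINT \<xi>|lborel. cis (- (\<xi> \<bullet> x)) * m \<xi> * (LINT y|lborel. cis (fst (\<xi>, y) \<bullet> snd (\<xi>, y)) * f y)) =
      (LINT y|lborel. f y * (LINT \<xi>|lborel. cis (fst (\<xi>, y) \<bullet> snd (\<xi>, y)) * (cis (- (\<xi> \<bullet> x)) * m \<xi>)))"
    by (rule integral_kernel_swap[OF i testfun_integrable[OF f], of "\<lambda>p. cis (fst p \<bullet> snd p)" 1]) auto
  also have "\<dots> = (LINT y|lborel. fourier m (x - y) * f y)"
    unfolding fourier_def
    by (simp add: mult.assoc[symmetric] cis_mult inner_diff_right mult.commute[of "f _"])
  finally show ?thesis .
qed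

section \<open>Functions determined by their mollifications\<close>

lemma mem_box_if_norm_less:
  fixes x :: "'a::euclidean_space"
  assumes "norm x < r"
  shows "x \<in> box (- r *\<^sub>R One) (r *\<^sub>R One)"
proof -
  have "\<bar>x \<bullet> i\<bar> < r" if "i \<in> Basis" for i
    using Basis_le_norm[OF that, of x] assms by linarith
  then show ?thesis by (auto simp: mem_box abs_less_iff minus_less_iff)
qed

text \<open>Boxes form an intersection-stable generator of the Borel sets, so vanishing integrals
  spread from boxes to all Borel sets by a Dynkin argument.\<close>

lemma AE_zero_if_box_integrals_zero:
  fixes h :: "'a::euclidean_space \<Rightarrow> complex"
  assumes h: "integrable lborel h"
    and box: "\<And>a b. (LINT x:box a b|lborel. h x) = 0"
  shows "AE x in lborel. h x = 0"
proof (rule sigma_finite_measure.density_zero[OF sigma_finite_lborel h])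
  fix A :: "'a set" assume "A \<in> sets lborel"
  then have A: "A \<in> sigma_sets UNIV (range (\<lambda>(a, b). box a b :: 'a set))"
    by (simp add: borel_eq_box)
  have si: "set_integrable lborel B h" if "B \<in> sets borel" for B
    using h that unfolding set_integrable_def by (intro integrable_mult_indicator) auto
  have mem: "B \<in> sets borel" if "B \<in> sigma_sets UNIV (range (\<lambda>(a, b). box a b :: 'a set))" for B
    using that by (simp add: borel_eq_box)
  \<comment> \<open>Passing to complements needs the integral over the whole space, obtained as the
    limit over growing boxes.\<close>
  have total: "(LINT x|lborel. h x) = 0"
  proof -
    have "(\<lambda>k. LINT x:box (- real k *\<^sub>R One) (real k *\<^sub>R One)|lborel. h x) \<longlonglongrightarrow> (LINT x|lborel. h x)"
      unfolding set_lebesgue_integral_def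
    proof (rule integral_dominated_convergence[where w = "\<lambda>x. norm (h x)"])
      show "AE x in lborel. (\<lambda>k. indicator (box (- real k *\<^sub>R One) (real k *\<^sub>R One)) x *\<^sub>R h x) \<longlonglongrightarrow> h x"
      proof (rule AE_I2)
        fix x :: 'a
        have "\<forall>\<^sub>F k in sequentially. indicator (box (- real k *\<^sub>R One) (real k *\<^sub>R One)) x *\<^sub>R h x = h x"
          using eventually_gt_at_top[of "nat \<lceil>norm x\<rceil>"]
        proof eventually_elim
          fix k assume "nat \<lceil>norm x\<rceil> < k"
          then have "norm x < real k" by linarith
          then have "x \<in> box (- real k *\<^sub>R One) (real k *\<^sub>R One)"
            by (rule mem_box_if_norm_less)
          then show "indicator (box (- real k *\<^sub>R One) (real k *\<^sub>R One)) x *\<^sub>R h x = h x" by simp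
        qed
        then show "(\<lambda>k. indicator (box (- real k *\<^sub>R One) (real k *\<^sub>R One)) x *\<^sub>R h x) \<longlonglongrightarrow> h x"
          by (rule tendsto_eventually)
      qed
    qed (use h in \<open>auto intro!: borel_measurable_integrable integrable_mult_indicator simp: indicator_def\<close>)
    then show ?thesis using box by (simp add: LIMSEQ_const_iff)
  qed
  have "Int_stable (range (\<lambda>(a, b). box a b :: 'a set))"
    by (auto simp: Int_stable_def box_Int_box)
  moreover have "range (\<lambda>(a, b). box a b :: 'a set) \<subseteq> Pow UNIV" by simp
  ultimately show "(LINT x:A|lborel. h x) = 0"
    using A
  proof (induction rule: sigma_sets_induct_disjoint)
    case (compl A)
    have "indicator (UNIV - A) x *\<^sub>R h x = h x - indicator A x *\<^sub>R h x" for x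
      by (simp add: indicator_def)
    then have "(LINT x:UNIV - A|lborel. h x) = (LINT x|lborel. h x) - (LINT x:A|lborel. h x)"
      using Bochner_Integration.integral_diff[OF h si[OF mem[OF compl(1)], unfolded set_integrable_def]]
      by (simp add: set_lebesgue_integral_def)
    then show ?case using compl total by simp
  next
    case (union A)
    have "(LINT x:(\<Union>i. A i)|lborel. h x) = (\<Sum>i. LINT x:A i|lborel. h x)"
    proof (rule lebesgue_integral_countable_add)
      show "A i \<in> sets lborel" for i using union(2) mem by auto
      then show "set_integrable lborel (\<Union>i. A i) h" by (intro si) auto
      show "A i \<inter> A j = {}" if "i \<noteq> j" for i j
        using union(1) that by (auto simp: disjoint_family_on_def)
    qed
    then show ?case using union(3) by simp
  qed (use box in \<open>auto simp: set_lebesgue_integral_def\<close>)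
qed

text \<open>Integrating the vanishing mollifications over a box and exchanging the integrals tests h
  against the mollified indicator of the box. As e tends to 0 this tends to the indicator times the
  integral of rho, so the integrals of h over boxes vanish.\<close>

lemma AE_zero_if_mollifications_zero:
  fixes h :: "real^'n::finite \<Rightarrow> complex"
  assumes [measurable]: "h \<in> borel_measurable borel"
    and loc: "\<And>R. integrable lborel (\<lambda>x. indicator (cball 0 R) x *\<^sub>R h x)"
    and \<rho>: "\<rho> \<in> testfun" "(LINT x|lborel. \<rho> x) \<noteq> 0"
    and zero: "\<And>e y. e > 0 \<Longrightarrow> (LINT x|lborel. h x * \<rho> ((x - y) /\<^sub>R e)) = 0"
  shows "AE x in lborel. h x = 0"
proof -
  let ?e = "\<lambda>k. inverse (real (Suc k))"
  have e_lim: "?e \<longlonglongrightarrow> 0" by (rule LIMSEQ_inverse_real_of_nat)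
  obtain R where R: "R > 0" "\<And>x. R < norm x \<Longrightarrow> \<rho> x = 0" using testfunE[OF \<rho>(1)] by blast
  obtain B where B: "B > 0" "\<And>x. cmod (\<rho> x) \<le> B" using testfun_bounded[OF \<rho>(1)] by blast
  have [measurable]: "\<rho> \<in> borel_measurable borel" by (rule testfun_measurable[OF \<rho>(1)])
  have \<rho>i: "integrable lborel \<rho>" by (rule testfun_integrable[OF \<rho>(1)])
  have box0: "(LINT x:box a b|lborel. h x) = 0" for a b :: "real^'n"
  proof -
    let ?Q = "box a b"
    obtain S0 where S0: "\<And>y. y \<in> ?Q \<Longrightarrow> norm y \<le> S0"
      using bounded_box[of a b] by (auto simp: bounded_iff)
    \<comment> \<open>For e at most 1, a bump centred in the box lives within radius S, so
      truncating h there changes none of these integrals and makes Fubini applicable.\<close>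
    define S where "S = S0 + R"
    define g where "g = (\<lambda>x. indicator (cball 0 S) x *\<^sub>R h x)"
    have gi: "integrable lborel g" unfolding g_def by (rule loc)
    have [measurable]: "g \<in> borel_measurable borel" using borel_measurable_integrable[OF gi] by simp
    have Qi: "integrable lborel (\<lambda>y. indicator ?Q y :: complex)"
    proof -
      have "integrable lborel (\<lambda>y. complex_of_real (indicator ?Q y))"
        by (intro integrable_of_real integrable_real_indicator) (auto simp: emeasure_lborel_box_eq)
      then show ?thesis by (simp add: of_real_indicator)
    qed
    have smooth0: "(LINT x|lborel. g x * (LINT z|lborel. indicator ?Q (x - ?e k *\<^sub>R z) * \<rho> z)) = 0" for k
    proof -
      define e where "e = ?e k"
      have e: "e > 0" "e \<le> 1" by (auto simp: e_def field_simps)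
      have inner: "(LINT y|lborel. \<rho> ((x - y) /\<^sub>R e) * indicator ?Q y) =
          e ^ CARD('n) *\<^sub>R (LINT z|lborel. indicator ?Q (x - e *\<^sub>R z) * \<rho> z)" for x
      proof -
        have "(LINT y|lborel. \<rho> ((x - y) /\<^sub>R e) * indicator ?Q y) =
          \<bar>- e\<bar> ^ DIM(real^'n) *\<^sub>R (LINT z|lborel. \<rho> ((x - (x + (- e) *\<^sub>R z)) /\<^sub>R e) * indicator ?Q (x + (- e) *\<^sub>R z))"
          by (rule lborel_integral_affine) (use e in auto)
        then show ?thesis using e by (simp add: mult.commute)
      qed
      have "(LINT x|lborel. g x * (LINT y|lborel. \<rho> ((fst (x, y) - snd (x, y)) /\<^sub>R e) * indicator ?Q y)) =
          (LINT y|lborel. indicator ?Q y * (LINT x|lborel. \<rho> ((fst (x, y) - snd (x, y)) /\<^sub>R e) * g x))"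
        by (rule integral_kernel_swap[OF gi Qi, of "\<lambda>p. \<rho> ((fst p - snd p) /\<^sub>R e)" B]) (auto intro: B)
      also have "\<dots> = 0"
      proof -
        have "indicator ?Q y * (LINT x|lborel. \<rho> ((fst (x, y) - snd (x, y)) /\<^sub>R e) * g x) = 0" for y
        proof (cases "y \<in> ?Q")
          case True
          have eq: "\<rho> ((x - y) /\<^sub>R e) * g x = h x * \<rho> ((x - y) /\<^sub>R e)" for x
          proof (cases "norm x \<le> S")
            case False
            have "norm x \<le> norm (x - y) + norm y" by (metis norm_triangle_sub add.commute)
            then have "R < norm (x - y)" using False S0[OF True] by (simp add: S_def)
            also have "\<dots> \<le> norm ((x - y) /\<^sub>R e)"
              using e mult_right_mono[of 1 "inverse e" "norm (x - y)"] by (simp add: one_le_inverse)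
            finally show ?thesis using R by simp
          qed (simp add: g_def)
          show ?thesis
            using zero[OF e(1), of y] by (simp only: fst_conv snd_conv eq mult_zero_right)
        qed simp
        then show ?thesis by (simp only: Bochner_Integration.integral_zero)
      qed
      finally have "(LINT x|lborel. g x * (e ^ CARD('n) *\<^sub>R (LINT z|lborel. indicator ?Q (x - e *\<^sub>R z) * \<rho> z))) = 0"
        by (simp add: inner)
      then show ?thesis using e by (simp add: e_def)
    qed
    have "(\<lambda>k. LINT x|lborel. g x * (LINT z|lborel. indicator ?Q (x - ?e k *\<^sub>R z) * \<rho> z)) \<longlonglongrightarrow>
        (LINT x|lborel. g x * (LINT z|lborel. indicator ?Q x * \<rho> z))"
    proof (rule integral_dominated_convergence[where w = "\<lambda>x. cmod (g x) * (LINT z|lborel. cmod (\<rho> z))"])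
      show "integrable lborel (\<lambda>x. cmod (g x) * (LINT z|lborel. cmod (\<rho> z)))"
        using gi by simp
      \<comment> \<open>Off the frontier, points near x lie on the same side of the box as x, so the
        mollified indicators converge there.\<close>
      have "AE x in lborel. x \<notin> frontier ?Q"
        using negligible_convex_frontier[OF convex_box(2), of a b]
        by (simp add: AE_not_in negligible_iff_null_sets null_sets_completion_iff)
      then show "AE x in lborel. (\<lambda>k. g x * (LINT z|lborel. indicator ?Q (x - ?e k *\<^sub>R z) * \<rho> z)) \<longlonglongrightarrow>
          g x * (LINT z|lborel. indicator ?Q x * \<rho> z)"
      proof eventually_elim
        fix x :: "real^'n" assume x: "x \<notin> frontier ?Q"
        have "(\<lambda>k. LINT z|lborel. indicator ?Q (x - ?e k *\<^sub>R z) * \<rho> z) \<longlonglongrightarrow> (LINT z|lborel. indicator ?Q x * \<rho> z)"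
        proof (rule integral_dominated_convergence[where w = "\<lambda>z. cmod (\<rho> z)"])
          show "AE z in lborel. (\<lambda>k. indicator ?Q (x - ?e k *\<^sub>R z) * \<rho> z) \<longlonglongrightarrow> indicator ?Q x * \<rho> z"
          proof (rule AE_I2, rule tendsto_mult[OF _ tendsto_const])
            fix z :: "real^'n"
            have "(\<lambda>k. x - ?e k *\<^sub>R z) \<longlonglongrightarrow> x - 0 *\<^sub>R z"
              by (intro tendsto_diff tendsto_scaleR tendsto_const e_lim)
            then have lim: "(\<lambda>k. x - ?e k *\<^sub>R z) \<longlonglongrightarrow> x" by simp
            have "x \<in> interior ?Q \<or> x \<in> interior (- ?Q)"
              using x by (auto simp: frontier_def interior_complement)
            then have "\<forall>\<^sub>F k in sequentially. indicator ?Q (x - ?e k *\<^sub>R z) = (indicator ?Q x :: complex)"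
            proof
              assume "x \<in> interior ?Q"
              from topological_tendstoD[OF lim open_interior this] this
              show ?thesis using interior_subset[of ?Q] by (auto elim!: eventually_mono simp: indicator_def subset_eq)
            next
              assume "x \<in> interior (- ?Q)"
              from topological_tendstoD[OF lim open_interior this] this
              show ?thesis using interior_subset[of "- ?Q"] by (auto elim!: eventually_mono simp: indicator_def subset_eq)
            qed
            then show "(\<lambda>k. indicator ?Q (x - ?e k *\<^sub>R z) :: complex) \<longlonglongrightarrow> indicator ?Q x"
              by (rule tendsto_eventually)
          qed
          show "AE z in lborel. cmod (indicator ?Q (x - ?e k *\<^sub>R z) * \<rho> z) \<le> cmod (\<rho> z)" for k
            by (intro AE_I2) (auto simp: indicator_def norm_mult)
        qed (use \<rho>i in auto)
        then show "(\<lambda>k. g x * (LINT z|lborel. indicator ?Q (x - ?e k *\<^sub>R z) * \<rho> z)) \<longlonglongrightarrow>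
            g x * (LINT z|lborel. indicator ?Q x * \<rho> z)"
          by (intro tendsto_mult tendsto_const)
      qed
      show "AE x in lborel. cmod (g x * (LINT z|lborel. indicator ?Q (x - ?e k *\<^sub>R z) * \<rho> z))
          \<le> cmod (g x) * (LINT z|lborel. cmod (\<rho> z))" for k
      proof (rule AE_I2)
        fix x
        have "cmod (LINT z|lborel. indicator ?Q (x - ?e k *\<^sub>R z) * \<rho> z)
            \<le> (LINT z|lborel. cmod (indicator ?Q (x - ?e k *\<^sub>R z) * \<rho> z))"
          by (rule integral_norm_bound)
        also have "\<dots> \<le> (LINT z|lborel. cmod (\<rho> z))"
        proof (rule integral_mono)
          show "integrable lborel (\<lambda>z. cmod (\<rho> z))" using \<rho>i by simp
          then show "integrable lborel (\<lambda>z. cmod (indicator ?Q (x - ?e k *\<^sub>R z) * \<rho> z))"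
            by (rule Bochner_Integration.integrable_bound) (auto simp: indicator_def norm_mult)
        qed (auto simp: indicator_def norm_mult)
        finally show "cmod (g x * (LINT z|lborel. indicator ?Q (x - ?e k *\<^sub>R z) * \<rho> z))
            \<le> cmod (g x) * (LINT z|lborel. cmod (\<rho> z))"
          by (simp add: norm_mult mult_left_mono)
      qed
    qed measurable
    then have "(LINT x|lborel. g x * (LINT z|lborel. indicator ?Q x * \<rho> z)) = 0"
      unfolding smooth0 by (simp add: LIMSEQ_const_iff)
    then have "(LINT x|lborel. g x * indicator ?Q x) * (LINT z|lborel. \<rho> z) = 0"
      by (simp add: mult.assoc[symmetric])
    moreover have "g x * indicator ?Q x = indicator ?Q x *\<^sub>R h x" for x
      using S0[of x] R(1) by (auto simp: g_def S_def indicator_def)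
    ultimately show ?thesis
      using \<rho>(2) by (simp add: set_lebesgue_integral_def)
  qed
  \<comment> \<open>h is only locally integrable, so the box criterion is applied to its truncations
    to cubes; a box cut by a cube is again a box.\<close>
  let ?Q = "\<lambda>N::nat. box (- real N *\<^sub>R One) (real N *\<^sub>R One) :: (real^'n) set"
  have "AE x in lborel. indicator (?Q N) x *\<^sub>R h x = 0" for N
  proof (rule AE_zero_if_box_integrals_zero)
    obtain S where "\<And>x. x \<in> ?Q N \<Longrightarrow> norm x \<le> S"
      using bounded_box[of "- real N *\<^sub>R One" "real N *\<^sub>R One :: real^'n"] unfolding bounded_iff by auto
    then have eq: "indicator (?Q N) x *\<^sub>R h x = indicator (?Q N) x *\<^sub>R (indicator (cball 0 S) x *\<^sub>R h x)" for x
      by (auto simp: indicator_def)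
    show "integrable lborel (\<lambda>x. indicator (?Q N) x *\<^sub>R h x)"
      unfolding eq by (intro integrable_mult_indicator loc) auto
    show "(LINT x:box a b|lborel. indicator (?Q N) x *\<^sub>R h x) = 0" for a b
    proof -
      obtain c d where cd: "box a b \<inter> ?Q N = box c d" unfolding box_Int_box by blast
      have eq: "indicator (box a b) x *\<^sub>R (indicator (?Q N) x *\<^sub>R h x) = indicator (box c d) x *\<^sub>R h x" for x
        unfolding cd[symmetric] by (simp add: indicator_inter_arith)
      show ?thesis
        using box0[of c d] by (simp only: set_lebesgue_integral_def eq)
    qed
  qed
  then have "AE x in lborel. \<forall>N. indicator (?Q N) x *\<^sub>R h x = 0"
    by (simp only: AE_all_countable simp_thms)
  then show ?thesis
  proof eventually_elim
    fix x :: "real^'n" assume *: "\<forall>N. indicator (?Q N) x *\<^sub>R h x = 0"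
    obtain N where N: "norm x < real N" using reals_Archimedean2 by blast
    then have "x \<in> ?Q N" by (rule mem_box_if_norm_less)
    then show "h x = 0" using *[rule_format, of N] by simp
  qed
qed

section \<open>Lorentz quasi-norms\<close>

lemma ennreal_le_if_mult_le:
  assumes "c > 0" "0 \<le> b" "ennreal c * x \<le> ennreal b"
  shows "x \<le> ennreal (b / c)"
proof -
  have "x = ennreal (1 / c) * (ennreal c * x)"
    using assms(1) by (simp add: mult.assoc[symmetric] ennreal_mult[symmetric])
  also have "\<dots> \<le> ennreal (1 / c) * ennreal b"
    by (intro mult_left_mono assms) simp
  also have "\<dots> = ennreal (b / c)"
    using assms by (subst ennreal_mult[symmetric]) auto
  finally show ?thesis .
qed

lemma rearrangement_le_if_lorentz_norm_le:
  assumes "lorentz_norm q \<infinity> g \<le> ennreal A" "A \<ge> 0" "t > 0"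
  shows "decreasing_rearrangement g t \<le> ennreal (A * t powr (- recip q))"
proof -
  have "ennreal (t powr recip q) * decreasing_rearrangement g t \<le> lorentz_norm q \<infinity> g"
    using assms(3) unfolding lorentz_norm_def by (auto intro: SUP_upper)
  also have "\<dots> \<le> ennreal A" by fact
  finally have "decreasing_rearrangement g t \<le> ennreal (A / t powr recip q)"
    using assms by (intro ennreal_le_if_mult_le) auto
  then show ?thesis by (simp add: powr_minus divide_inverse)
qed

text \<open>The minimum of two positive numbers is at most each of their weighted geometric
  means.\<close>

lemma rearrangement_interpolation:
  assumes A: "A > 0" "decreasing_rearrangement g t \<le> ennreal (A * t powr (- a))"
    and B: "B > 0" "decreasing_rearrangement g t \<le> ennreal (B * t powr (- b))"
    and t: "t > 0" and \<eta>: "0 \<le> \<eta>" "\<eta> \<le> 1"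
  shows "decreasing_rearrangement g t \<le>
    ennreal (A powr \<eta> * B powr (1 - \<eta>) * t powr (- (\<eta> * a + (1 - \<eta>) * b)))"
proof -
  define x y where "x = A * t powr (- a)" and "y = B * t powr (- b)"
  have x: "x > 0" and y: "y > 0" using A B t by (auto simp: x_def y_def)
  have "min x y = min x y powr \<eta> * min x y powr (1 - \<eta>)"
    using x y by (simp add: powr_add[symmetric])
  also have "\<dots> \<le> x powr \<eta> * y powr (1 - \<eta>)"
    using x y \<eta> by (intro mult_mono powr_mono2) auto
  also have "\<dots> = A powr \<eta> * B powr (1 - \<eta>) * t powr (- (\<eta> * a + (1 - \<eta>) * b))"
    using A B t by (simp add: x_def y_def powr_mult powr_powr powr_add[symmetric] algebra_simps)
  finally have "ennreal (min x y) \<le> ennreal \<dots>" by (rule ennreal_leI)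
  moreover have "decreasing_rearrangement g t \<le> ennreal (min x y)"
    using A(2) B(2) by (simp add: x_def y_def min_def)
  ultimately show ?thesis by order
qed

section \<open>Weak bounds: level sets, truncation and convolution\<close>

lemma superlevel_set_lebesgue:
  assumes [measurable]: "g \<in> borel_measurable lebesgue"
  shows "{x. \<alpha> < cmod (g x)} \<in> sets lebesgue"
proof -
  have "(\<lambda>x. cmod (g x)) \<in> borel_measurable lebesgue" by measurable
  then show ?thesis unfolding borel_measurable_iff_greater by simp
qed

lemma distribution_function_weak:
  fixes g :: "'a::euclidean_space \<Rightarrow> complex"
  assumes g: "g \<in> borel_measurable lebesgue"
    and le: "\<And>t. t > 0 \<Longrightarrow> decreasing_rearrangement g t \<le> ennreal (N * t powr (- b))"
    and N: "N > 0" and b: "b > 0" and \<alpha>: "\<alpha> > 0"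
  shows "distribution_function g \<alpha> \<le> ennreal ((2 * N / \<alpha>) powr (1 / b))"
proof -
  \<comment> \<open>Chosen so that N t^(-b) is half of alpha. Being strictly below alpha, the
    infimum that defines the rearrangement admits a level beta < alpha.\<close>
  define t where "t = (2 * N / \<alpha>) powr (1 / b)"
  have t: "t > 0" using N \<alpha> by (simp add: t_def)
  have "N * t powr (- b) = \<alpha> / 2"
    using N \<alpha> b by (simp add: t_def powr_powr powr_minus)
  then have "decreasing_rearrangement g t \<le> ennreal (\<alpha> / 2)"
    using le[OF t] by metis
  also have "\<dots> < ennreal \<alpha>" using \<alpha> by (intro ennreal_lessI) auto
  finally obtain \<beta> where \<beta>: "\<beta> > 0" "distribution_function g \<beta> \<le> ennreal t" "ennreal \<beta> < ennreal \<alpha>"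
    unfolding decreasing_rearrangement_def Inf_less_iff by auto
  have "{x. \<beta> < cmod (g x)} \<in> sets lebesgue"
    by (rule superlevel_set_lebesgue[OF g])
  then have "distribution_function g \<alpha> \<le> distribution_function g \<beta>"
    unfolding distribution_function_def using \<beta>(1,3) by (intro emeasure_mono) (auto simp: ennreal_less_iff)
  then show ?thesis using \<beta>(2) by (simp add: t_def)
qed

text \<open>2 * 2^(1/b) times the sum of the geometric series of ratio 2^(1 - 1/b), as it arises
  from the dyadic layers in \<open>nn_integral_excess_weak\<close>. The ratio is below 1 when 0 < b
  < 1.\<close>

definition weak_const :: "real \<Rightarrow> real"
  where "weak_const b = 2 * 2 powr (1 / b) / (1 - 2 powr (1 - 1 / b))"

lemma weak_const_nonneg: "0 < b \<Longrightarrow> b < 1 \<Longrightarrow> 0 \<le> weak_const b"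
  using powr_less_mono[of "1 - 1 / b" 0 2] by (auto simp: weak_const_def)

text \<open>Where |g| lies between 2^k alpha and 2^(k+1) alpha the excess is at most 2^(k+1) alpha.
  The weak bound makes the measures of these level sets decay like 2^(-k/b), which beats the factor
  2^k because b < 1.\<close>

lemma nn_integral_excess_weak:
  fixes g :: "'a::euclidean_space \<Rightarrow> complex"
  assumes [measurable]: "g \<in> borel_measurable borel"
    and le: "\<And>t. t > 0 \<Longrightarrow> decreasing_rearrangement g t \<le> ennreal (N * t powr (- b))"
    and N: "N > 0" and b: "0 < b" "b < 1" and \<alpha>: "\<alpha> > 0"
  shows "(\<integral>\<^sup>+x. ennreal (cmod (g x) - \<alpha>) \<partial>lborel) \<le> ennreal (weak_const b * \<alpha> * (N / \<alpha>) powr (1 / b))"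
proof -
  let ?S = "\<lambda>k::nat. {x. 2 ^ k * \<alpha> < cmod (g x)}"
  have meas: "?S k \<in> sets lborel" for k by measurable
  have gl: "g \<in> borel_measurable lebesgue"
    by (simp add: measurable_completion)
  have dyadic: "ennreal (cmod (g x) - \<alpha>) \<le> (\<Sum>k. ennreal (2 ^ Suc k * \<alpha>) * indicator (?S k) x)" for x
  proof (cases "cmod (g x) \<le> \<alpha>")
    case False
    obtain n where "cmod (g x) / \<alpha> < 2 ^ n" using real_arch_pow[of 2 "cmod (g x) / \<alpha>"] by auto
    then have ex: "cmod (g x) \<le> 2 ^ n * \<alpha>" using \<alpha> by (simp add: field_simps)
    \<comment> \<open>The layer of x is k = m - 1: minimality of m puts x into the k-th level set,
      while the height at m still bounds |g x|.\<close>
    define m where "m = (LEAST n. cmod (g x) \<le> 2 ^ n * \<alpha>)"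
    have m: "cmod (g x) \<le> 2 ^ m * \<alpha>" unfolding m_def using ex by (rule LeastI)
    have "m \<noteq> 0" using m False by (intro notI) simp
    then obtain k where k: "m = Suc k" using not0_implies_Suc by blast
    have "\<not> cmod (g x) \<le> 2 ^ k * \<alpha>" using k not_less_Least[of k] unfolding m_def by (metis lessI)
    then have "ennreal (cmod (g x) - \<alpha>) \<le> ennreal (2 ^ Suc k * \<alpha>) * indicator (?S k) x"
      using m \<alpha> by (auto simp: k intro!: ennreal_leI)
    also have "\<dots> \<le> (\<Sum>k. ennreal (2 ^ Suc k * \<alpha>) * indicator (?S k) x)"
      by (rule ennreal_le_suminf)
    finally show ?thesis .
  qed (simp add: ennreal_neg)
  define r where "r = 2 powr (1 - 1 / b)"
  have r: "0 < r" "r < 1" using powr_less_mono[of "1 - 1 / b" 0 2] b by (auto simp: r_def)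
  define c where "c = 2 * \<alpha> * (2 * N / \<alpha>) powr (1 / b)"
  have c: "c \<ge> 0" using \<alpha> by (simp add: c_def)
  have term_le: "ennreal (2 ^ Suc k * \<alpha>) * emeasure lborel (?S k) \<le> ennreal (c * r ^ k)" for k
  proof -
    have pos: "2 ^ k * \<alpha> > 0" using \<alpha> by simp
    have "emeasure lborel (?S k) = distribution_function g (2 ^ k * \<alpha>)"
      unfolding distribution_function_def using meas by simp
    also have "\<dots> \<le> ennreal ((2 * N / (2 ^ k * \<alpha>)) powr (1 / b))"
      using distribution_function_weak[OF gl le N b(1) pos] .
    finally have "ennreal (2 ^ Suc k * \<alpha>) * emeasure lborel (?S k) \<le>
        ennreal (2 ^ Suc k * \<alpha>) * ennreal ((2 * N / (2 ^ k * \<alpha>)) powr (1 / b))"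
      by (intro mult_left_mono) auto
    also have "\<dots> = ennreal (2 ^ Suc k * \<alpha> * (2 * N / (2 ^ k * \<alpha>)) powr (1 / b))"
      using \<alpha> by (subst ennreal_mult) auto
    also have "2 ^ Suc k * \<alpha> * (2 * N / (2 ^ k * \<alpha>)) powr (1 / b) = c * r ^ k"
    proof -
      have "(2 * N / (2 ^ k * \<alpha>)) powr (1 / b) = (2 * N / \<alpha>) powr (1 / b) / (2 powr (1 / b)) ^ k"
      proof -
        have "(2 * N / (2 ^ k * \<alpha>)) = (2 * N / \<alpha>) / 2 ^ k" by simp
        moreover have "(2 ^ k) powr (1 / b) = ((2::real) powr (1 / b)) ^ k"
          by (simp add: powr_realpow[symmetric] powr_powr mult.commute)
        ultimately show ?thesis using N \<alpha> by (simp only: powr_divide)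
      qed
      moreover have "r ^ k = 2 ^ k / (2 powr (1 / b)) ^ k"
        by (simp add: r_def powr_diff power_divide)
      ultimately show ?thesis by (simp add: c_def)
    qed
    finally show ?thesis .
  qed
  have "(\<integral>\<^sup>+x. ennreal (cmod (g x) - \<alpha>) \<partial>lborel) \<le>
      (\<integral>\<^sup>+x. (\<Sum>k. ennreal (2 ^ Suc k * \<alpha>) * indicator (?S k) x) \<partial>lborel)"
    by (intro nn_integral_mono dyadic)
  also have "\<dots> = (\<Sum>k. \<integral>\<^sup>+x. ennreal (2 ^ Suc k * \<alpha>) * indicator (?S k) x \<partial>lborel)"
    by (rule nn_integral_suminf) (use meas in measurable)
  also have "\<dots> = (\<Sum>k. ennreal (2 ^ Suc k * \<alpha>) * emeasure lborel (?S k))"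
    using meas by (simp add: nn_integral_cmult_indicator del: power_Suc)
  also have "\<dots> \<le> (\<Sum>k. ennreal (c * r ^ k))"
    by (intro suminf_le term_le) auto
  also have "\<dots> = ennreal (\<Sum>k. c * r ^ k)"
    using r c by (intro suminf_ennreal2) (auto intro!: summable_mult summable_geometric)
  also have "(\<Sum>k. c * r ^ k) = c / (1 - r)"
    using r by (simp add: suminf_mult summable_geometric suminf_geometric)
  also have "\<dots> = weak_const b * \<alpha> * (N / \<alpha>) powr (1 / b)"
  proof -
    have "(2 * (N / \<alpha>)) powr (1 / b) = 2 powr (1 / b) * (N / \<alpha>) powr (1 / b)"
      using N \<alpha> by (intro powr_mult)
    then show ?thesis by (simp add: weak_const_def r_def c_def)
  qed
  finally show ?thesis .
qed

lemma nn_integral_lborel_affine: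
  fixes f :: "'a::euclidean_space \<Rightarrow> ennreal"
  assumes c: "c \<noteq> 0" and [measurable]: "f \<in> borel_measurable borel"
  shows "(\<integral>\<^sup>+x. f x \<partial>lborel) = ennreal (\<bar>c\<bar> ^ DIM('a)) * (\<integral>\<^sup>+x. f (t + c *\<^sub>R x) \<partial>lborel)"
  by (subst lborel_affine[OF c, of t]) (simp add: nn_integral_density nn_integral_distr nn_integral_cmult)

text \<open>The part of g below a height is paired with the L^1 norm of the dilated kernel, the
  excess above it with the supremum of the kernel. Thus a kernel in both spaces can be integrated
  against a function that is merely in a weak space.\<close>

lemma weak_type_convolution_bound:
  fixes g K :: "'a::euclidean_space \<Rightarrow> complex"
  assumes [measurable]: "g \<in> borel_measurable borel" "K \<in> borel_measurable borel"
    and le: "\<And>t. t > 0 \<Longrightarrow> decreasing_rearrangement g t \<le> ennreal (N * t powr (- b))"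
    and N: "N > 0" and b: "0 < b" "b < 1" and l: "l > 0"
    and K: "\<And>z. cmod (K z) \<le> k" "(\<integral>\<^sup>+z. ennreal (cmod (K z)) \<partial>lborel) \<le> ennreal k" "k \<ge> 0"
  shows "(\<integral>\<^sup>+x. ennreal (cmod (K (l *\<^sub>R (x - y)) * g x)) \<partial>lborel) \<le>
    ennreal (k * (1 + weak_const b) * N * l powr (real DIM('a) * (b - 1)))"
proof -
  \<comment> \<open>With n the dimension, this height gives (N / alpha)^(1/b) = l^(-n), the scaling
    of the L^1 norm of the kernel, so both parts contribute the same power of l.\<close>
  define \<alpha> where "\<alpha> = N * l powr (real DIM('a) * b)"
  have \<alpha>: "\<alpha> > 0" using N l by (simp add: \<alpha>_def)
  have ln: "l ^ DIM('a) = l powr real DIM('a)" using l by (simp add: powr_realpow)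
  have pw: "ennreal (cmod (K (l *\<^sub>R (x - y)) * g x)) \<le>
      ennreal \<alpha> * ennreal (cmod (K (l *\<^sub>R (x - y)))) + ennreal k * ennreal (cmod (g x) - \<alpha>)" for x
  proof -
    let ?a = "cmod (K (l *\<^sub>R (x - y)))"
    have "?a * cmod (g x) \<le> \<alpha> * ?a + k * max 0 (cmod (g x) - \<alpha>)"
    proof (cases "cmod (g x) \<le> \<alpha>")
      case True
      then show ?thesis using mult_left_mono[OF True, of ?a] by (simp add: mult.commute)
    next
      case False
      have "?a * cmod (g x) = \<alpha> * ?a + ?a * (cmod (g x) - \<alpha>)" by (simp add: algebra_simps)
      also have "\<dots> \<le> \<alpha> * ?a + k * (cmod (g x) - \<alpha>)"
        using False K(1) by (intro add_left_mono mult_right_mono) auto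
      finally show ?thesis using False by simp
    qed
    then have "ennreal (cmod (K (l *\<^sub>R (x - y)) * g x)) \<le> ennreal (\<alpha> * ?a + k * max 0 (cmod (g x) - \<alpha>))"
      by (intro ennreal_leI) (simp add: norm_mult)
    also have "\<dots> = ennreal \<alpha> * ennreal ?a + ennreal k * ennreal (max 0 (cmod (g x) - \<alpha>))"
      using \<alpha> K(3) by (simp add: ennreal_mult)
    finally show ?thesis by (simp add: ennreal_max_0)
  qed
  have K1: "(\<integral>\<^sup>+x. ennreal (cmod (K (l *\<^sub>R (x - y)))) \<partial>lborel) \<le> ennreal (k * l powr (- real DIM('a)))"
  proof -
    have "ennreal (l ^ DIM('a)) * (\<integral>\<^sup>+x. ennreal (cmod (K (l *\<^sub>R (x - y)))) \<partial>lborel) =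
        (\<integral>\<^sup>+z. ennreal (cmod (K z)) \<partial>lborel)"
      using nn_integral_lborel_affine[of l "\<lambda>z. ennreal (cmod (K z))" "- l *\<^sub>R y"] l
      by (simp add: algebra_simps)
    then have "(\<integral>\<^sup>+x. ennreal (cmod (K (l *\<^sub>R (x - y)))) \<partial>lborel) \<le> ennreal (k / l ^ DIM('a))"
      using K(2,3) l by (intro ennreal_le_if_mult_le) auto
    then show ?thesis using l by (simp add: powr_minus powr_realpow divide_inverse)
  qed
  have "(\<integral>\<^sup>+x. ennreal (cmod (K (l *\<^sub>R (x - y)) * g x)) \<partial>lborel) \<le>
      (\<integral>\<^sup>+x. ennreal \<alpha> * ennreal (cmod (K (l *\<^sub>R (x - y)))) + ennreal k * ennreal (cmod (g x) - \<alpha>) \<partial>lborel)"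
    by (intro nn_integral_mono pw)
  also have "\<dots> = ennreal \<alpha> * (\<integral>\<^sup>+x. ennreal (cmod (K (l *\<^sub>R (x - y)))) \<partial>lborel) +
      ennreal k * (\<integral>\<^sup>+x. ennreal (cmod (g x) - \<alpha>) \<partial>lborel)"
    by (subst nn_integral_add) (auto simp: nn_integral_cmult)
  also have "\<dots> \<le> ennreal \<alpha> * ennreal (k * l powr (- real DIM('a))) +
      ennreal k * ennreal (weak_const b * \<alpha> * (N / \<alpha>) powr (1 / b))"
    by (intro add_mono mult_left_mono K1 nn_integral_excess_weak le N b \<alpha>) auto
  also have "\<dots> = ennreal (\<alpha> * (k * l powr (- real DIM('a))) + k * (weak_const b * \<alpha> * (N / \<alpha>) powr (1 / b)))"
    using \<alpha> K(3) weak_const_nonneg[OF b] by (simp add: ennreal_mult[symmetric] ennreal_plus[symmetric] del: ennreal_plus)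
  also have "(N / \<alpha>) powr (1 / b) = l powr (- real DIM('a))"
  proof -
    have "N / \<alpha> = l powr (- (real DIM('a) * b))" using N l by (simp add: \<alpha>_def powr_minus divide_inverse)
    then show ?thesis using b by (simp add: powr_powr)
  qed
  also have "\<alpha> * (k * l powr (- real DIM('a))) + k * (weak_const b * \<alpha> * l powr (- real DIM('a))) =
      k * (1 + weak_const b) * N * l powr (real DIM('a) * (b - 1))"
  proof -
    have "l powr (real DIM('a) * (b - 1)) = l powr (real DIM('a) * b) * l powr (- real DIM('a))"
      by (simp add: powr_add[symmetric] algebra_simps)
    then show ?thesis by (simp add: \<alpha>_def algebra_simps)
  qed
  finally show ?thesis .
qed

section \<open>Second Lorentz index 1: estimate from a height bound and a weak bound\<close>

lemma ennpowr_1: "ennpowr x 1 = x"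
  by (cases x) (auto simp: ennpowr_def)

lemma recip_1: "recip 1 = 1"
  by (simp add: recip_def)

lemma rearrangement_le_if_AE_le:
  fixes g :: "'a::euclidean_space \<Rightarrow> complex"
  assumes "AE x in lebesgue. cmod (g x) \<le> M" and M: "M > 0" and g: "g \<in> borel_measurable lebesgue"
  shows "decreasing_rearrangement g t \<le> ennreal M"
proof -
  have "{x. M < cmod (g x)} \<in> sets lebesgue"
    by (rule superlevel_set_lebesgue[OF g])
  then have "distribution_function g M = 0"
    using assms(1) AE_iff_measurable[of "{x. M < cmod (g x)}" lebesgue "\<lambda>x. cmod (g x) \<le> M"]
    unfolding distribution_function_def by (simp add: not_le)
  then show ?thesis
    unfolding decreasing_rearrangement_def using M by (intro Inf_lower) auto
qed

text \<open>The integrand is t^(a - 1) times the rearrangement. The height bound is used up to tau,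
  where 0 < a gives convergence at 0; the weak bound is used beyond tau, where a < b gives
  convergence at infinity.\<close>

lemma lorentz_norm_1_le:
  assumes a: "recip p = a" "0 < a" "a < b" and M: "M > 0" and N: "N > 0" and \<tau>: "\<tau> > 0"
    and le1: "\<And>t. t > 0 \<Longrightarrow> decreasing_rearrangement g t \<le> ennreal M"
    and le2: "\<And>t. t > 0 \<Longrightarrow> decreasing_rearrangement g t \<le> ennreal (N * t powr (- b))"
  shows "lorentz_norm p 1 g \<le> ennreal (M * \<tau> powr a / a + N * \<tau> powr (a - b) / (b - a))"
proof -
  let ?F = "\<lambda>t. ennreal (t powr a) * decreasing_rearrangement g t / ennreal t * indicator {0<..} t"
  let ?G = "\<lambda>t. ennreal M * ennreal (indicator {0..\<tau>} t * t powr (a - 1)) +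
    ennreal N * ennreal (indicator {\<tau>..} t * t powr (a - b - 1))"
  have "?F t \<le> ?G t" for t
  proof (cases "t > 0")
    case t: True
    have div: "ennreal (t powr a) * ennreal x / ennreal t = ennreal (x * t powr (a - 1))" if "x \<ge> 0" for x
      using t that by (simp add: ennreal_mult[symmetric] divide_ennreal powr_diff mult.commute)
    show ?thesis
    proof (cases "t \<le> \<tau>")
      case True
      have "?F t \<le> ennreal (t powr a) * ennreal M / ennreal t"
        using t le1[OF t] by (auto intro!: divide_right_mono_ennreal mult_left_mono)
      also have "\<dots> = ennreal M * ennreal (indicator {0..\<tau>} t * t powr (a - 1))"
        using True t M by (simp add: div ennreal_mult)
      also have "\<dots> \<le> ?G t" by simp
      finally show ?thesis .
    next
      case False
      have "?F t \<le> ennreal (t powr a) * ennreal (N * t powr (- b)) / ennreal t"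
        using t le2[OF t] by (auto intro!: divide_right_mono_ennreal mult_left_mono)
      also have "\<dots> = ennreal (N * t powr (- b) * t powr (a - 1))"
        using N by (intro div) simp
      also have "N * t powr (- b) * t powr (a - 1) = N * t powr (a - b - 1)"
        by (simp add: powr_add[symmetric] algebra_simps)
      also have "ennreal \<dots> = ennreal N * ennreal (indicator {\<tau>..} t * t powr (a - b - 1))"
        using False N by (simp add: ennreal_mult)
      also have "\<dots> \<le> ?G t" by simp
      finally show ?thesis .
    qed
  qed simp
  then have "(\<integral>\<^sup>+t. ?F t \<partial>lborel) \<le> (\<integral>\<^sup>+t. ?G t \<partial>lborel)"
    by (rule nn_integral_mono)
  also have "\<dots> = ennreal M * (\<integral>\<^sup>+t. ennreal (indicator {0..\<tau>} t * t powr (a - 1)) \<partial>lborel) +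
      ennreal N * (\<integral>\<^sup>+t. ennreal (indicator {\<tau>..} t * t powr (a - b - 1)) \<partial>lborel)"
    by (subst nn_integral_add) (auto simp: nn_integral_cmult)
  also have "(\<integral>\<^sup>+t. ennreal (indicator {0..\<tau>} t * t powr (a - 1)) \<partial>lborel) = ennreal (\<tau> powr a / a)"
    using nn_integral_has_integral_lebesgue[OF _ has_integral_powr_from_0[of "a - 1" \<tau>]] a \<tau>
    by simp
  also have "(\<integral>\<^sup>+t. ennreal (indicator {\<tau>..} t * t powr (a - b - 1)) \<partial>lborel) = ennreal (\<tau> powr (a - b) / (b - a))"
    using nn_integral_has_integral_lebesgue[OF _ has_integral_powr_to_inf[where e = "a - b - 1" and a = \<tau>]] a \<tau>
    by (simp add: field_simps)
  also have "ennreal M * ennreal (\<tau> powr a / a) + ennreal N * ennreal (\<tau> powr (a - b) / (b - a)) =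
      ennreal (M * \<tau> powr a / a + N * \<tau> powr (a - b) / (b - a))"
    using a M N by (simp add: ennreal_mult[symmetric] ennreal_plus[symmetric] del: ennreal_plus)
  finally show ?thesis
    using a(1) by (simp add: lorentz_norm_def ennpowr_1 recip_1)
qed

section \<open>Littlewood--Paley blocks\<close>

lemma littlewood_paley_support:
  assumes "littlewood_paley \<phi>" "\<phi> \<xi> \<noteq> 0"
  shows "3/4 \<le> norm \<xi> \<and> norm \<xi> \<le> 8/3"
proof -
  have "closure {\<xi>. \<phi> \<xi> \<noteq> 0} \<subseteq> {\<xi>. 3/4 \<le> norm \<xi> \<and> norm \<xi> \<le> 8/3}"
    using assms(1) unfolding littlewood_paley_def by (elim conjE)
  then show ?thesis using assms(2) closure_subset[of "{\<xi>. \<phi> \<xi> \<noteq> 0}"] by blast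
qed

lemma littlewood_paley_smooth: "littlewood_paley \<phi> \<Longrightarrow> smooth \<phi>"
  unfolding littlewood_paley_def by (elim conjE)

lemma littlewood_paley_nonneg: "littlewood_paley \<phi> \<Longrightarrow> 0 \<le> \<phi> \<xi>"
  unfolding littlewood_paley_def by (elim conjE allE)

lemma littlewood_paley_has_sum:
  assumes "littlewood_paley \<phi>" "\<xi> \<noteq> 0"
  shows "((\<lambda>j::int. \<phi> (2 powi (-j) *\<^sub>R \<xi>)) has_sum 1) UNIV"
proof -
  have "\<forall>\<xi>. \<xi> \<noteq> 0 \<longrightarrow> ((\<lambda>j::int. \<phi> (2 powi (-j) *\<^sub>R \<xi>)) has_sum 1) UNIV"
    using assms(1) unfolding littlewood_paley_def by (elim conjE)
  then show ?thesis using assms(2) by blast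
qed

lemma littlewood_paley_testfun:
  assumes "littlewood_paley \<phi>"
  shows "(\<lambda>\<xi>. complex_of_real (\<phi> \<xi>)) \<in> testfun"
proof -
  have "complex_of_real (\<phi> \<xi>) = 0" if "8/3 < norm \<xi>" for \<xi>
    using littlewood_paley_support[OF assms, of \<xi>] that by auto
  then show ?thesis
    using smooth_of_real[OF littlewood_paley_smooth[OF assms]] unfolding testfun_def by blast
qed

lemma littlewood_paley_nonzero:
  fixes \<phi> :: "real^'n::finite \<Rightarrow> real"
  assumes "littlewood_paley \<phi>"
  obtains \<xi> where "\<phi> \<xi> \<noteq> 0"
proof (rule ccontr)
  assume "\<not> thesis"
  then have 0: "\<phi> \<xi> = 0" for \<xi> using that by blast
  have "(axis undefined 1 :: real^'n) \<noteq> 0" by (simp add: axis_eq_0_iff)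
  then have "((\<lambda>j::int. \<phi> (2 powi (-j) *\<^sub>R axis undefined 1)) has_sum 1) UNIV"
    by (rule littlewood_paley_has_sum[OF assms])
  then have "((\<lambda>j::int. 0::real) has_sum 1) UNIV" by (simp only: 0)
  then show False
    using has_sum_unique[OF has_sum_0[of UNIV "\<lambda>j::int. 0::real"]] zero_neq_one by blast
qed

text \<open>phi is continuous, nonnegative and not identically zero. A nonzero integral qualifies it
  as the bump in \<open>AE_zero_if_mollifications_zero\<close>.\<close>

lemma littlewood_paley_integral_nonzero:
  fixes \<phi> :: "real^'n::finite \<Rightarrow> real"
  assumes lp: "littlewood_paley \<phi>"
  shows "(LINT x|lborel. complex_of_real (\<phi> x)) \<noteq> 0"
proof
  assume "(LINT x|lborel. complex_of_real (\<phi> x)) = 0"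
  then have zero: "(LINT x|lborel. \<phi> x) = 0" by simp
  have int: "integrable lborel \<phi>"
    using testfun_integrable[OF littlewood_paley_testfun[OF lp]] by (simp add: complex_of_real_integrable_eq)
  have "AE x in lborel. \<phi> x = 0"
    using integral_nonneg_eq_0_iff_AE[OF int] zero littlewood_paley_nonneg[OF lp] by simp
  moreover have "continuous_on UNIV \<phi>"
    by (rule smooth_continuous_on[OF littlewood_paley_smooth[OF lp]])
  ultimately have "\<phi> x = 0" for x using continuous_AE_zero by blast
  then show False using littlewood_paley_nonzero[OF lp] by metis
qed

text \<open>Dilating the annulus by a factor of 4 or more, or by 1/4 or less, moves it off itself: 4
  * 3/4 = 3 exceeds 8/3, and 1/4 * 8/3 = 2/3 is below 3/4. Only j = -1, 0, 1 survive in the dyadic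
  sum.\<close>

lemma littlewood_paley_cutoff:
  fixes \<phi> :: "real^'n::finite \<Rightarrow> real"
  assumes lp: "littlewood_paley \<phi>" and \<xi>: "\<phi> \<xi> \<noteq> 0"
  shows "\<phi> (2 *\<^sub>R \<xi>) + \<phi> \<xi> + \<phi> ((1/2) *\<^sub>R \<xi>) = 1"
proof -
  have n: "3/4 \<le> norm \<xi>" "norm \<xi> \<le> 8/3" using littlewood_paley_support[OF lp \<xi>] by auto
  then have "\<xi> \<noteq> 0" by auto
  then have "((\<lambda>j::int. \<phi> (2 powi (-j) *\<^sub>R \<xi>)) has_sum 1) UNIV"
    by (rule littlewood_paley_has_sum[OF lp])
  moreover have "\<phi> (2 powi (-j) *\<^sub>R \<xi>) = 0" if "j \<notin> {-1, 0, 1}" for j :: int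
  proof (rule ccontr)
    assume "\<phi> (2 powi (-j) *\<^sub>R \<xi>) \<noteq> 0"
    then have m: "3/4 \<le> 2 powi (-j) * norm \<xi>" "2 powi (-j) * norm \<xi> \<le> 8/3"
      using littlewood_paley_support[OF lp] by fastforce+
    from that consider "2 \<le> j" | "j \<le> -2" by force
    then show False
    proof cases
      case 1
      then have "(2::real) powi (-j) \<le> 2 powi (-2)" by (intro power_int_increasing) auto
      then have "2 powi (-j) * norm \<xi> \<le> 1/4 * (8/3)"
        using n by (intro mult_mono) (auto simp: power_int_minus)
      then show False using m by simp
    next
      case 2
      then have "(2::real) powi 2 \<le> 2 powi (-j)" by (intro power_int_increasing) auto
      then have "4 * (3/4) \<le> 2 powi (-j) * norm \<xi>"
        using n by (intro mult_mono) auto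
      then show False using m by simp
    qed
  qed
  ultimately have "((\<lambda>j::int. \<phi> (2 powi (-j) *\<^sub>R \<xi>)) has_sum 1) {-1, 0, 1}"
    by (subst has_sum_cong_neutral[where T = UNIV and g = "\<lambda>j::int. \<phi> (2 powi (-j) *\<^sub>R \<xi>)"]) auto
  then show ?thesis
    by (simp add: has_sum_finite_iff power_int_minus)
qed

text \<open>
  Fourier inversion is only known up to a factor \<open>c\<close>, which is therefore divided out of the kernel.
\<close>

lemma lp_block_kernel:
  fixes \<phi> :: "real^'n::finite \<Rightarrow> real"
  assumes lp: "littlewood_paley \<phi>"
  obtains K k where "K \<in> borel_measurable borel" "\<And>z. cmod (K z) \<le> k"
    "(\<integral>\<^sup>+z. ennreal (cmod (K z)) \<partial>lborel) \<le> ennreal k" "0 \<le> k"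
    "\<And>j u \<psi>. \<psi> \<in> testfun \<Longrightarrow> \<exists>\<psi>'\<in>schwartz. lp_block \<phi> j u \<psi> = lp_block \<phi> j u \<psi>' \<and>
      (\<forall>x. \<psi>' x = of_real ((2 powi j) ^ CARD('n)) * (LINT y|lborel. K (2 powi j *\<^sub>R (x - y)) * \<psi> y))"
proof -
  let ?\<phi> = "\<lambda>\<xi>. complex_of_real (\<phi> \<xi>)"
  have \<phi>: "?\<phi> \<in> testfun" by (rule littlewood_paley_testfun[OF lp])
  obtain \<xi>0 where \<xi>0: "\<phi> \<xi>0 \<noteq> 0" using littlewood_paley_nonzero[OF lp] by blast
  \<comment> \<open>phi vanishes near the origin, so it is recentred at a point where it is nonzero
    and normalised to serve as the damping function in the inversion.\<close>
  have "(\<lambda>\<xi>. inverse (?\<phi> \<xi>0) * ?\<phi> (1 *\<^sub>R \<xi> + \<xi>0)) \<in> testfun"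
    by (rule testfun_cmult[OF testfun_affine_compose[OF \<phi>]]) simp
  moreover have "inverse (?\<phi> \<xi>0) * ?\<phi> (1 *\<^sub>R 0 + \<xi>0) = 1" using \<xi>0 by simp
  ultimately obtain c where c: "c \<noteq> 0" "\<And>f (x::real^'n). f \<in> testfun \<Longrightarrow> inv_fourier (fourier f) x = c * f x"
    using fourier_inversion_up_to_factor by blast
  define X where "X = (\<lambda>\<xi>. inverse c * (?\<phi> (2 *\<^sub>R \<xi>) + ?\<phi> \<xi> + ?\<phi> ((1/2) *\<^sub>R \<xi>)))"
  have X: "X \<in> testfun"
  proof -
    have s: "smooth ?\<phi>" by (rule testfun_smooth[OF \<phi>])
    \<comment> \<open>The widest of the three dilates is supported in the ball of radius
      16/3.\<close>
    have "X \<xi> = 0" if "6 < norm \<xi>" for \<xi>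
      using littlewood_paley_support[OF lp, of "2 *\<^sub>R \<xi>"] littlewood_paley_support[OF lp, of \<xi>]
        littlewood_paley_support[OF lp, of "(1/2) *\<^sub>R \<xi>"] that
      by (fastforce simp: X_def)
    moreover have "smooth X"
      unfolding X_def by (rule smooth_mult[OF smooth_const smooth_add[OF smooth_add]])
        (rule smooth_scaleR_compose[OF s] s)+
    ultimately show ?thesis by (auto simp: testfun_def)
  qed
  define b where "b = complex_of_real ((2 * pi) ^ CARD('n))"
  have b: "b \<noteq> 0" by (simp add: b_def)
  define K where "K = (\<lambda>z. fourier X z / b)"
  have Ki: "integrable lborel K"
    unfolding K_def using fourier_integrable[OF X] by simp
  obtain k0 where k0: "\<And>z. cmod (fourier X z) \<le> k0" using cmod_fourier_le[of X] by blast
  \<comment> \<open>One constant for both the supremum and the L^1 norm, as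
    \<open>weak_type_convolution_bound\<close> expects.\<close>
  define k where "k = max (k0 / cmod b) (LINT z|lborel. cmod (K z))"
  show thesis
  proof (rule that[of K k])
    show "K \<in> borel_measurable borel" using borel_measurable_integrable[OF Ki] by simp
    show "cmod (K z) \<le> k" for z
      using k0[of z] b by (auto simp: K_def k_def norm_divide divide_right_mono le_max_iff_disj)
    have "(\<integral>\<^sup>+z. ennreal (cmod (K z)) \<partial>lborel) = ennreal (LINT z|lborel. cmod (K z))"
      using Ki by (intro nn_integral_eq_integral) auto
    then show "(\<integral>\<^sup>+z. ennreal (cmod (K z)) \<partial>lborel) \<le> ennreal k"
      by (simp add: k_def ennreal_leI)
    show "0 \<le> k" by (simp add: k_def le_max_iff_disj)
    fix j :: int and u :: "'n dist" and \<psi> :: "real^'n \<Rightarrow> complex" assume \<psi>: "\<psi> \<in> testfun"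
    define a where "a = (2::real) powi (-j)"
    have a: "a > 0" by (simp add: a_def)
    define Xj where "Xj = (\<lambda>\<xi>. X (a *\<^sub>R \<xi>))"
    have Xj: "Xj \<in> testfun" using testfun_affine_compose[OF X, of a 0] a by (simp add: Xj_def)
    define \<eta> where "\<eta> = (\<lambda>\<xi>. Xj \<xi> * inv_fourier \<psi> \<xi>)"
    have \<eta>: "\<eta> \<in> testfun" unfolding \<eta>_def by (intro testfun_mult_right Xj smooth_inv_fourier \<psi>)
    have inv: "inv_fourier (fourier \<eta>) \<xi> = c * \<eta> \<xi>" for \<xi> by (rule c(2)[OF \<eta>])
    \<comment> \<open>On the support of the j-th multiplier \<open>c * Xj\<close> equals 1, so the
      factor c of the inversion cancels and \<open>fourier \<eta>\<close> has the same block value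
      as psi.\<close>
    have fix_block: "complex_of_real (\<phi> (a *\<^sub>R \<xi>)) * inv_fourier (fourier \<eta>) \<xi> =
        complex_of_real (\<phi> (a *\<^sub>R \<xi>)) * inv_fourier \<psi> \<xi>" for \<xi>
    proof (cases "\<phi> (a *\<^sub>R \<xi>) = 0")
      case False
      have "c * Xj \<xi> = complex_of_real (\<phi> (2 *\<^sub>R (a *\<^sub>R \<xi>)) + \<phi> (a *\<^sub>R \<xi>) + \<phi> ((1/2) *\<^sub>R (a *\<^sub>R \<xi>)))"
        using c(1) by (simp add: Xj_def X_def)
      also have "\<dots> = 1" by (simp only: littlewood_paley_cutoff[OF lp False] of_real_1)
      finally show ?thesis
        unfolding inv by (simp add: \<eta>_def mult.assoc[symmetric])
    qed simp
    have "fourier \<eta> x = of_real ((2 powi j) ^ CARD('n)) * (LINT y|lborel. K (2 powi j *\<^sub>R (x - y)) * \<psi> y)" for x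
    proof -
      have F: "fourier Xj z = of_real ((2 powi j) ^ CARD('n)) * fourier X (2 powi j *\<^sub>R z)" for z
      proof -
        have "fourier X (z /\<^sub>R a) = \<bar>a\<bar> ^ CARD('n) *\<^sub>R fourier Xj z"
          unfolding Xj_def by (rule fourier_scaleR) (use a testfun_measurable[OF X] in auto)
        moreover have "inverse a = 2 powi j" by (simp add: a_def power_int_minus)
        moreover have "(2 powi j) * a = 1" by (simp add: a_def power_int_minus)
        ultimately show ?thesis
          using a by (simp add: scaleR_conv_of_real mult.assoc[symmetric] flip: power_mult_distrib of_real_mult of_real_power)
      qed
      have "fourier \<eta> x = (LINT y|lborel. fourier Xj (x - y) * \<psi> y) / b"
        unfolding \<eta>_def b_def by (rule fourier_mult_inv_fourier[OF Xj \<psi>])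
      also have "\<dots> = (LINT y|lborel. of_real ((2 powi j) ^ CARD('n)) * (K (2 powi j *\<^sub>R (x - y)) * \<psi> y))"
        unfolding F K_def integral_divide_zero[symmetric] by (simp add: mult_ac)
      finally show ?thesis by (simp only: integral_mult_right_zero)
    qed
    moreover have "lp_block \<phi> j u \<psi> = lp_block \<phi> j u (fourier \<eta>)"
      unfolding lp_block_def inv_fourier_dist_def mult_dist_def a_def[symmetric] by (simp only: fix_block)
    ultimately show "\<exists>\<psi>'\<in>schwartz. lp_block \<phi> j u \<psi> = lp_block \<phi> j u \<psi>' \<and>
      (\<forall>x. \<psi>' x = of_real ((2 powi j) ^ CARD('n)) * (LINT y|lborel. K (2 powi j *\<^sub>R (x - y)) * \<psi> y))"
      using fourier_schwartz[OF \<eta>] by blast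
  qed
qed

section \<open>Functions representing a block\<close>

lemma schwartz_measurable: "\<psi> \<in> schwartz \<Longrightarrow> \<psi> \<in> borel_measurable borel"
  by (simp add: schwartz_def smooth_continuous_on borel_measurable_continuous_onI)

text \<open>\<open>represents\<close> speaks of Lebesgue measurable functions, while the Fubini
  arguments work with Borel functions on \<open>lborel\<close>. Altering real and imaginary parts on
  null sets bridges the two.\<close>

lemma represents_borel:
  fixes g :: "real^'n::finite \<Rightarrow> complex"
  assumes "represents g w"
  obtains g' where "g' \<in> borel_measurable borel" "AE x in lborel. g x = g' x"
    "\<And>\<psi>. \<psi> \<in> schwartz \<Longrightarrow> integrable lborel (\<lambda>x. g' x * \<psi> x)"
    "\<And>\<psi>. \<psi> \<in> schwartz \<Longrightarrow> w \<psi> = (LINT x|lborel. g' x * \<psi> x)"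
proof -
  have g: "g \<in> borel_measurable (completion lborel)" using assms by (simp add: represents_def)
  have "(\<lambda>x. Re (g x)) \<in> borel_measurable (completion lborel)" "(\<lambda>x. Im (g x)) \<in> borel_measurable (completion lborel)"
    using measurable_compose[OF g borel_measurable_Re] measurable_compose[OF g borel_measurable_Im] by auto
  from this[THEN completion_ex_borel_measurable_real] obtain gr gi
    where [measurable]: "gr \<in> borel_measurable lborel" "gi \<in> borel_measurable lborel"
      and ae: "AE x in lborel. Re (g x) = gr x" "AE x in lborel. Im (g x) = gi x"
    by blast
  define g' where "g' = (\<lambda>x. Complex (gr x) (gi x))"
  have meas [measurable]: "g' \<in> borel_measurable borel"
    unfolding g'_def Complex_eq by measurable
  have eq: "AE x in lborel. g x = g' x"
    using ae by eventually_elim (simp add: g'_def complex_eq_iff)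
  have eq': "AE x in lebesgue. g x = g' x"
    using eq by (rule AE_completion)
  have *: "integrable lborel (\<lambda>x. g' x * \<psi> x) \<and> w \<psi> = (LINT x|lborel. g' x * \<psi> x)"
    if \<psi>: "\<psi> \<in> schwartz" for \<psi>
  proof -
    have [measurable]: "\<psi> \<in> borel_measurable borel" by (rule schwartz_measurable[OF \<psi>])
    have i: "integrable lebesgue (\<lambda>x. g x * \<psi> x)" and w: "w \<psi> = (LINT x|lebesgue. g x * \<psi> x)"
      using assms \<psi> by (auto simp: represents_def)
    have m: "(\<lambda>x. g' x * \<psi> x) \<in> borel_measurable lborel" by measurable
    then have m': "(\<lambda>x. g' x * \<psi> x) \<in> borel_measurable lebesgue" by (rule measurable_completion)
    have e: "AE x in lebesgue. g x * \<psi> x = g' x * \<psi> x" using eq' by eventually_elim simp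
    have "integrable lebesgue (\<lambda>x. g' x * \<psi> x)"
      by (rule integrable_cong_AE_imp[OF i m' e])
    moreover have "w \<psi> = (LINT x|lebesgue. g' x * \<psi> x)"
      unfolding w by (rule integral_cong_AE[OF borel_measurable_integrable[OF i] m' e])
    ultimately show ?thesis
      using integrable_completion[OF m] integral_completion[OF m] by simp
  qed
  show thesis by (rule that[OF meas eq]) (use * in auto)
qed

lemma rearrangement_cong_AE:
  fixes f g :: "'a::euclidean_space \<Rightarrow> complex"
  assumes "AE x in lborel. f x = g x" "f \<in> borel_measurable lebesgue" "g \<in> borel_measurable lebesgue"
  shows "decreasing_rearrangement f = decreasing_rearrangement g"
proof -
  have "distribution_function f \<alpha> = distribution_function g \<alpha>" for \<alpha>
    unfolding distribution_function_def
    by (rule emeasure_eq_AE)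
       (use AE_completion[OF assms(1)] superlevel_set_lebesgue assms(2,3) in \<open>auto elim!: eventually_mono\<close>)
  then show ?thesis by (simp add: decreasing_rearrangement_def fun_eq_iff)
qed

text \<open>By continuity phi is bounded below by some delta > 0 on a small ball. A translate and
  dilate psi of phi is then bounded below on \<open>cball 0 R\<close>, where |g| is at most |g psi|
  / delta.\<close>

lemma locally_integrable_if_testfun_mult:
  fixes g :: "real^'n::finite \<Rightarrow> complex"
  assumes lp: "littlewood_paley (\<phi> :: real^'n \<Rightarrow> real)" and [measurable]: "g \<in> borel_measurable borel"
    and int: "\<And>\<psi>. \<psi> \<in> testfun \<Longrightarrow> integrable lborel (\<lambda>x. g x * \<psi> x)"
  shows "integrable lborel (\<lambda>x. indicator (cball 0 R) x *\<^sub>R g x)"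
proof -
  let ?\<phi> = "\<lambda>\<xi>. complex_of_real (\<phi> \<xi>)"
  have \<phi>: "?\<phi> \<in> testfun" by (rule littlewood_paley_testfun[OF lp])
  obtain \<xi>0 where \<xi>0: "\<phi> \<xi>0 \<noteq> 0" using littlewood_paley_nonzero[OF lp] by blast
  have "open {\<xi>. \<phi> \<xi> \<noteq> 0}"
    by (intro open_Collect_neq smooth_continuous_on littlewood_paley_smooth lp continuous_on_const)
  then obtain d where d: "d > 0" "cball \<xi>0 d \<subseteq> {\<xi>. \<phi> \<xi> \<noteq> 0}"
    using \<xi>0 open_contains_cball by blast
  have "continuous_on (cball \<xi>0 d) (\<lambda>\<xi>. cmod (?\<phi> \<xi>))"
    by (intro continuous_on_norm testfun_continuous \<phi>)
  then obtain \<xi>1 where \<xi>1: "\<xi>1 \<in> cball \<xi>0 d" "\<And>\<xi>. \<xi> \<in> cball \<xi>0 d \<Longrightarrow> cmod (?\<phi> \<xi>1) \<le> cmod (?\<phi> \<xi>)"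
    using continuous_attains_inf[OF compact_cball, of \<xi>0 d] d(1) by (metis cball_eq_empty less_le_not_le linorder_not_le)
  define \<delta> where "\<delta> = cmod (?\<phi> \<xi>1)"
  have \<delta>: "\<delta> > 0" using d(2) \<xi>1(1) by (auto simp: \<delta>_def)
  \<comment> \<open>Maps the ball of radius R into the ball of radius d on which phi is nonzero; the
    maximum keeps the quotient meaningful for every real R.\<close>
  define r where "r = d / max R 1"
  have r: "r > 0" using d(1) by (simp add: r_def)
  define \<psi> where "\<psi> = (\<lambda>x. ?\<phi> (r *\<^sub>R x + \<xi>0))"
  have \<psi>: "\<psi> \<in> testfun" unfolding \<psi>_def using testfun_affine_compose[OF \<phi>] r by simp
  have lower: "\<delta> \<le> cmod (\<psi> x)" if "norm x \<le> R" for x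
  proof -
    have "norm (r *\<^sub>R x) \<le> r * max R 1" using that r by (simp add: le_max_iff_disj)
    also have "\<dots> = d" by (simp add: r_def)
    finally have "r *\<^sub>R x + \<xi>0 \<in> cball \<xi>0 d" by (simp add: dist_norm)
    then show ?thesis using \<xi>1(2) by (simp add: \<psi>_def \<delta>_def)
  qed
  show ?thesis
  proof (rule Bochner_Integration.integrable_bound)
    show "integrable lborel (\<lambda>x. complex_of_real (inverse \<delta>) * (g x * \<psi> x))"
      by (intro integrable_mult_right int \<psi>)
    show "(\<lambda>x. indicator (cball 0 R) x *\<^sub>R g x) \<in> borel_measurable lborel"
      by (intro borel_measurable_scaleR borel_measurable_indicator) auto
    show "AE x in lborel. cmod (indicator (cball 0 R) x *\<^sub>R g x) \<le> cmod (complex_of_real (inverse \<delta>) * (g x * \<psi> x))"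
    proof (rule AE_I2)
      fix x :: "real^'n"
      show "cmod (indicator (cball 0 R) x *\<^sub>R g x) \<le> cmod (complex_of_real (inverse \<delta>) * (g x * \<psi> x))"
      proof (cases "norm x \<le> R")
        case True
        then have "cmod (g x) * \<delta> \<le> cmod (g x) * cmod (\<psi> x)" by (intro mult_left_mono lower) auto
        then show ?thesis using True \<delta> by (simp add: norm_mult norm_divide norm_inverse field_simps)
      qed simp
    qed
  qed
qed

text \<open>Translates and dilates of phi are test functions, so the difference of g and h has
  vanishing mollifications. This identifies g with its smoothed version, and also any two functions
  that represent the same block.\<close>

lemma AE_eq_if_testfun_integrals_eq:
  fixes g h :: "real^'n::finite \<Rightarrow> complex"
  assumes lp: "littlewood_paley (\<phi> :: real^'n \<Rightarrow> real)"
    and [measurable]: "g \<in> borel_measurable borel" "h \<in> borel_measurable borel"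
    and g: "\<And>\<psi>. \<psi> \<in> testfun \<Longrightarrow> integrable lborel (\<lambda>x. g x * \<psi> x)"
    and h: "\<And>\<psi>. \<psi> \<in> testfun \<Longrightarrow> integrable lborel (\<lambda>x. h x * \<psi> x)"
    and eq: "\<And>\<psi>. \<psi> \<in> testfun \<Longrightarrow> (LINT x|lborel. g x * \<psi> x) = (LINT x|lborel. h x * \<psi> x)"
  shows "AE x in lborel. g x = h x"
proof -
  have "AE x in lborel. g x - h x = 0"
  proof (rule AE_zero_if_mollifications_zero[OF _ _ littlewood_paley_testfun[OF lp] littlewood_paley_integral_nonzero[OF lp]])
    show "(\<lambda>x. g x - h x) \<in> borel_measurable borel" by measurable
    show "integrable lborel (\<lambda>x. indicator (cball 0 R) x *\<^sub>R (g x - h x))" for R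
      unfolding scaleR_diff_right
      by (intro Bochner_Integration.integrable_diff locally_integrable_if_testfun_mult[OF lp] g h) auto
    fix e :: real and y :: "real^'n" assume e: "e > 0"
    have "(\<lambda>x. complex_of_real (\<phi> (inverse e *\<^sub>R x + - (inverse e *\<^sub>R y)))) \<in> testfun"
      using e by (intro testfun_affine_compose[OF littlewood_paley_testfun[OF lp]]) auto
    then have \<psi>: "(\<lambda>x. complex_of_real (\<phi> ((x - y) /\<^sub>R e))) \<in> testfun"
      by (simp add: scaleR_diff_right)
    show "(LINT x|lborel. (g x - h x) * complex_of_real (\<phi> ((x - y) /\<^sub>R e))) = 0"
      unfolding left_diff_distrib by (subst Bochner_Integration.integral_diff[OF g[OF \<psi>] h[OF \<psi>]]) (simp add: eq[OF \<psi>])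
  qed
  then show ?thesis by simp
qed

section \<open>The reproducing identity and the Bernstein inequality\<close>

lemma integrable_bounded_mult:
  fixes f g :: "'a \<Rightarrow> complex"
  assumes g: "integrable M g" and f: "f \<in> borel_measurable M" "\<And>x. cmod (f x) \<le> B"
  shows "integrable M (\<lambda>x. f x * g x)"
proof (rule Bochner_Integration.integrable_bound)
  show "integrable M (\<lambda>x. complex_of_real B * g x)" using g by (rule integrable_mult_right)
  show "(\<lambda>x. f x * g x) \<in> borel_measurable M"
    by (intro borel_measurable_times f borel_measurable_integrable g)
  have "cmod (f x) \<le> \<bar>B\<bar>" for x using f(2)[of x] by linarith
  then show "AE x in M. cmod (f x * g x) \<le> cmod (complex_of_real B * g x)"
    by (intro AE_I2) (simp add: norm_mult mult_right_mono)
qed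

text \<open>The block does not distinguish psi from its smoothed version, so g and its convolution G
  have the same integrals against all test functions and agree almost everywhere. The bound is the
  one that the weak estimate gives for G.\<close>

lemma lp_block_AE_bound:
  fixes \<phi> :: "real^'n::finite \<Rightarrow> real"
  assumes lp: "littlewood_paley \<phi>"
  obtains k where "0 \<le> k"
    "\<And>j u g N b. g \<in> borel_measurable borel \<Longrightarrow>
      (\<And>\<psi>. \<psi> \<in> schwartz \<Longrightarrow> integrable lborel (\<lambda>x. g x * \<psi> x)) \<Longrightarrow>
      (\<And>\<psi>. \<psi> \<in> schwartz \<Longrightarrow> lp_block \<phi> j u \<psi> = (LINT x|lborel. g x * \<psi> x)) \<Longrightarrow>
      (\<And>t. t > 0 \<Longrightarrow> decreasing_rearrangement g t \<le> ennreal (N * t powr (- b))) \<Longrightarrow>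
      N > 0 \<Longrightarrow> 0 < b \<Longrightarrow> b < 1 \<Longrightarrow>
      AE x in lborel. cmod (g x) \<le> k * (1 + weak_const b) * N * (2 powi j) powr (real CARD('n) * b)"
proof -
  obtain K k where K [measurable]: "K \<in> borel_measurable borel" and Kk: "\<And>z. cmod (K z) \<le> k"
    "(\<integral>\<^sup>+z. ennreal (cmod (K z)) \<partial>lborel) \<le> ennreal k" "0 \<le> k"
    and repr: "\<And>j u \<psi>. \<psi> \<in> testfun \<Longrightarrow> \<exists>\<psi>'\<in>schwartz. lp_block \<phi> j u \<psi> = lp_block \<phi> j u \<psi>' \<and>
      (\<forall>x. \<psi>' x = of_real ((2 powi j) ^ CARD('n)) * (LINT y|lborel. K (2 powi j *\<^sub>R (x - y)) * \<psi> y))"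
    using lp_block_kernel[OF lp] by blast
  show thesis
  proof (rule that[OF Kk(3)])
    fix j :: int and u :: "'n dist" and g :: "real^'n \<Rightarrow> complex" and N b :: real
    assume g_meas [measurable]: "g \<in> borel_measurable borel"
      and int: "\<And>\<psi>. \<psi> \<in> schwartz \<Longrightarrow> integrable lborel (\<lambda>x. g x * \<psi> x)"
      and block: "\<And>\<psi>. \<psi> \<in> schwartz \<Longrightarrow> lp_block \<phi> j u \<psi> = (LINT x|lborel. g x * \<psi> x)"
      and weak: "\<And>t. t > 0 \<Longrightarrow> decreasing_rearrangement g t \<le> ennreal (N * t powr (- b))"
      and N: "N > 0" and b: "0 < b" "b < 1"
    define l where "l = (2::real) powi j"
    have l: "l > 0" by (simp add: l_def)
    define H where "H = k * (1 + weak_const b) * N * l powr (real CARD('n) * (b - 1))"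
    have H: "H \<ge> 0" using Kk(3) N weak_const_nonneg[OF b] by (simp add: H_def)
    have conv: "(\<integral>\<^sup>+x. ennreal (cmod (K (l *\<^sub>R (x - y)) * g x)) \<partial>lborel) \<le> ennreal H" for y
      using weak_type_convolution_bound[OF g_meas K weak N b l Kk] by (simp add: H_def)
    have conv_int: "integrable lborel (\<lambda>x. K (l *\<^sub>R (x - y)) * g x)" for y
    proof (rule integrableI_bounded)
      show "(\<integral>\<^sup>+x. ennreal (cmod (K (l *\<^sub>R (x - y)) * g x)) \<partial>lborel) < \<infinity>"
        using conv[of y] by (auto simp: less_top[symmetric] top_unique)
    qed measurable
    have conv_le: "(LINT x|lborel. cmod (K (l *\<^sub>R (x - y)) * g x)) \<le> H" for y
      using nn_integral_eq_integral[OF integrable_norm[OF conv_int[of y]]] conv[of y] H by simp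
    \<comment> \<open>The adjoint of the smoothing that \<open>repr\<close> applies to psi, which is
      why x is integrated and the kernel appears reflected.\<close>
    define G where "G = (\<lambda>y. of_real (l ^ CARD('n)) * (LINT x|lborel. K (l *\<^sub>R (x - y)) * g x))"
    have G_meas: "G \<in> borel_measurable borel"
      unfolding G_def by measurable
    have G_le: "cmod (G y) \<le> l ^ CARD('n) * H" for y
    proof -
      have "cmod (LINT x|lborel. K (l *\<^sub>R (x - y)) * g x) \<le> H"
        using integral_norm_bound[of lborel "\<lambda>x. K (l *\<^sub>R (x - y)) * g x"] conv_le[of y] by linarith
      then show ?thesis using l by (simp add: G_def norm_mult norm_power mult_left_mono)
    qed
    have swap: "(LINT x|lborel. g x * \<psi> x) = (LINT x|lborel. G x * \<psi> x)" if \<psi>: "\<psi> \<in> testfun" for \<psi>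
    proof -
      have [measurable]: "\<psi> \<in> borel_measurable borel" by (rule testfun_measurable[OF \<psi>])
      obtain \<psi>' where \<psi>': "\<psi>' \<in> schwartz" "lp_block \<phi> j u \<psi> = lp_block \<phi> j u \<psi>'"
        "\<And>x. \<psi>' x = of_real (l ^ CARD('n)) * (LINT y|lborel. K (l *\<^sub>R (x - y)) * \<psi> y)"
        using repr[OF \<psi>, of j u] unfolding l_def by blast
      \<comment> \<open>As g need not be integrable, the absolute integrability for Fubini comes
        from the bound H, uniform in y, together with the integrability of psi.\<close>
      have pair: "integrable (lborel \<Otimes>\<^sub>M lborel) (\<lambda>(y, x). K (l *\<^sub>R (x - y)) * g x * \<psi> y)"
      proof (rule lborel_pair.Fubini_integrable)
        show "(\<lambda>(y, x). K (l *\<^sub>R (x - y)) * g x * \<psi> y) \<in> borel_measurable (lborel \<Otimes>\<^sub>M lborel)"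
          by measurable
        have eq: "(LINT x|lborel. cmod (K (l *\<^sub>R (x - y)) * g x * \<psi> y)) =
            (LINT x|lborel. cmod (K (l *\<^sub>R (x - y)) * g x)) * cmod (\<psi> y)" for y
          by (simp add: norm_mult)
        have "integrable lborel (\<lambda>y. (LINT x|lborel. cmod (K (l *\<^sub>R (x - y)) * g x)) * cmod (\<psi> y))"
        proof (rule Bochner_Integration.integrable_bound)
          show "integrable lborel (\<lambda>y. H * cmod (\<psi> y))"
            using testfun_integrable[OF \<psi>] by simp
          show "(\<lambda>y. (LINT x|lborel. cmod (K (l *\<^sub>R (x - y)) * g x)) * cmod (\<psi> y)) \<in> borel_measurable lborel"
            by measurable
          show "AE y in lborel. norm ((LINT x|lborel. cmod (K (l *\<^sub>R (x - y)) * g x)) * cmod (\<psi> y)) \<le> norm (H * cmod (\<psi> y))"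
          proof (rule AE_I2)
            fix y
            have gen: "norm (I * c) \<le> norm (H * c)" if "0 \<le> I" "I \<le> H" "0 \<le> c" for I c :: real
              using that by (simp add: abs_mult mult_right_mono)
            show "norm ((LINT x|lborel. cmod (K (l *\<^sub>R (x - y)) * g x)) * cmod (\<psi> y)) \<le> norm (H * cmod (\<psi> y))"
              by (rule gen[OF _ conv_le]) simp_all
          qed
        qed
        then show "integrable lborel (\<lambda>y. LINT x|lborel. cmod (case (y, x) of (y, x) \<Rightarrow> K (l *\<^sub>R (x - y)) * g x * \<psi> y))"
          by (simp only: prod.case eq)
        show "AE y in lborel. integrable lborel (\<lambda>x. case (y, x) of (y, x) \<Rightarrow> K (l *\<^sub>R (x - y)) * g x * \<psi> y)"
          using conv_int by simp
      qed
      have "(LINT x|lborel. g x * \<psi> x) = (LINT x|lborel. g x * \<psi>' x)"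
        using block[OF testfun_schwartz[OF \<psi>]] block[OF \<psi>'(1)] \<psi>'(2) by simp
      also have "\<dots> = (LINT x|lborel. of_real (l ^ CARD('n)) * (LINT y|lborel. K (l *\<^sub>R (x - y)) * g x * \<psi> y))"
        unfolding \<psi>'(3) by (simp add: mult_ac flip: integral_mult_right_zero)
      also have "\<dots> = of_real (l ^ CARD('n)) * (LINT x|lborel. LINT y|lborel. K (l *\<^sub>R (x - y)) * g x * \<psi> y)"
        by (rule integral_mult_right_zero)
      also have "(LINT x|lborel. LINT y|lborel. K (l *\<^sub>R (x - y)) * g x * \<psi> y) =
          (LINT y|lborel. LINT x|lborel. K (l *\<^sub>R (x - y)) * g x * \<psi> y)"
        by (rule lborel_pair.Fubini_integral[OF pair])
      also have "of_real (l ^ CARD('n)) * \<dots> = (LINT y|lborel. G y * \<psi> y)"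
      proof -
        have "G y * \<psi> y = of_real (l ^ CARD('n)) * (LINT x|lborel. K (l *\<^sub>R (x - y)) * g x * \<psi> y)" for y
          unfolding G_def integral_mult_left_zero by (rule mult.assoc)
        then show ?thesis by (simp only: integral_mult_right_zero)
      qed
      finally show ?thesis .
    qed
    have "AE x in lborel. g x = G x"
    proof (rule AE_eq_if_testfun_integrals_eq[OF lp g_meas G_meas _ _ swap])
      show "integrable lborel (\<lambda>x. g x * \<psi> x)" if "\<psi> \<in> testfun" for \<psi>
        by (rule int[OF testfun_schwartz[OF that]])
      show "integrable lborel (\<lambda>x. G x * \<psi> x)" if "\<psi> \<in> testfun" for \<psi>
        by (rule integrable_bounded_mult[OF testfun_integrable[OF that] _ G_le]) (use G_meas in simp)
    qed
    moreover have "l ^ CARD('n) * H = k * (1 + weak_const b) * N * l powr (real CARD('n) * b)"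
    proof -
      have "l ^ CARD('n) * l powr (real CARD('n) * (b - 1)) = l powr (real CARD('n) * b)"
        using l by (simp add: powr_realpow[symmetric] powr_add[symmetric] algebra_simps)
      then show ?thesis by (simp add: H_def mult_ac)
    qed
    ultimately show "AE x in lborel. cmod (g x) \<le> k * (1 + weak_const b) * N * (2 powi j) powr (real CARD('n) * b)"
      using G_le unfolding l_def by (auto elim!: eventually_mono)
  qed
qed

text \<open>Interpolation first merges both hypotheses into a single weak bound of exponent b; the
  height bound and \<open>lorentz_norm_1_le\<close> then raise it to second index 1, since
  \<open>recip p\<close> is below b. The strict inequalities for A and B supply representatives with
  norms below them.\<close>

lemma lp_block_interpolation:
  fixes \<phi> :: "real^'n::finite \<Rightarrow> real" and p q r :: ennreal and \<eta> :: real
  defines "b \<equiv> \<eta> * recip q + (1 - \<eta>) * recip r"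
  assumes lp: "littlewood_paley \<phi>" and p: "0 < recip p" "recip p < b" and b: "b < 1"
    and \<eta>: "0 \<le> \<eta>" "\<eta> \<le> 1"
  shows "\<exists>C>0. \<forall>j u A B. A > 0 \<longrightarrow> B > 0 \<longrightarrow>
    lorentz_norm_dist q \<infinity> (lp_block \<phi> j u) < ennreal A \<longrightarrow>
    lorentz_norm_dist r \<infinity> (lp_block \<phi> j u) < ennreal B \<longrightarrow>
    lorentz_norm_dist p 1 (lp_block \<phi> j u) \<le>
      ennreal (C * (A powr \<eta> * B powr (1 - \<eta>)) * (2 powi j) powr (real CARD('n) * (b - recip p)))"
proof -
  obtain k where k: "0 \<le> k"
    "\<And>j u g N b. g \<in> borel_measurable borel \<Longrightarrow>
      (\<And>\<psi>. \<psi> \<in> schwartz \<Longrightarrow> integrable lborel (\<lambda>x. g x * \<psi> x)) \<Longrightarrow>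
      (\<And>\<psi>. \<psi> \<in> schwartz \<Longrightarrow> lp_block \<phi> j u \<psi> = (LINT x|lborel. g x * \<psi> x)) \<Longrightarrow>
      (\<And>t. t > 0 \<Longrightarrow> decreasing_rearrangement g t \<le> ennreal (N * t powr (- b))) \<Longrightarrow>
      N > 0 \<Longrightarrow> 0 < b \<Longrightarrow> b < 1 \<Longrightarrow>
      AE x in lborel. cmod (g x) \<le> k * (1 + weak_const b) * N * (2 powi j) powr (real CARD('n) * b)"
    using lp_block_AE_bound[OF lp] by blast
  have b0: "0 < b" using p by linarith
  define a where "a = recip p"
  \<comment> \<open>k may be 0; k + 1 keeps D, and with it the height M below, strictly
    positive.\<close>
  define D where "D = (k + 1) * (1 + weak_const b)"
  have D: "D > 0" using k(1) weak_const_nonneg[OF b0 b] by (simp add: D_def add_pos_nonneg)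
  define C where "C = D / a + 1 / (b - a)"
  have C: "C > 0" using D p by (simp add: C_def a_def add_pos_pos)
  show ?thesis
  proof (intro exI[of _ C] conjI allI impI C)
    fix j :: int and u :: "'n dist" and A B :: real
    assume A: "A > 0" and B: "B > 0"
    assume "lorentz_norm_dist q \<infinity> (lp_block \<phi> j u) < ennreal A"
    then obtain g where g: "represents g (lp_block \<phi> j u)" "lorentz_norm q \<infinity> g < ennreal A"
      unfolding lorentz_norm_dist_def Inf_less_iff by blast
    assume "lorentz_norm_dist r \<infinity> (lp_block \<phi> j u) < ennreal B"
    then obtain h where h: "represents h (lp_block \<phi> j u)" "lorentz_norm r \<infinity> h < ennreal B"
      unfolding lorentz_norm_dist_def Inf_less_iff by blast
    obtain g' where g': "g' \<in> borel_measurable borel" "AE x in lborel. g x = g' x"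
      "\<And>\<psi>. \<psi> \<in> schwartz \<Longrightarrow> integrable lborel (\<lambda>x. g' x * \<psi> x)"
      "\<And>\<psi>. \<psi> \<in> schwartz \<Longrightarrow> lp_block \<phi> j u \<psi> = (LINT x|lborel. g' x * \<psi> x)"
      by (rule represents_borel[OF g(1)], rule that)
    obtain h' where h': "h' \<in> borel_measurable borel" "AE x in lborel. h x = h' x"
      "\<And>\<psi>. \<psi> \<in> schwartz \<Longrightarrow> integrable lborel (\<lambda>x. h' x * \<psi> x)"
      "\<And>\<psi>. \<psi> \<in> schwartz \<Longrightarrow> lp_block \<phi> j u \<psi> = (LINT x|lborel. h' x * \<psi> x)"
      by (rule represents_borel[OF h(1)], rule that)
    \<comment> \<open>The infima for q and r may be approached by different representatives. They
      agree almost everywhere, so the weak bound of h carries over to g.\<close>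
    have "AE x in lborel. g' x = h' x"
    proof (rule AE_eq_if_testfun_integrals_eq[OF lp g'(1) h'(1)])
      fix \<psi> :: "real^'n \<Rightarrow> complex" assume "\<psi> \<in> testfun"
      then have \<psi>: "\<psi> \<in> schwartz" by (rule testfun_schwartz)
      show "integrable lborel (\<lambda>x. g' x * \<psi> x)" "integrable lborel (\<lambda>x. h' x * \<psi> x)"
        by (rule g'(3)[OF \<psi>], rule h'(3)[OF \<psi>])
      show "(LINT x|lborel. g' x * \<psi> x) = (LINT x|lborel. h' x * \<psi> x)"
        using g'(4)[OF \<psi>] h'(4)[OF \<psi>] by (simp only:)
    qed
    with g'(2) h'(2) have gh: "AE x in lborel. h x = g x"
      by eventually_elim simp
    have gm: "g \<in> borel_measurable lebesgue" and hm: "h \<in> borel_measurable lebesgue"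
      using g(1) h(1) by (auto simp: represents_def)
    have g'm: "g' \<in> borel_measurable lebesgue"
      using g'(1) by (simp add: measurable_completion)
    define N where "N = A powr \<eta> * B powr (1 - \<eta>)"
    have N: "N > 0" using A B by (simp add: N_def)
    have weak: "decreasing_rearrangement g t \<le> ennreal (N * t powr (- b))" if t: "t > 0" for t
    proof -
      have "decreasing_rearrangement g t \<le> ennreal (A * t powr (- recip q))"
        using g(2) A t by (intro rearrangement_le_if_lorentz_norm_le) auto
      moreover have "decreasing_rearrangement h t \<le> ennreal (B * t powr (- recip r))"
        using h(2) B t by (intro rearrangement_le_if_lorentz_norm_le) auto
      then have "decreasing_rearrangement g t \<le> ennreal (B * t powr (- recip r))"
        using rearrangement_cong_AE[OF gh hm gm] by simp
      ultimately show ?thesis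
        unfolding N_def b_def using A B t \<eta> by (intro rearrangement_interpolation) auto
    qed
    define l where "l = (2::real) powi j"
    have l: "l > 0" by (simp add: l_def)
    define M where "M = D * N * l powr (real CARD('n) * b)"
    have M: "M > 0" using D N l by (simp add: M_def)
    have "AE x in lborel. cmod (g' x) \<le> k * (1 + weak_const b) * N * l powr (real CARD('n) * b)"
      unfolding l_def
      by (rule k(2)[OF g'(1) g'(3,4) _ N b0 b])
         (use weak rearrangement_cong_AE[OF g'(2) gm g'm] in auto)
    moreover have "k * (1 + weak_const b) * N * l powr (real CARD('n) * b) \<le> M"
      unfolding M_def D_def using weak_const_nonneg[OF b0 b] N l
      by (intro mult_right_mono) auto
    ultimately have "AE x in lborel. cmod (g x) \<le> M"
      using g'(2) by (auto elim!: eventually_elim2)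
    then have "AE x in lebesgue. cmod (g x) \<le> M" by (rule AE_completion)
    then have bdd: "decreasing_rearrangement g t \<le> ennreal M" for t
      using rearrangement_le_if_AE_le[OF _ M gm] by blast
    have "lorentz_norm_dist p 1 (lp_block \<phi> j u) \<le> lorentz_norm p 1 g"
      unfolding lorentz_norm_dist_def using g(1) by (intro Inf_lower) blast
    \<comment> \<open>The split point l^(-n) is where M and N t^(-b) agree up to the factor D. Both
      terms then carry the same power of l, and their coefficients add up to C.\<close>
    also have "\<dots> \<le> ennreal (M * (l powr (- real CARD('n))) powr a / a + N * (l powr (- real CARD('n))) powr (a - b) / (b - a))"
      by (rule lorentz_norm_1_le) (use p M N l bdd weak in \<open>auto simp: a_def\<close>)
    also have "M * (l powr (- real CARD('n))) powr a / a + N * (l powr (- real CARD('n))) powr (a - b) / (b - a) =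
        C * N * l powr (real CARD('n) * (b - a))"
    proof -
      have "l powr (real CARD('n) * b) * (l powr (- real CARD('n))) powr a = l powr (real CARD('n) * (b - a))"
        by (simp add: powr_powr powr_add[symmetric] algebra_simps)
      moreover have "(l powr (- real CARD('n))) powr (a - b) = l powr (real CARD('n) * (b - a))"
        by (simp add: powr_powr algebra_simps)
      ultimately show ?thesis
        by (simp add: M_def C_def distrib_right mult.assoc)
    qed
    finally show "lorentz_norm_dist p 1 (lp_block \<phi> j u) \<le>
      ennreal (C * (A powr \<eta> * B powr (1 - \<eta>)) * (2 powi j) powr (real CARD('n) * (b - recip p)))"
      by (simp add: N_def l_def a_def)
  qed
qed

section \<open>Summation over the frequencies\<close>

lemma lr_norm_1: "lr_norm 1 a = (\<Sum>\<^sub>\<infinity>j. a j)"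
  by (simp add: lr_norm_def ennpowr_1 recip_1)

lemma recip_less_1:
  assumes "1 < q"
  shows "0 \<le> recip q" "recip q < 1"
proof -
  show "0 \<le> recip q" by (simp add: recip_def)
  show "recip q < 1"
  proof (cases q)
    case (real x)
    then have "1 < x" using assms by simp
    then show ?thesis using real by (simp add: recip_def ennreal_1[symmetric] divide_ennreal del: ennreal_1)
  qed (simp add: recip_def)
qed

lemma recip_pos:
  assumes "0 < p" "p < \<infinity>"
  shows "0 < recip p"
proof (cases p)
  case (real x)
  then have "0 < x" using assms by simp
  then show ?thesis using real by (simp add: recip_def ennreal_1[symmetric] divide_ennreal del: ennreal_1)
qed (use assms in auto)

lemma summable_on_two_powr_abs_int:
  assumes "\<delta> > 0"
  shows "(\<lambda>j::int. 2 powr (- (\<delta> * \<bar>real_of_int j\<bar>))) summable_on UNIV"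
proof -
  let ?f = "\<lambda>j::int. 2 powr (- (\<delta> * \<bar>real_of_int j\<bar>))"
  have r: "0 < 2 powr (- \<delta>)" "2 powr (- \<delta>) < 1"
    using powr_less_mono[of "- \<delta>" 0 2] assms by auto
  have eq: "2 powr (- (\<delta> * real n)) = (2 powr (- \<delta>)) ^ n" for n
    by (simp add: powr_realpow[symmetric] powr_powr)
  have geo: "(\<lambda>n::nat. 2 powr (- (\<delta> * real n))) summable_on UNIV"
    unfolding eq by (rule norm_summable_imp_summable_on) (use r in \<open>simp add: summable_geometric\<close>)
  have "?f summable_on range int"
    using geo by (subst summable_on_reindex) (auto simp: o_def)
  moreover have "?f summable_on range (\<lambda>n. - int n)"
    using geo by (subst summable_on_reindex) (auto simp: o_def inj_on_def)
  ultimately have "?f summable_on (range int \<union> range (\<lambda>n. - int n))"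
    by (rule summable_on_union)
  moreover have "range int \<union> range (\<lambda>n. - int n) = UNIV"
  proof (intro equalityI subsetI)
    fix j :: int
    show "j \<in> range int \<union> range (\<lambda>n. - int n)" by (cases j rule: int_cases2) auto
  qed simp
  ultimately show ?thesis by simp
qed

text \<open>
  The two geometric sequences cross at \<open>j = - x / \<delta>\<close>; shifting by the integer part of this bounds
  the sum of the minimum independently of \<open>x\<close>.
\<close>

lemma sum_min_geometric_le:
  assumes \<delta>: "\<delta> \<noteq> 0"
  obtains S where "S > 0" "\<And>x F. finite F \<Longrightarrow>
    (\<Sum>j\<in>F. min (2 powr (\<delta> * real_of_int j + x)) (2 powr (- (\<delta> * real_of_int j + x)))) \<le> S"
proof -
  let ?f = "\<lambda>j::int. 2 powr (- (\<bar>\<delta>\<bar> * \<bar>real_of_int j\<bar>))"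
  have sm: "?f summable_on UNIV" using \<delta> by (intro summable_on_two_powr_abs_int) simp
  have bound: "(\<Sum>j\<in>F. min (2 powr (\<delta> * real_of_int j + x)) (2 powr (- (\<delta> * real_of_int j + x)))) \<le> 2 powr \<bar>\<delta>\<bar> * infsum ?f UNIV"
    if F: "finite F" for x and F :: "int set"
  proof -
    \<comment> \<open>Replacing x / delta by its floor changes distances by at most 1, which costs
      the factor 2 powr |delta|.\<close>
    define m where "m = \<lfloor>x / \<delta>\<rfloor>"
    have "min (2 powr (\<delta> * real_of_int j + x)) (2 powr (- (\<delta> * real_of_int j + x))) \<le> 2 powr \<bar>\<delta>\<bar> * ?f (j + m)" for j
    proof -
      have "\<bar>\<delta> * real_of_int j + x\<bar> = \<bar>\<delta>\<bar> * \<bar>real_of_int j + x / \<delta>\<bar>"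
        using \<delta> by (simp add: abs_mult[symmetric] algebra_simps)
      moreover have "\<bar>real_of_int (j + m)\<bar> - 1 \<le> \<bar>real_of_int j + x / \<delta>\<bar>"
        unfolding m_def by (simp add: abs_if) linarith
      then have "\<bar>\<delta>\<bar> * (\<bar>real_of_int (j + m)\<bar> - 1) \<le> \<bar>\<delta>\<bar> * \<bar>real_of_int j + x / \<delta>\<bar>"
        by (rule mult_left_mono) simp
      ultimately have "- \<bar>\<delta> * real_of_int j + x\<bar> \<le> \<bar>\<delta>\<bar> + - (\<bar>\<delta>\<bar> * \<bar>real_of_int (j + m)\<bar>)"
        by (simp add: algebra_simps)
      then have 1: "2 powr (- \<bar>\<delta> * real_of_int j + x\<bar>) \<le> 2 powr (\<bar>\<delta>\<bar> + - (\<bar>\<delta>\<bar> * \<bar>real_of_int (j + m)\<bar>))"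
        by simp
      have 2: "min (2 powr (\<delta> * real_of_int j + x)) (2 powr (- (\<delta> * real_of_int j + x))) \<le> 2 powr (- \<bar>\<delta> * real_of_int j + x\<bar>)"
        by (simp add: abs_if)
      show ?thesis using order_trans[OF 2 1] by (simp only: powr_add)
    qed
    then have "(\<Sum>j\<in>F. min (2 powr (\<delta> * real_of_int j + x)) (2 powr (- (\<delta> * real_of_int j + x)))) \<le> (\<Sum>j\<in>F. 2 powr \<bar>\<delta>\<bar> * ?f (j + m))"
      by (intro sum_mono)
    also have "\<dots> = 2 powr \<bar>\<delta>\<bar> * (\<Sum>j\<in>(\<lambda>j. j + m) ` F. ?f j)"
      by (subst sum.reindex) (auto simp: sum_distrib_left)
    also have "\<dots> \<le> 2 powr \<bar>\<delta>\<bar> * infsum ?f UNIV"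
      using F by (intro mult_left_mono finite_sum_le_infsum sm) auto
    finally show ?thesis .
  qed
  show thesis
  proof (rule that)
    have "0 \<le> infsum ?f UNIV" by (intro infsum_nonneg) simp
    then show "2 powr \<bar>\<delta>\<bar> * infsum ?f UNIV + 1 > 0" by (simp add: add_nonneg_pos)
    show "(\<Sum>j\<in>F. min (2 powr (\<delta> * real_of_int j + x)) (2 powr (- (\<delta> * real_of_int j + x)))) \<le> 2 powr \<bar>\<delta>\<bar> * infsum ?f UNIV + 1"
      if "finite F" for x and F :: "int set"
      using bound[OF that, of x] by linarith
  qed
qed

lemma lp_block_sum_estimate:
  fixes \<phi> :: "real^'n::finite \<Rightarrow> real" and p q r :: ennreal and s \<sigma> \<theta> :: real
  assumes lp: "littlewood_paley \<phi>" and q: "1 < q" and r: "1 < r" and p: "0 < p" "p < \<infinity>"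
    and \<sigma>: "0 \<le> \<sigma>" "\<sigma> < s"
    and scaling: "real CARD('n) * recip p - \<sigma> =
      \<theta> * (real CARD('n) * recip q) + (1 - \<theta>) * (real CARD('n) * recip r - s)"
    and \<theta>: "0 < \<theta>" "\<theta> < 1 - \<sigma> / s"
    and ne: "s - real CARD('n) * recip r \<noteq> \<sigma> - real CARD('n) * recip p"
  shows "\<exists>C>0. \<forall>v A B. A > 0 \<longrightarrow> B > 0 \<longrightarrow>
    (\<forall>j. lorentz_norm_dist q \<infinity> (lp_block \<phi> j v) < ennreal A) \<longrightarrow>
    (\<forall>j. lorentz_norm_dist r \<infinity> (lp_block \<phi> j v) < ennreal (2 powr (- (real_of_int j * s)) * B)) \<longrightarrow>
    besov_lorentz_norm_dist \<phi> \<sigma> p 1 1 v \<le> ennreal (C * (A powr \<theta> * B powr (1 - \<theta>)))"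
proof -
  define n where "n = real CARD('n)"
  have n: "n > 0" by (simp add: n_def)
  define b where "b = (\<lambda>\<eta>. \<eta> * recip q + (1 - \<eta>) * recip r)"
  define \<kappa> where "\<kappa> = n * recip q - n * recip r + s"
  have q': "0 \<le> recip q" "recip q < 1" and r': "0 \<le> recip r" "recip r < 1" and p': "0 < recip p"
    using recip_less_1[OF q] recip_less_1[OF r] recip_pos[OF p] by auto
  have s: "s > 0" using \<sigma> by linarith
  \<comment> \<open>The total exponent of 2^j in the bound for the j-th term of the Besov norm:
    affine in eta with slope kappa, and zero at theta by the scaling relation.\<close>
  have expo: "\<sigma> - s * (1 - \<eta>) + n * (b \<eta> - recip p) = (\<eta> - \<theta>) * \<kappa>" for \<eta>
    using scaling unfolding b_def \<kappa>_def n_def[symmetric] by (simp add: algebra_simps)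
  \<comment> \<open>kappa = 0 would reduce the scaling relation to n/p - sigma = n/r - s, which
    \<open>ne\<close> excludes.\<close>
  have "\<kappa> \<noteq> 0"
  proof
    assume "\<kappa> = 0"
    then have "\<theta> * \<kappa> = 0" by simp
    then show False
      using scaling ne unfolding \<kappa>_def n_def[symmetric] by (simp add: algebra_simps)
  qed
  have \<theta>s: "\<theta> * s < s - \<sigma>" using \<theta>(2) s by (simp add: field_simps)
  have \<theta>1: "\<theta> < 1"
  proof -
    have "0 \<le> \<sigma> / s" using \<sigma> s by simp
    then show ?thesis using \<theta>(2) by linarith
  qed
  have b\<theta>: "recip p < b \<theta>"
  proof -
    have "n * (b \<theta> - recip p) = s * (1 - \<theta>) - \<sigma>" using expo[of \<theta>] by simp
    also have "\<dots> > 0" using \<theta>s by (simp add: algebra_simps)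
    finally show ?thesis using n by (simp add: zero_less_mult_iff)
  qed
  \<comment> \<open>Keeps theta + eps and theta - eps in [0, 1] and b above 1/p at both: b is affine
    with slope 1/q - 1/r, of modulus at most 1, and halving gives the strict inequality.\<close>
  define \<epsilon> where "\<epsilon> = min (min \<theta> (1 - \<theta>)) (b \<theta> - recip p) / 2"
  have \<epsilon>: "0 < \<epsilon>" "\<epsilon> \<le> \<theta>" "\<epsilon> \<le> 1 - \<theta>" "\<epsilon> < b \<theta> - recip p"
    using \<theta>(1) \<theta>1 b\<theta> by (auto simp: \<epsilon>_def min_def)
  have b_ok: "recip p < b \<eta> \<and> b \<eta> < 1 \<and> 0 \<le> \<eta> \<and> \<eta> \<le> 1" if \<eta>: "\<eta> = \<theta> + \<epsilon> \<or> \<eta> = \<theta> - \<epsilon>" for \<eta>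
  proof -
    have rng: "0 \<le> \<eta>" "\<eta> \<le> 1" using \<eta> \<epsilon> by auto
    have "b \<eta> - b \<theta> = \<epsilon> * (recip q - recip r) \<or> b \<eta> - b \<theta> = - (\<epsilon> * (recip q - recip r))"
      using \<eta> by (auto simp: b_def algebra_simps)
    then have "\<bar>b \<eta> - b \<theta>\<bar> = \<epsilon> * \<bar>recip q - recip r\<bar>"
      using \<epsilon>(1) by (auto simp: abs_mult)
    also have "\<dots> \<le> \<epsilon> * 1" using q' r' \<epsilon>(1) by (intro mult_left_mono) auto
    finally have "recip p < b \<eta>" using \<epsilon>(4) by linarith
    moreover have "b \<eta> < 1"
    proof -
      have "b \<eta> \<le> \<eta> * max (recip q) (recip r) + (1 - \<eta>) * max (recip q) (recip r)"
        unfolding b_def using rng by (intro add_mono mult_left_mono) auto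
      also have "\<dots> = max (recip q) (recip r)" by (simp add: algebra_simps)
      finally show ?thesis using q' r' by linarith
    qed
    ultimately show ?thesis using rng by simp
  qed
  define bounds where "bounds = (\<lambda>\<eta> C. C > 0 \<and> (\<forall>j (u :: 'n dist) A B. A > 0 \<longrightarrow> B > 0 \<longrightarrow>
    lorentz_norm_dist q \<infinity> (lp_block \<phi> j u) < ennreal A \<longrightarrow>
    lorentz_norm_dist r \<infinity> (lp_block \<phi> j u) < ennreal B \<longrightarrow>
    lorentz_norm_dist p 1 (lp_block \<phi> j u) \<le>
      ennreal (C * (A powr \<eta> * B powr (1 - \<eta>)) * (2 powi j) powr (n * (b \<eta> - recip p)))))"
  have "\<exists>C. bounds \<eta> C" if "\<eta> = \<theta> + \<epsilon> \<or> \<eta> = \<theta> - \<epsilon>" for \<eta>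
    unfolding bounds_def n_def b_def using b_ok[OF that] p' unfolding b_def
    by (intro lp_block_interpolation[OF lp]) auto
  then obtain D where bounds: "\<And>\<eta>. \<eta> = \<theta> + \<epsilon> \<or> \<eta> = \<theta> - \<epsilon> \<Longrightarrow> bounds \<eta> (D \<eta>)"
    by metis
  have D1: "D \<eta> > 0" if "\<eta> = \<theta> + \<epsilon> \<or> \<eta> = \<theta> - \<epsilon>" for \<eta>
    using bounds[OF that] by (simp add: bounds_def)
  have D2: "lorentz_norm_dist p 1 (lp_block \<phi> j u) \<le>
        ennreal (D \<eta> * (A powr \<eta> * B powr (1 - \<eta>)) * (2 powi j) powr (n * (b \<eta> - recip p)))"
    if "\<eta> = \<theta> + \<epsilon> \<or> \<eta> = \<theta> - \<epsilon>" "A > 0" "B > 0"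
      "lorentz_norm_dist q \<infinity> (lp_block \<phi> j u) < ennreal A"
      "lorentz_norm_dist r \<infinity> (lp_block \<phi> j u) < ennreal B"
    for \<eta> j A B and u :: "'n dist"
    using bounds[OF that(1)] that(2-5) unfolding bounds_def by simp
  define E where "E = max (D (\<theta> + \<epsilon>)) (D (\<theta> - \<epsilon>))"
  have E: "E > 0" "D (\<theta> + \<epsilon>) \<le> E" "D (\<theta> - \<epsilon>) \<le> E" using D1 by (auto simp: E_def less_max_iff_disj)
  obtain S where S: "S > 0" "\<And>x F. finite F \<Longrightarrow>
    (\<Sum>j\<in>F. min (2 powr (\<epsilon> * \<kappa> * real_of_int j + x)) (2 powr (- (\<epsilon> * \<kappa> * real_of_int j + x)))) \<le> S"
  proof (rule sum_min_geometric_le)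
    show "\<epsilon> * \<kappa> \<noteq> 0" using \<epsilon>(1) \<open>\<kappa> \<noteq> 0\<close> by simp
  qed (rule that)
  show ?thesis
  proof (intro exI[of _ "E * S"] conjI allI impI)
    show "E * S > 0" using E S by simp
    fix v :: "'n dist" and A B :: real
    assume A: "A > 0" and B: "B > 0"
      and LA: "\<forall>j. lorentz_norm_dist q \<infinity> (lp_block \<phi> j v) < ennreal A"
      and LB: "\<forall>j. lorentz_norm_dist r \<infinity> (lp_block \<phi> j v) < ennreal (2 powr (- (real_of_int j * s)) * B)"
    define T where "T = A powr \<theta> * B powr (1 - \<theta>)"
    have T: "T > 0" using A B by (simp add: T_def)
    \<comment> \<open>A^eta B^(1 - eta) is T times (A/B)^(eta - theta), so A/B enters only as a
      shift x of the exponent of 2, and the sum over j has a bound independent of x.\<close>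
    define x where "x = \<epsilon> * log 2 (A / B)"
    have X: "(A / B) powr \<epsilon> = 2 powr x"
    proof -
      have "2 powr x = (2 powr log 2 (A / B)) powr \<epsilon>" by (simp add: x_def powr_powr mult.commute)
      then show ?thesis using A B by simp
    qed
    \<comment> \<open>The sign tau selects eta = theta + eps or eta = theta - eps;
      \<open>term_le\<close> takes the smaller of the two bounds.\<close>
    have one: "ennreal (2 powr (real_of_int j * \<sigma>)) * lorentz_norm_dist p 1 (lp_block \<phi> j v) \<le>
        ennreal (E * T * 2 powr (\<tau> * (\<epsilon> * \<kappa> * real_of_int j + x)))"
      if \<tau>: "\<tau> = 1 \<or> \<tau> = -1" for j \<tau>
    proof -
      define \<eta> where "\<eta> = \<theta> + \<tau> * \<epsilon>"
      have \<eta>: "\<eta> = \<theta> + \<epsilon> \<or> \<eta> = \<theta> - \<epsilon>" using \<tau> by (auto simp: \<eta>_def)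
      have DE: "D \<eta> \<le> E" using \<eta> E by auto
      let ?j = "real_of_int j"
      have "ennreal (2 powr (?j * \<sigma>)) * lorentz_norm_dist p 1 (lp_block \<phi> j v) \<le> ennreal (2 powr (?j * \<sigma>)) *
          ennreal (D \<eta> * (A powr \<eta> * (2 powr (- (?j * s)) * B) powr (1 - \<eta>)) * (2 powi j) powr (n * (b \<eta> - recip p)))"
        by (intro mult_left_mono D2[OF \<eta>]) (use A B LA LB in auto)
      also have "\<dots> = ennreal (2 powr (?j * \<sigma>) *
          (D \<eta> * (A powr \<eta> * (2 powr (- (?j * s)) * B) powr (1 - \<eta>)) * (2 powi j) powr (n * (b \<eta> - recip p))))"
        using D1[OF \<eta>] by (subst ennreal_mult) auto
      also have "2 powr (?j * \<sigma>) *
          (D \<eta> * (A powr \<eta> * (2 powr (- (?j * s)) * B) powr (1 - \<eta>)) * (2 powi j) powr (n * (b \<eta> - recip p))) =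
          D \<eta> * T * 2 powr (\<tau> * (\<epsilon> * \<kappa> * ?j + x))"
      proof -
        have "(2::real) powi j = 2 powr ?j" by (simp add: powr_real_of_int')
        then have 1: "(2 powi j) powr (n * (b \<eta> - recip p)) = (2::real) powr (?j * (n * (b \<eta> - recip p)))"
          by (simp add: powr_powr)
        have 2: "(2 powr (- (?j * s)) * B) powr (1 - \<eta>) = 2 powr (- (?j * s) * (1 - \<eta>)) * B powr (1 - \<eta>)"
          using B by (simp add: powr_mult powr_powr)
        have 3: "A powr \<eta> * B powr (1 - \<eta>) = T * 2 powr (\<tau> * x)"
        proof -
          have "2 powr (\<tau> * x) = ((A / B) powr \<epsilon>) powr \<tau>" unfolding X by (simp add: powr_powr mult.commute)
          also have "\<dots> = A powr (\<tau> * \<epsilon>) * B powr (- (\<tau> * \<epsilon>))"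
            using A B by (simp add: powr_powr powr_divide powr_minus_divide mult.commute)
          finally have 5: "2 powr (\<tau> * x) = A powr (\<tau> * \<epsilon>) * B powr (- (\<tau> * \<epsilon>))" .
          have "A powr \<eta> = A powr \<theta> * A powr (\<tau> * \<epsilon>)"
            by (simp only: \<eta>_def powr_add)
          moreover have "B powr (1 - \<eta>) = B powr (1 - \<theta>) * B powr (- (\<tau> * \<epsilon>))"
            by (simp add: \<eta>_def algebra_simps flip: powr_add)
          ultimately show ?thesis
            unfolding 5 T_def by (simp only: mult_ac)
        qed
        have 4: "2 powr (?j * \<sigma>) * 2 powr (- (?j * s) * (1 - \<eta>)) * 2 powr (?j * (n * (b \<eta> - recip p))) =
            (2::real) powr (?j * ((\<eta> - \<theta>) * \<kappa>))"
          unfolding expo[symmetric] powr_add[symmetric] by (simp add: algebra_simps)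
        have "2 powr (?j * \<sigma>) *
          (D \<eta> * (A powr \<eta> * (2 powr (- (?j * s)) * B) powr (1 - \<eta>)) * (2 powi j) powr (n * (b \<eta> - recip p))) =
          D \<eta> * (A powr \<eta> * B powr (1 - \<eta>)) *
          (2 powr (?j * \<sigma>) * 2 powr (- (?j * s) * (1 - \<eta>)) * 2 powr (?j * (n * (b \<eta> - recip p))))"
          unfolding 1 2 by (simp only: mult_ac)
        also have "\<dots> = D \<eta> * T * (2 powr (\<tau> * x) * 2 powr (?j * ((\<eta> - \<theta>) * \<kappa>)))"
          unfolding 3 4 by (simp only: mult_ac)
        also have "2 powr (\<tau> * x) * 2 powr (?j * ((\<eta> - \<theta>) * \<kappa>)) = 2 powr (\<tau> * (\<epsilon> * \<kappa> * ?j + x))"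
          unfolding powr_add[symmetric] \<eta>_def by (simp add: algebra_simps)
        finally show ?thesis .
      qed
      also have "ennreal \<dots> \<le> ennreal (E * T * 2 powr (\<tau> * (\<epsilon> * \<kappa> * ?j + x)))"
        using DE T by (intro ennreal_leI mult_right_mono) auto
      finally show ?thesis .
    qed
    have term_le: "ennreal (2 powr (real_of_int j * \<sigma>)) * lorentz_norm_dist p 1 (lp_block \<phi> j v) \<le>
        ennreal (E * T * min (2 powr (\<epsilon> * \<kappa> * real_of_int j + x)) (2 powr (- (\<epsilon> * \<kappa> * real_of_int j + x))))" for j
      using one[of 1 j] one[of "-1" j] by (auto simp: min_def)
    have "besov_lorentz_norm_dist \<phi> \<sigma> p 1 1 v =
        (SUP F\<in>{F. finite F \<and> F \<subseteq> UNIV}. \<Sum>j\<in>F. ennreal (2 powr (real_of_int j * \<sigma>)) * lorentz_norm_dist p 1 (lp_block \<phi> j v))"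
      unfolding besov_lorentz_norm_dist_def lr_norm_1 by (rule nonneg_infsum_complete) simp
    also have "\<dots> \<le> ennreal (E * S * T)"
    proof (rule SUP_least)
      fix F :: "int set" assume "F \<in> {F. finite F \<and> F \<subseteq> UNIV}"
      then have F: "finite F" by simp
      let ?m = "\<lambda>j::int. min (2 powr (\<epsilon> * \<kappa> * real_of_int j + x)) (2 powr (- (\<epsilon> * \<kappa> * real_of_int j + x)))"
      have "(\<Sum>j\<in>F. ennreal (2 powr (real_of_int j * \<sigma>)) * lorentz_norm_dist p 1 (lp_block \<phi> j v)) \<le>
          (\<Sum>j\<in>F. ennreal (E * T * ?m j))"
        by (intro sum_mono term_le)
      also have "\<dots> = ennreal (\<Sum>j\<in>F. E * T * ?m j)"
        using E T by (intro sum_ennreal) simp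
      also have "\<dots> \<le> ennreal (E * S * T)"
      proof (rule ennreal_leI)
        have "(\<Sum>j\<in>F. E * T * ?m j) = E * T * (\<Sum>j\<in>F. ?m j)" by (simp add: sum_distrib_left)
        also have "\<dots> \<le> E * T * S" using E T by (intro mult_left_mono S(2) F) auto
        finally show "(\<Sum>j\<in>F. E * T * ?m j) \<le> E * S * T" by (simp add: mult_ac)
      qed
      finally show "(\<Sum>j\<in>F. ennreal (2 powr (real_of_int j * \<sigma>)) * lorentz_norm_dist p 1 (lp_block \<phi> j v)) \<le> ennreal (E * S * T)" .
    qed
    finally show "besov_lorentz_norm_dist \<phi> \<sigma> p 1 1 v \<le> ennreal (E * S * (A powr \<theta> * B powr (1 - \<theta>)))"
      by (simp add: T_def)
  qed
qed

text \<open>The summed estimate wants positive A and B strictly above the block norms, whereas a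
  Besov norm may be 0 or attained by a block. Both are enlarged by e and e tends to 0; positivity of
  both exponents makes the powers continuous even at 0.\<close>

lemma le_powr_mult_if_le_perturbed:
  fixes a b C \<theta> :: real and x :: ennreal
  assumes "a \<ge> 0" "b \<ge> 0" "0 < \<theta>" "\<theta> < 1"
    and le: "\<And>e. e > 0 \<Longrightarrow> x \<le> ennreal (C * ((a + e) powr \<theta> * (b + e) powr (1 - \<theta>)))"
  shows "x \<le> ennreal (C * (a powr \<theta> * b powr (1 - \<theta>)))"
proof (rule LIMSEQ_le_const)
  let ?e = "\<lambda>k. inverse (real (Suc k))"
  show "(\<lambda>k. ennreal (C * ((a + ?e k) powr \<theta> * (b + ?e k) powr (1 - \<theta>)))) \<longlonglongrightarrow> ennreal (C * (a powr \<theta> * b powr (1 - \<theta>)))"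
  proof (intro tendsto_ennrealI tendsto_mult tendsto_const)
    have lim: "(\<lambda>k. c + ?e k) \<longlonglongrightarrow> c" for c
      using tendsto_add[OF tendsto_const LIMSEQ_inverse_real_of_nat, of c] by simp
    show "(\<lambda>k. (a + ?e k) powr \<theta>) \<longlonglongrightarrow> a powr \<theta>"
      by (rule tendsto_powr'[OF lim tendsto_const]) (use assms in auto)
    show "(\<lambda>k. (b + ?e k) powr (1 - \<theta>)) \<longlonglongrightarrow> b powr (1 - \<theta>)"
      by (rule tendsto_powr'[OF lim tendsto_const]) (use assms in auto)
  qed
  show "\<exists>N. \<forall>k\<ge>N. x \<le> ennreal (C * ((a + ?e k) powr \<theta> * (b + ?e k) powr (1 - \<theta>)))"
    by (intro exI[of _ 0] allI impI le) simp
qed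

theorem theorem1p2:
  fixes \<phi> :: "real^'n::finite \<Rightarrow> real"
    and p q r :: ennreal
    and s \<sigma> :: real
  assumes "littlewood_paley \<phi>"
    and "1 < q" and "1 < r"
    and "0 < p" and "p < \<infinity>"
    and "0 \<le> \<sigma>" and "\<sigma> < s"
  shows "\<exists>C::real. C > 0 \<and>
    (\<forall>\<theta>::real.
      real CARD('n) * recip p - \<sigma> =
        \<theta> * (real CARD('n) * recip q) + (1 - \<theta>) * (real CARD('n) * recip r - s) \<and>
      0 < \<theta> \<and> \<theta> < 1 - \<sigma> / s \<and>
      s - real CARD('n) * recip r \<noteq> \<sigma> - real CARD('n) * recip p \<longrightarrow>
      (\<forall>u \<in> besov_lorentz \<phi> s r \<infinity> \<infinity> \<inter> besov_lorentz \<phi> 0 q \<infinity> \<infinity>.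
        besov_lorentz_norm \<phi> \<sigma> p 1 1 u
          \<le> ennreal C * ennpowr (besov_lorentz_norm \<phi> 0 q \<infinity> \<infinity> u) \<theta>
                      * ennpowr (besov_lorentz_norm \<phi> s r \<infinity> \<infinity> u) (1 - \<theta>)))"
proof -
  let ?n = "real CARD('n)"
  define admissible where "admissible = (\<lambda>\<theta>. ?n * recip p - \<sigma> =
        \<theta> * (?n * recip q) + (1 - \<theta>) * (?n * recip r - s) \<and>
      0 < \<theta> \<and> \<theta> < 1 - \<sigma> / s \<and> s - ?n * recip r \<noteq> \<sigma> - ?n * recip p)"
  \<comment> \<open>C is chosen before theta, so theta must be determined by the other parameters:
    the scaling relation prescribes theta * kappa, and its value is nonzero.\<close>
  have unique: "\<theta> = \<theta>'" if "admissible \<theta>" "admissible \<theta>'" for \<theta> \<theta>'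
  proof -
    define \<kappa> where "\<kappa> = ?n * recip q - ?n * recip r + s"
    have "\<theta> * \<kappa> = ?n * recip p - \<sigma> - ?n * recip r + s" "\<theta>' * \<kappa> = ?n * recip p - \<sigma> - ?n * recip r + s"
      using that by (auto simp: admissible_def \<kappa>_def algebra_simps)
    moreover have "?n * recip p - \<sigma> - ?n * recip r + s \<noteq> 0" using that by (auto simp: admissible_def)
    ultimately show ?thesis by (metis mult_cancel_right mult_zero_right)
  qed
  have estimate: "\<exists>C>0. \<forall>u \<in> besov_lorentz \<phi> s r \<infinity> \<infinity> \<inter> besov_lorentz \<phi> 0 q \<infinity> \<infinity>.
        besov_lorentz_norm \<phi> \<sigma> p 1 1 u
          \<le> ennreal C * ennpowr (besov_lorentz_norm \<phi> 0 q \<infinity> \<infinity> u) \<theta>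
                      * ennpowr (besov_lorentz_norm \<phi> s r \<infinity> \<infinity> u) (1 - \<theta>)" if \<theta>: "admissible \<theta>" for \<theta>
  proof -
    have s: "s > 0" using assms(6,7) by linarith
    have \<theta>01: "0 < \<theta>" "\<theta> < 1"
    proof -
      show "0 < \<theta>" using \<theta> by (simp add: admissible_def)
      have "0 \<le> \<sigma> / s" using assms(6) s by simp
      moreover have "\<theta> < 1 - \<sigma> / s" using \<theta> by (simp add: admissible_def)
      ultimately show "\<theta> < 1" by linarith
    qed
    obtain C where C: "C > 0" "\<And>v A B. A > 0 \<Longrightarrow> B > 0 \<Longrightarrow>
      (\<And>j. lorentz_norm_dist q \<infinity> (lp_block \<phi> j v) < ennreal A) \<Longrightarrow>
      (\<And>j. lorentz_norm_dist r \<infinity> (lp_block \<phi> j v) < ennreal (2 powr (- (real_of_int j * s)) * B)) \<Longrightarrow>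
      besov_lorentz_norm_dist \<phi> \<sigma> p 1 1 v \<le> ennreal (C * (A powr \<theta> * B powr (1 - \<theta>)))"
      using lp_block_sum_estimate[OF assms, of \<theta>] \<theta> unfolding admissible_def by metis
    show ?thesis
    proof (intro exI[of _ C] conjI ballI C(1))
      fix u assume u: "u \<in> besov_lorentz \<phi> s r \<infinity> \<infinity> \<inter> besov_lorentz \<phi> 0 q \<infinity> \<infinity>"
      \<comment> \<open>All three Besov norms of the class are evaluated at this same
        representative, so the estimate for distributions transfers to the class.\<close>
      define v where "v = (SOME w. w \<in> u)"
      define a where "a = enn2real (besov_lorentz_norm \<phi> 0 q \<infinity> \<infinity> u)"
      define b where "b = enn2real (besov_lorentz_norm \<phi> s r \<infinity> \<infinity> u)"
      have a: "besov_lorentz_norm \<phi> 0 q \<infinity> \<infinity> u = ennreal a" "a \<ge> 0"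
        and b: "besov_lorentz_norm \<phi> s r \<infinity> \<infinity> u = ennreal b" "b \<ge> 0"
        using u by (auto simp: besov_lorentz_def a_def b_def less_top)
      have a_le: "lorentz_norm_dist q \<infinity> (lp_block \<phi> j v) \<le> ennreal a" for j
      proof -
        have "ennreal (2 powr (real_of_int j * 0)) * lorentz_norm_dist q \<infinity> (lp_block \<phi> j v) \<le> besov_lorentz_norm \<phi> 0 q \<infinity> \<infinity> u"
          unfolding besov_lorentz_norm_def besov_lorentz_norm_dist_def lr_norm_def v_def
          by (simp, rule SUP_upper[of j UNIV], simp)
        then show ?thesis unfolding a(1) by simp
      qed
      have b_le: "lorentz_norm_dist r \<infinity> (lp_block \<phi> j v) \<le> ennreal (2 powr (- (real_of_int j * s)) * b)" for j
      proof -
        have "ennreal (2 powr (real_of_int j * s)) * lorentz_norm_dist r \<infinity> (lp_block \<phi> j v) \<le> besov_lorentz_norm \<phi> s r \<infinity> \<infinity> u"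
          unfolding besov_lorentz_norm_def besov_lorentz_norm_dist_def lr_norm_def v_def
          by (simp, rule SUP_upper[of j UNIV], simp)
        then have "lorentz_norm_dist r \<infinity> (lp_block \<phi> j v) \<le> ennreal (b / 2 powr (real_of_int j * s))"
          unfolding b(1) using b(2) by (intro ennreal_le_if_mult_le) auto
        then show ?thesis by (simp add: powr_minus divide_inverse mult.commute)
      qed
      have "besov_lorentz_norm \<phi> \<sigma> p 1 1 u \<le> ennreal (C * (a powr \<theta> * b powr (1 - \<theta>)))"
      proof (rule le_powr_mult_if_le_perturbed[OF a(2) b(2) \<theta>01])
        fix e :: real assume e: "e > 0"
        show "besov_lorentz_norm \<phi> \<sigma> p 1 1 u \<le> ennreal (C * ((a + e) powr \<theta> * (b + e) powr (1 - \<theta>)))"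
          unfolding besov_lorentz_norm_def v_def[symmetric]
        proof (rule C(2))
          show "lorentz_norm_dist q \<infinity> (lp_block \<phi> j v) < ennreal (a + e)" for j
            using a(2) e by (intro le_less_trans[OF a_le] ennreal_lessI) auto
          show "lorentz_norm_dist r \<infinity> (lp_block \<phi> j v) < ennreal (2 powr (- (real_of_int j * s)) * (b + e))" for j
            using b(2) e by (intro le_less_trans[OF b_le] ennreal_lessI) auto
        qed (use a b e in auto)
      qed
      also have "\<dots> = ennreal C * ennpowr (besov_lorentz_norm \<phi> 0 q \<infinity> \<infinity> u) \<theta>
                      * ennpowr (besov_lorentz_norm \<phi> s r \<infinity> \<infinity> u) (1 - \<theta>)"
        unfolding a(1) b(1) using C(1) a(2) b(2) by (simp add: ennpowr_def ennreal_mult mult.assoc)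
      finally show "besov_lorentz_norm \<phi> \<sigma> p 1 1 u
          \<le> ennreal C * ennpowr (besov_lorentz_norm \<phi> 0 q \<infinity> \<infinity> u) \<theta>
                      * ennpowr (besov_lorentz_norm \<phi> s r \<infinity> \<infinity> u) (1 - \<theta>)" .
    qed
  qed
  show ?thesis
  \<comment> \<open>If no theta is admissible, the claim is vacuous and any positive constant
    serves.\<close>
  proof (cases "\<exists>\<theta>. admissible \<theta>")
    case True
    then obtain \<theta>\<^sub>0 where \<theta>\<^sub>0: "admissible \<theta>\<^sub>0" by blast
    from estimate[OF this] show ?thesis
      using unique[OF \<theta>\<^sub>0] unfolding admissible_def by metis
  next
    case False
    then show ?thesis unfolding admissible_def by (intro exI[of _ 1]) auto
  qed
qed

end
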